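(* Let $\alpha\in(0,1)$, $\sigma=1-\alpha/2$, $T>0$, and let $\Omega\subset\mathbb R^d$ be a bounded Lipschitz domain. Let $u$ be the solution of the subdiffusion problem $$\partial_t^\alpha u=\Delta u+f\ \text{in }(0,\infty)\times\Omega,\qquad u=0\ \text{on }(0,\infty)\times\partial\Omega,\qquad u(0,\cdot)=u^0\ \text{in }\Omega,$$ where $\partial_t^\alpha u(t)=\frac{1}{\Gamma(1-\alpha)}\int_0^t(t-s)^{-\alpha}u'(s)\,\mathrm ds$, and assume $u\in C^3((0,T],H_0^1(\Omega))$ with $\|\partial_t^m u(t)\|_{H^1(\Omega)}\le C_m(1+t^{\alpha-m})$ for $m=1,2,3$ and $0<t\le T$. Let $0=t_0<t_1<\cdots$ be a time mesh with $\tau_j=t_j-t_{j-1}$, $\rho_j=\tau_j/\tau_{j-1}$ satisfying $\rho_k\ge\eta$ for all $k\ge2$, and let $u^k$, $k\ge1$, be the solution of the L2-1$_\sigma$ scheme $$L_k^{\alpha,*}u=(1-\alpha/2)\Delta u^k+(\alpha/2)\Delta u^{k-1}+f(t_k^*,\cdot)\ \text{in }\Omega,\qquad u^k=0\ \text{on }\partial\Omega,$$ starting from the same $u^0$. Then for every $n$ with $t_n\le T$, $$\max_{1\le k\le n}\|u(t_k)-u^k\|_{L^2(\Omega)}\le C\Big(t_2^\alpha/\alpha+t_2+\frac{1}{1-\alpha}\max_{2\le k\le n}(1+\rho_{k+1})(1+t_{k-1}^{\alpha-3})(t_{k-1}^* )^\alpha\tau_k^3\tau_{k-1}^{-\alpha}+(\tau_1^\alpha/\alpha+\tau_1)\tau_1^{\alpha/2}+\sqrt{\Gamma(1-\alpha)}\max_{2\le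 k\le n}(t_k^* )^{\alpha/2}(1+t_{k-1}^{\alpha-2})\tau_k^2\Big),$$ where $C$ is a constant depending only on $C_1,C_2,C_3$ and $\Omega$.
   Context: Notation: $t_k^*=t_{k-1}+\sigma\tau_k$. For $k\ge2$ and $1\le j\le k-1$ define $$a_j^k=\int_0^1\frac{-2\tau_j(1-\theta)-\tau_{j+1}}{(\tau_j+\tau_{j+1})\,(t_k^*-t_{j-1}-\theta\tau_j)^\alpha}\,\mathrm d\theta,\qquad c_j^k=\int_0^1\frac{\tau_j^2(2\theta-1)}{\tau_{j+1}(\tau_j+\tau_{j+1})\,(t_k^*-t_{j-1}-\theta\tau_j)^\alpha}\,\mathrm d\theta,$$ and $d_j^k=c_{j-1}^k-a_j^k$ for $2\le j\le k-1$; by convention $a_1^1=0$, $c_0^1=0$. With $\delta_j u=u^j-u^{j-1}$, $$L_k^{\alpha,*}u=\frac{1}{\Gamma(1-\alpha)}\Big(c_{k-1}^k\delta_k u-a_1^k\delta_1u+\sum_{j=2}^{k-1}d_j^k\delta_j u\Big)+\frac{\sigma^{1-\alpha}}{\Gamma(2-\alpha)\tau_k^\alpha}\delta_k u.$$ $\eta\approx0.475329$ is the unique positive root of $1-3\rho^2(1+\rho)=0$. *)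

theory Defs
  imports "HOL-Analysis.Analysis"
begin

definition lipschitz_domain :: "'d::euclidean_space set \<Rightarrow> bool" where
  "lipschitz_domain \<Omega> \<longleftrightarrow> open \<Omega> \<and> connected \<Omega> \<and> \<Omega> \<noteq> {} \<and>
     (\<forall>p\<in>frontier \<Omega>. \<exists>r>0. \<exists>e L g. norm e = 1 \<and>
        L-lipschitz_on {y. y \<bullet> e = 0} (g :: 'd \<Rightarrow> real) \<and>
        (\<forall>x\<in>ball p r. x \<in> \<Omega> \<longleftrightarrow>
            (x - p) \<bullet> e < g ((x - p) - ((x - p) \<bullet> e) *\<^sub>R e)))"

definition pdiff :: "'d::euclidean_space \<Rightarrow> ('d \<Rightarrow> real) \<Rightarrow> 'd \<Rightarrow> real" where
  "pdiff i f x = frechet_derivative f (at x) i"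

definition smooth_fun :: "('d::euclidean_space \<Rightarrow> real) \<Rightarrow> bool" where
  "smooth_fun f \<longleftrightarrow> (\<forall>is. set is \<subseteq> Basis \<longrightarrow>
       (\<forall>x. foldr pdiff is f differentiable (at x)))"

definition test_fun :: "'d::euclidean_space set \<Rightarrow> ('d \<Rightarrow> real) \<Rightarrow> bool" where
  "test_fun \<Omega> \<phi> \<longleftrightarrow> smooth_fun \<phi> \<and> compact (closure {x. \<phi> x \<noteq> 0}) \<and>
     closure {x. \<phi> x \<noteq> 0} \<subseteq> \<Omega>"

definition L2 :: "'d::euclidean_space set \<Rightarrow> ('d \<Rightarrow> real) \<Rightarrow> bool" where
  "L2 \<Omega> v \<longleftrightarrow> v \<in> borel_measurable (lebesgue_on \<Omega>) \<and>
     set_integrable lebesgue \<Omega> (\<lambda>x. (v x)\<^sup>2)"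

definition L2norm :: "'d::euclidean_space set \<Rightarrow> ('d \<Rightarrow> real) \<Rightarrow> real" where
  "L2norm \<Omega> v = sqrt (\<integral>x\<in>\<Omega>. (v x)\<^sup>2 \<partial>lebesgue)"

definition L2inner :: "'d::euclidean_space set \<Rightarrow> ('d \<Rightarrow> real) \<Rightarrow> ('d \<Rightarrow> real) \<Rightarrow> real" where
  "L2inner \<Omega> v w = (\<integral>x\<in>\<Omega>. v x * w x \<partial>lebesgue)"

definition is_weak_grad :: "'d::euclidean_space set \<Rightarrow> ('d \<Rightarrow> real) \<Rightarrow> ('d \<Rightarrow> 'd) \<Rightarrow> bool" where
  "is_weak_grad \<Omega> v G \<longleftrightarrow> (\<forall>\<phi>. test_fun \<Omega> \<phi> \<longrightarrow> (\<forall>i\<in>Basis.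
      (\<integral>x\<in>\<Omega>. v x * pdiff i \<phi> x \<partial>lebesgue) = - (\<integral>x\<in>\<Omega>. (G x \<bullet> i) * \<phi> x \<partial>lebesgue)))"

definition H1 :: "'d::euclidean_space set \<Rightarrow> ('d \<Rightarrow> real) \<Rightarrow> bool" where
  "H1 \<Omega> v \<longleftrightarrow> L2 \<Omega> v \<and> (\<exists>G. is_weak_grad \<Omega> v G \<and> (\<forall>i\<in>Basis. L2 \<Omega> (\<lambda>x. G x \<bullet> i)))"

definition wgrad :: "'d::euclidean_space set \<Rightarrow> ('d \<Rightarrow> real) \<Rightarrow> 'd \<Rightarrow> 'd" where
  "wgrad \<Omega> v = (SOME G. is_weak_grad \<Omega> v G \<and> (\<forall>i\<in>Basis. L2 \<Omega> (\<lambda>x. G x \<bullet> i)))"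

definition H1norm :: "'d::euclidean_space set \<Rightarrow> ('d \<Rightarrow> real) \<Rightarrow> real" where
  "H1norm \<Omega> v = sqrt ((L2norm \<Omega> v)\<^sup>2 + (\<integral>x\<in>\<Omega>. (norm (wgrad \<Omega> v x))\<^sup>2 \<partial>lebesgue))"

definition dform :: "'d::euclidean_space set \<Rightarrow> ('d \<Rightarrow> real) \<Rightarrow> ('d \<Rightarrow> real) \<Rightarrow> real" where
  "dform \<Omega> v w = (\<integral>x\<in>\<Omega>. wgrad \<Omega> v x \<bullet> wgrad \<Omega> w x \<partial>lebesgue)"

definition H01 :: "'d::euclidean_space set \<Rightarrow> ('d \<Rightarrow> real) \<Rightarrow> bool" where
  "H01 \<Omega> v \<longleftrightarrow> H1 \<Omega> v \<and> (\<exists>\<phi>. (\<forall>n. test_fun \<Omega> (\<phi> n)) \<and>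
       (\<lambda>n. H1norm \<Omega> (\<lambda>x. v x - \<phi> n x)) \<longlonglongrightarrow> 0)"

definition H1_deriv_on :: "'d::euclidean_space set \<Rightarrow> real \<Rightarrow> (real \<Rightarrow> 'd \<Rightarrow> real) \<Rightarrow> (real \<Rightarrow> 'd \<Rightarrow> real) \<Rightarrow> bool" where
  "H1_deriv_on \<Omega> T U D \<longleftrightarrow> (\<forall>t\<in>{0<..T}.
     ((\<lambda>s. H1norm \<Omega> (\<lambda>x. (U s x - U t x) / (s - t) - D t x)) \<longlongrightarrow> 0) (at t within {0<..T}))"

definition H1_cont_on :: "'d::euclidean_space set \<Rightarrow> real \<Rightarrow> (real \<Rightarrow> 'd \<Rightarrow> real) \<Rightarrow> bool" where
  "H1_cont_on \<Omega> T U \<longleftrightarrow> (\<forall>t\<in>{0<..T}.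
     ((\<lambda>s. H1norm \<Omega> (\<lambda>x. U s x - U t x)) \<longlongrightarrow> 0) (at t within {0<..T}))"

definition eta :: real where
  "eta = (THE \<rho>. \<rho> > 0 \<and> 1 - 3 * \<rho>\<^sup>2 * (1 + \<rho>) = 0)"

definition tau :: "(nat \<Rightarrow> real) \<Rightarrow> nat \<Rightarrow> real" where
  "tau t j = t j - t (j - 1)"

definition rho :: "(nat \<Rightarrow> real) \<Rightarrow> nat \<Rightarrow> real" where
  "rho t j = tau t j / tau t (j - 1)"

definition tstar :: "real \<Rightarrow> (nat \<Rightarrow> real) \<Rightarrow> nat \<Rightarrow> real" where
  "tstar \<alpha> t k = t (k - 1) + (1 - \<alpha> / 2) * tau t k"

definition coef_a :: "real \<Rightarrow> (nat \<Rightarrow> real) \<Rightarrow> nat \<Rightarrow> nat \<Rightarrow> real" where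
  "coef_a \<alpha> t j k = (if k = 1 then 0 else
     (LBINT \<theta>=0..1. (- 2 * tau t j * (1 - \<theta>) - tau t (j + 1)) /
        ((tau t j + tau t (j + 1)) * (tstar \<alpha> t k - t (j - 1) - \<theta> * tau t j) powr \<alpha>)))"

definition coef_c :: "real \<Rightarrow> (nat \<Rightarrow> real) \<Rightarrow> nat \<Rightarrow> nat \<Rightarrow> real" where
  "coef_c \<alpha> t j k = (if k = 1 then 0 else
     (LBINT \<theta>=0..1. ((tau t j)\<^sup>2 * (2 * \<theta> - 1)) /
        (tau t (j + 1) * (tau t j + tau t (j + 1)) * (tstar \<alpha> t k - t (j - 1) - \<theta> * tau t j) powr \<alpha>)))"

definition coef_d :: "real \<Rightarrow> (nat \<Rightarrow> real) \<Rightarrow> nat \<Rightarrow> nat \<Rightarrow> real" where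
  "coef_d \<alpha> t j k = coef_c \<alpha> t (j - 1) k - coef_a \<alpha> t j k"

definition Lstar :: "real \<Rightarrow> (nat \<Rightarrow> real) \<Rightarrow> (nat \<Rightarrow> 'd \<Rightarrow> real) \<Rightarrow> nat \<Rightarrow> 'd \<Rightarrow> real" where
  "Lstar \<alpha> t U k x =
     (let \<sigma> = 1 - \<alpha> / 2; \<delta> = (\<lambda>j. U j x - U (j - 1) x) in
      (1 / Gamma (1 - \<alpha>)) * (coef_c \<alpha> t (k - 1) k * \<delta> k - coef_a \<alpha> t 1 k * \<delta> 1
          + (\<Sum>j=2..k-1. coef_d \<alpha> t j k * \<delta> j))
      + \<sigma> powr (1 - \<alpha>) / (Gamma (2 - \<alpha>) * tau t k powr \<alpha>) * \<delta> k)"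

definition maxk :: "nat set \<Rightarrow> (nat \<Rightarrow> real) \<Rightarrow> real" where
  "maxk K g = Max (insert 0 (g ` K))"

end

theory Submission
  imports Defs
begin

text \<open>
  Write \<open>\<Gamma>(1 - \<alpha>) L\<^sub>k u = \<Sum>\<^sub>j A(k,j) \<delta>\<^sub>j u\<close> and \<open>w(s) = (t\<^sup>* - s)\<^sup>-\<^sup>\<alpha>\<close> with \<open>t\<^sup>*\<close> the \<open>k\<close>-th collocation
  point.  The weights are moments of the convex function \<open>w\<close>, and \<open>3\<rho>\<^sup>2(1 + \<rho>) \<ge> 1\<close> is what makes
  \<open>A(k,j) \<le> w(t j) \<le> A(k,j+1)\<close>, with a gap that dominates \<open>w(t j) - w(t (j-1))\<close>.  Monotonicity of
  the weights gives the energy inequality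
  \<open>\<Sum>\<^sub>j A(k,j) \<delta>\<^sub>j\<parallel>e\<parallel>\<^sup>2 \<le> 2 \<Sum>\<^sub>j A(k,j) (\<delta>\<^sub>j e, \<sigma> e k + (1 - \<sigma>) e (k-1))\<close>.
  Integrating by parts on each interval bounds the truncation error by
  \<open>\<Sum>\<^sub>j G j (A(k,j+1) - A(k,j)) + H k A(k,k)\<close>, where \<open>G j\<close> is the interpolation error on the \<open>j\<close>-th
  interval; on the last interval the choice of \<open>\<sigma>\<close> kills the linear part of the error.  A bound of
  this shape is absorbed by the discrete supersolution \<open>P - c G j\<close>, so that \<open>E = max \<parallel>e k\<parallel>\<close>
  satisfies \<open>E\<^sup>2 \<le> 2ES + q\<^sup>2\<close> and hence \<open>E \<le> 2S + q\<close>.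
\<close>

section \<open>Smooth bump functions\<close>

text \<open>\<open>wgrad\<close> picks one of many weak gradients, so even its linearity rests on
  uniqueness almost everywhere, that is, on the fundamental lemma of the calculus of variations; the
  smooth bumps serve that lemma. No calculus for H1-valued functions is built: the solution enters
  only through scalar functions of time, its L2 pairing and its Dirichlet pairing with a fixed
  \<open>v\<close>. The truncation error is estimated for the L2 pairing and produces S. The error
  of averaging the Laplacian in time is estimated for the Dirichlet pairing, relative to the
  gradient norm of \<open>v\<close>; Young's inequality hides it in the dissipation, so it enters
  squared, with a factor \<Gamma>(1 - \<alpha>), and produces q. Time 0 is the obstacle. The bounds
  on the second and third derivative are not integrable there, so the first interval is treated
  through increments alone, measured by \<open>N s = s + s powr \<alpha> / \<alpha>\<close>.
  Moreover the initial value is attained only in L2, while the Dirichlet pairing has to be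
  continuous at 0 as well; bounded gradients and density of test functions give the weak convergence
  that is needed.\<close>

lemma smooth_fun_coinduct:
  assumes "f \<in> F"
    and "\<And>f x. f \<in> F \<Longrightarrow> f differentiable (at x)"
    and "\<And>f i. f \<in> F \<Longrightarrow> i \<in> Basis \<Longrightarrow> pdiff i f \<in> F"
  shows "smooth_fun f"
proof -
  \<comment> \<open>Iterated partial derivatives never leave \<open>F\<close>, so smoothness reduces
    to exhibiting one family of differentiable functions that is closed under
    differentiation.\<close>
  have "set bs \<subseteq> Basis \<Longrightarrow> foldr pdiff bs f \<in> F" for bs
    by (induction bs) (auto simp: assms)
  then show ?thesis
    using assms(2) by (auto simp: smooth_fun_def)
qed

lemma smooth_fun_differentiable: "smooth_fun f \<Longrightarrow> f differentiable (at x)"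
  unfolding smooth_fun_def by (drule spec[where x="[]"]) auto

lemma smooth_fun_pdiff:
  assumes "smooth_fun f" "i \<in> Basis"
  shows "smooth_fun (pdiff i f)"
  unfolding smooth_fun_def
proof (intro allI impI)
  fix bs :: "'a list" and x assume "set bs \<subseteq> Basis"
  then have "set (bs @ [i]) \<subseteq> Basis" using assms by auto
  then have "foldr pdiff (bs @ [i]) f differentiable (at x)"
    using assms(1) unfolding smooth_fun_def by blast
  then show "foldr pdiff bs (pdiff i f) differentiable (at x)" by simp
qed

lemma pdiff_eq: "(f has_derivative f') (at x) \<Longrightarrow> pdiff i f x = f' i"
  unfolding pdiff_def by (metis frechet_derivative_at)

lemma pdiff_lin:
  assumes "f differentiable (at x)" "g differentiable (at x)"
  shows "pdiff i (\<lambda>x. a * f x + b * g x) x = a * pdiff i f x + b * pdiff i g x"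
proof -
  from assms obtain f' g' where d: "(f has_derivative f') (at x)" "(g has_derivative g') (at x)"
    by (auto simp: differentiable_def)
  have "((\<lambda>x. a * f x + b * g x) has_derivative (\<lambda>h. a * f' h + b * g' h)) (at x)"
    by (auto intro!: derivative_eq_intros d)
  with d show ?thesis by (simp add: pdiff_eq)
qed

lemma pdiff_mult:
  assumes "f differentiable (at x)" "g differentiable (at x)"
  shows "pdiff i (\<lambda>x. f x * g x) x = f x * pdiff i g x + pdiff i f x * g x"
proof -
  from assms obtain f' g' where d: "(f has_derivative f') (at x)" "(g has_derivative g') (at x)"
    by (auto simp: differentiable_def)
  have "((\<lambda>x. f x * g x) has_derivative (\<lambda>h. f x * g' h + f' h * g x)) (at x)"
    by (auto intro!: derivative_eq_intros d)
  from pdiff_eq[OF this] pdiff_eq[OF d(1)] pdiff_eq[OF d(2)] show ?thesis by simp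
qed

lemma smooth_fun_lin:
  assumes "smooth_fun f" "smooth_fun g"
  shows "smooth_fun (\<lambda>x. a * f x + b * g x)"
proof (rule smooth_fun_coinduct[where F="{(\<lambda>x. a * f x + b * g x) | f g. smooth_fun f \<and> smooth_fun g}"])
  show "(\<lambda>x. a * f x + b * g x) \<in> {(\<lambda>x. a * f x + b * g x) | f g. smooth_fun f \<and> smooth_fun g}"
    using assms by blast
next
  fix h x assume "h \<in> {(\<lambda>x. a * f x + b * g x) | f g. smooth_fun f \<and> smooth_fun g}"
  then obtain f g where "smooth_fun f" "smooth_fun g" "h = (\<lambda>x. a * f x + b * g x)" by blast
  then show "h differentiable (at x)"
    by (simp add: smooth_fun_differentiable)
next
  fix h :: "'a \<Rightarrow> real" and i :: 'a assume h: "h \<in> {(\<lambda>x. a * f x + b * g x) | f g. smooth_fun f \<and> smooth_fun g}" and i: "i \<in> Basis"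
  then obtain f g where fg: "smooth_fun f" "smooth_fun g" "h = (\<lambda>x. a * f x + b * g x)" by blast
  have "pdiff i h = (\<lambda>x. a * pdiff i f x + b * pdiff i g x)"
    by (auto simp: fg pdiff_lin smooth_fun_differentiable)
  with fg i show "pdiff i h \<in> {(\<lambda>x. a * f x + b * g x) | f g. smooth_fun f \<and> smooth_fun g}"
    using smooth_fun_pdiff by blast
qed

text \<open>Differentiating exp (- c / y) produces powers of 1 / y; carrying a polynomial in 1 / y
  along keeps the family closed under differentiation. For c > 0 the exponential is flat at 0, which
  makes the extension by 0 smooth.\<close>

definition expbump :: "real poly \<Rightarrow> real \<Rightarrow> real \<Rightarrow> real" where
  "expbump p c y = (if y \<le> 0 then 0 else poly p (1 / y) * exp (- c / y))"

lemma poly_exp_tendsto_0: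
  fixes p :: "real poly" assumes "c > 0"
  shows "((\<lambda>z. poly p z * exp (- (c * z))) \<longlongrightarrow> 0) at_top"
proof -
  have 1: "((\<lambda>z. z ^ i * exp (- (c * z))) \<longlongrightarrow> 0) at_top" for i
  proof -
    have "filterlim (\<lambda>z. c * z) at_top at_top"
      using assms by (intro filterlim_tendsto_pos_mult_at_top[OF tendsto_const]) (auto simp: filterlim_ident)
    from filterlim_compose[OF tendsto_power_div_exp_0[of i] this]
    have "((\<lambda>z. (1 / c ^ i) * ((c * z) ^ i / exp (c * z))) \<longlongrightarrow> (1 / c ^ i) * 0) at_top"
      by (intro tendsto_mult tendsto_const)
    then show ?thesis
      using assms by (simp add: power_mult_distrib exp_minus field_simps)
  qed
  have "((\<lambda>z. \<Sum>i\<le>degree p. coeff p i * (z ^ i * exp (- (c * z)))) \<longlongrightarrow> (\<Sum>i\<le>degree p. coeff p i * 0)) at_top"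
    by (intro tendsto_sum tendsto_mult tendsto_const 1)
  then show ?thesis
    by (simp add: poly_altdef sum_distrib_right mult.assoc)
qed

text \<open>With z = 1 / y the derivative is z^2 (c p(z) - p'(z)) exp (- c z); the two leading zero
  coefficients supply z^2. At y = 0 the two one-sided difference quotients are treated
  separately.\<close>

lemma expbump_deriv:
  assumes c: "c > 0"
  shows "(expbump p c has_field_derivative expbump (pCons 0 (pCons 0 (smult c p - pderiv p))) c y) (at y)"
proof -
  consider "y > 0" | "y < 0" | "y = 0" by linarith
  then show ?thesis
  proof cases
    case 1
    have "((\<lambda>y. poly p (1 / y) * exp (- c / y)) has_field_derivative
        expbump (pCons 0 (pCons 0 (smult c p - pderiv p))) c y) (at y)"
      using 1 by (auto intro!: derivative_eq_intros DERIV_chain2[OF poly_DERIV]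
          simp: expbump_def field_simps power2_eq_square)
    moreover have "\<forall>\<^sub>F x in nhds y. poly p (1 / x) * exp (- c / x) = expbump p c x"
      using eventually_nhds_in_open[of "{0<..}" y] 1 by (auto elim!: eventually_mono simp: expbump_def)
    ultimately show ?thesis by (metis DERIV_cong_ev)
  next
    case 2
    have "\<forall>\<^sub>F x in nhds y. 0 = expbump p c x"
      using eventually_nhds_in_open[of "{..<0}" y] 2 by (auto elim!: eventually_mono simp: expbump_def)
    then have "(expbump p c has_field_derivative 0) (at y)"
      using DERIV_cong_ev[of y y "\<lambda>_. 0" "expbump p c" 0 0] by simp
    then show ?thesis using 2 by (simp add: expbump_def)
  next
    case 3
    have r: "((\<lambda>h. expbump p c h / h) \<longlongrightarrow> 0) (at_right 0)"
    proof -
      have "filterlim (\<lambda>h::real. inverse h) at_top (at_right 0)"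
        by (rule filterlim_inverse_at_top_right)
      \<comment> \<open>Under z = 1 / h the quotient \<open>expbump p c h / h\<close> becomes z p(z)
        exp (- c z), and \<open>pCons 0 p\<close> is the polynomial z p(z).\<close>
      from filterlim_compose[OF poly_exp_tendsto_0[OF c, of "pCons 0 p"] this]
      have *: "((\<lambda>h. poly (pCons 0 p) (inverse h) * exp (- (c * inverse h))) \<longlongrightarrow> 0) (at_right 0)" .
      show ?thesis
        by (rule Lim_transform_eventually[OF *])
          (auto simp: eventually_at_right_less expbump_def field_simps eventually_at_filter)
    qed
    have l: "((\<lambda>h. expbump p c h / h) \<longlongrightarrow> 0) (at_left 0)"
      by (rule Lim_transform_eventually[OF tendsto_const])
        (auto simp: expbump_def eventually_at_filter)
    have "((\<lambda>h. expbump p c h / h) \<longlongrightarrow> 0) (at 0)"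
      using l r by (simp add: filterlim_at_split)
    then show ?thesis
      using 3 by (simp add: DERIV_def expbump_def)
  qed
qed

text \<open>Closed under partial derivatives, so that its members are smooth.\<close>

inductive_set bumps :: "('d::euclidean_space \<Rightarrow> real) set" where
  atom: "c > 0 \<Longrightarrow> i \<in> Basis \<Longrightarrow> (\<lambda>x. expbump p c (s * (x \<bullet> i) + d)) \<in> bumps"
| add: "f \<in> bumps \<Longrightarrow> g \<in> bumps \<Longrightarrow> (\<lambda>x. f x + g x) \<in> bumps"
| mult: "f \<in> bumps \<Longrightarrow> g \<in> bumps \<Longrightarrow> (\<lambda>x. f x * g x) \<in> bumps"

lemma expbump_smult: "expbump (smult a p) c y = a * expbump p c y"
  by (simp add: expbump_def)

lemma expbump_atom_deriv:
  assumes "c > 0"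
  shows "((\<lambda>x. expbump p c (s * (x \<bullet> i) + d)) has_derivative
     (\<lambda>h. expbump (pCons 0 (pCons 0 (smult c p - pderiv p))) c (s * (x \<bullet> i) + d) * (s * (h \<bullet> i)))) (at x)"
proof -
  have "((\<lambda>x. s * (x \<bullet> i) + d) has_derivative (\<lambda>h. s * (h \<bullet> i))) (at x)"
    by (auto intro!: derivative_eq_intros)
  from has_derivative_compose[OF this expbump_deriv[OF assms, unfolded has_field_derivative_def]]
  show ?thesis by (simp add: o_def)
qed

lemma bumps_differentiable: "f \<in> bumps \<Longrightarrow> f differentiable (at x)"
proof (induction rule: bumps.induct)
  case (atom c i p s d)
  then show ?case using expbump_atom_deriv unfolding differentiable_def by blast
qed (auto intro!: derivative_intros)

lemma bumps_pdiff: "f \<in> bumps \<Longrightarrow> j \<in> Basis \<Longrightarrow> pdiff j f \<in> bumps"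
proof (induction rule: bumps.induct)
  case (atom c i p s d)
  have "pdiff j (\<lambda>x. expbump p c (s * (x \<bullet> i) + d)) =
     (\<lambda>x. expbump (smult (s * (j \<bullet> i)) (pCons 0 (pCons 0 (smult c p - pderiv p)))) c (s * (x \<bullet> i) + d))"
    unfolding fun_eq_iff expbump_smult pdiff_eq[OF expbump_atom_deriv[OF atom(1)]] by simp
  then show ?case using atom bumps.atom by metis
next
  case (add f g)
  have "pdiff j (\<lambda>x. f x + g x) = (\<lambda>x. pdiff j f x + pdiff j g x)"
    using pdiff_lin[of f _ g j 1 1] add by (auto simp: bumps_differentiable)
  then show ?case using add bumps.add by auto
next
  case (mult f g)
  have "pdiff j (\<lambda>x. f x * g x) = (\<lambda>x. f x * pdiff j g x + pdiff j f x * g x)"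
    using mult by (auto simp: bumps_differentiable pdiff_mult)
  then show ?case using mult by (auto intro!: bumps.intros)
qed

lemma bumps_smooth: "f \<in> bumps \<Longrightarrow> smooth_fun f"
  by (rule smooth_fun_coinduct[where F=bumps]) (auto simp: bumps_differentiable bumps_pdiff)

lemma bumps_prod:
  assumes "finite S" "S \<noteq> {}" "\<And>i. i \<in> S \<Longrightarrow> f i \<in> bumps"
  shows "(\<lambda>x. \<Prod>i\<in>S. f i x) \<in> bumps"
  using assms
proof (induction S rule: finite_ne_induct)
  case (singleton x)
  then show ?case by simp
next
  case (insert x F)
  then have "(\<lambda>y. f x y * (\<Prod>i\<in>F. f i y)) \<in> bumps" by (intro bumps.mult) auto
  then show ?case using insert by simp
qed

text \<open>As the parameter 1 / (n + 1) tends to 0, every factor tends to 1 inside the box. This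
  approximates the indicator of an open box by smooth functions with values in [0, 1], without
  convolution.\<close>

definition box_bump :: "'d::euclidean_space \<Rightarrow> 'd \<Rightarrow> nat \<Rightarrow> 'd \<Rightarrow> real" where
  "box_bump a b n x = (\<Prod>i\<in>Basis. expbump 1 (1 / Suc n) (x \<bullet> i - a \<bullet> i) * expbump 1 (1 / Suc n) (b \<bullet> i - x \<bullet> i))"

lemma box_bump_smooth: "smooth_fun (box_bump a b n)"
proof -
  have 1: "(\<lambda>x. expbump 1 (1 / Suc n) (x \<bullet> i - a \<bullet> i)) \<in> bumps" if "i \<in> Basis" for i :: 'a
    using bumps.atom[of "1 / Suc n" i 1 1 "- (a \<bullet> i)"] that by simp
  have 2: "(\<lambda>x. expbump 1 (1 / Suc n) (b \<bullet> i - x \<bullet> i)) \<in> bumps" if "i \<in> Basis" for i :: 'a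
    using bumps.atom[of "1 / Suc n" i 1 "-1" "b \<bullet> i"] that by simp
  have "box_bump a b n \<in> bumps"
    unfolding box_bump_def[abs_def] by (intro bumps_prod bumps.mult 1 2) auto
  then show ?thesis by (rule bumps_smooth)
qed

lemma expbump_1: "expbump 1 c y = (if y \<le> 0 then 0 else exp (- c / y))"
  by (simp add: expbump_def)

lemma expbump_1_bounds: "c > 0 \<Longrightarrow> 0 \<le> expbump 1 c y \<and> expbump 1 c y \<le> 1"
  by (auto simp: expbump_1)

lemma box_bump_eq_0_iff: "box_bump a b n x = 0 \<longleftrightarrow> x \<notin> box a b"
  by (auto simp: box_bump_def expbump_1 mem_box not_less not_le) (meson not_le)+

lemma box_bump_bounds: "0 \<le> box_bump a b n x \<and> box_bump a b n x \<le> 1"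
proof -
  have *: "0 \<le> expbump 1 (1 / Suc n) y * expbump 1 (1 / Suc n) z \<and>
      expbump 1 (1 / Suc n) y * expbump 1 (1 / Suc n) z \<le> 1" for y z
    using expbump_1_bounds[of "1 / Suc n" y] expbump_1_bounds[of "1 / Suc n" z]
    by (auto intro!: mult_le_one)
  then show ?thesis
    unfolding box_bump_def by (intro conjI prod_nonneg prod_le_1) blast+
qed

lemma box_bump_tendsto: "(\<lambda>n. box_bump a b n x) \<longlonglongrightarrow> indicator (box a b) x"
proof (cases "x \<in> box a b")
  case True
  have 1: "(\<lambda>n. expbump 1 (1 / Suc n) y) \<longlonglongrightarrow> 1" if "y > 0" for y
  proof -
    have "(\<lambda>n. exp (- (1 / real (Suc n)) * (1 / y))) \<longlonglongrightarrow> exp (- 0 * (1 / y))"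
      by (intro tendsto_intros) (use LIMSEQ_inverse_real_of_nat in \<open>simp add: inverse_eq_divide\<close>)
    then show ?thesis using that by (simp add: expbump_1 divide_simps)
  qed
  have "(\<lambda>n. box_bump a b n x) \<longlonglongrightarrow> (\<Prod>i\<in>(Basis :: 'a set). 1 * 1)"
    unfolding box_bump_def using True
    by (intro tendsto_prod tendsto_mult 1) (auto simp: mem_box)
  with True show ?thesis by simp
next
  case False
  then have "box_bump a b n x = 0" for n by (simp add: box_bump_eq_0_iff)
  then show ?thesis using False by simp
qed

lemma box_bump_test_fun:
  assumes "cbox a b \<subseteq> \<Omega>"
  shows "test_fun \<Omega> (box_bump a b n)"
proof -
  have "closure {x. box_bump a b n x \<noteq> 0} \<subseteq> cbox a b"
    by (intro closure_minimal) (auto simp: box_bump_eq_0_iff box_subset_cbox[THEN subsetD])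
  then show ?thesis
    using assms box_bump_smooth compact_closure
    unfolding test_fun_def by (metis bounded_cbox bounded_subset closure_subset dual_order.trans)
qed

text \<open>Open boxes are stable under intersection and generate the Borel sets, and the sets over
  which \<open>g\<close> integrates to 0 form a Dynkin system. Complements require the integral over
  the whole space, which comes from exhausting it by growing boxes.\<close>

lemma box_integrals_zero_AE:
  fixes g :: "'d::euclidean_space \<Rightarrow> real"
  assumes int: "integrable lborel g"
    and box: "\<And>a b. (LINT x:box a b|lborel. g x) = 0"
  shows "AE x in lborel. g x = 0"
proof (rule density_unique_real[OF int integrable_zero])
  have seti: "set_integrable lborel A g" if "A \<in> sets borel" for A
    unfolding set_integrable_def using that int by (intro integrable_mult_indicator) auto
  have univ: "(LINT x|lborel. g x) = 0"
  proof -
    let ?A = "\<lambda>n::nat. box (- (real n *\<^sub>R One)) (real n *\<^sub>R One) :: 'd set"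
    have "(\<lambda>n. (LINT x:?A n|lborel. g x)) \<longlonglongrightarrow> (LINT x:(\<Union>n. ?A n)|lborel. g x)"
    proof (rule set_integral_cont_up)
      show "incseq ?A"
        unfolding incseq_def
      proof (intro allI impI subsetI)
        fix m n :: nat and x :: 'd assume mn: "m \<le> n" and x: "x \<in> ?A m"
        have "real m \<le> real n" using mn by simp
        then show "x \<in> ?A n" using x
          by (fastforce simp: mem_box)
      qed
    qed (use seti in auto)
    then have "(LINT x:(\<Union>n. ?A n)|lborel. g x) = 0"
      by (simp add: box LIMSEQ_const_iff)
    then show ?thesis
      unfolding UN_box_eq_UNIV by (simp add: set_lebesgue_integral_def)
  qed
  have stable: "Int_stable (range (\<lambda>(a, b). box a b :: 'd set))"
    by (auto simp: Int_stable_def box_Int_box)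
  fix A assume "A \<in> sets (lborel :: 'd measure)"
  then have "A \<in> sigma_sets UNIV (range (\<lambda>(a, b). box a b :: 'd set))"
    by (simp add: borel_eq_box)
  then have "(LINT x:A|lborel. g x) = 0"
  proof (induction rule: sigma_sets_induct_disjoint[OF stable Pow_UNIV[THEN equalityD2, THEN order_trans[OF subset_UNIV]],
        consumes 1, case_names basic empty compl union])
    case (basic A)
    then show ?case using box by auto
  next
    case empty
    then show ?case by (simp add: set_lebesgue_integral_def)
  next
    case (compl A)
    then have "A \<in> sets borel" by (simp add: borel_eq_box)
    then have "(LINT x:A \<union> (UNIV - A)|lborel. g x) = (LINT x:A|lborel. g x) + (LINT x:UNIV - A|lborel. g x)"
      by (intro set_integral_Un seti) auto
    moreover have "A \<union> (UNIV - A) = UNIV" by auto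
    ultimately show ?case using compl(2) univ by (simp add: set_lebesgue_integral_def)
  next
    case (union A)
    then have "\<And>i. A i \<in> sets borel" by (auto simp: borel_eq_box)
    then have "(LINT x:(\<Union>i. A i)|lborel. g x) = (\<Sum>i. (LINT x:A i|lborel. g x))"
      using union(1) by (intro lebesgue_integral_countable_add seti) (auto simp: disjoint_family_on_def)
    then show ?case using union by simp
  qed
  then show "(LINT x:A|lborel. g x) = (LINT x:A|lborel. 0)"
    by (simp add: set_lebesgue_integral_def)
qed

section \<open>Test functions and their partial derivatives\<close>

lemma test_fun_smooth: "test_fun \<Omega> \<phi> \<Longrightarrow> smooth_fun \<phi>"
  by (simp add: test_fun_def)

lemma smooth_fun_continuous: "smooth_fun f \<Longrightarrow> continuous_on UNIV f"
  by (simp add: continuous_at_imp_continuous_on differentiable_imp_continuous_within smooth_fun_differentiable)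

lemma test_fun_continuous: "test_fun \<Omega> \<phi> \<Longrightarrow> continuous_on UNIV \<phi>"
  by (simp add: smooth_fun_continuous test_fun_smooth)

lemma test_fun_bounded:
  assumes "test_fun \<Omega> \<phi>"
  obtains B where "B \<ge> 0" "\<And>x. \<bar>\<phi> x\<bar> \<le> B"
proof -
  let ?K = "closure {x. \<phi> x \<noteq> 0}"
  have "compact (\<phi> ` ?K)"
    using assms test_fun_continuous[OF assms] unfolding test_fun_def
    by (intro compact_continuous_image) (auto intro: continuous_on_subset)
  then obtain B where B: "\<And>x. x \<in> ?K \<Longrightarrow> \<bar>\<phi> x\<bar> \<le> B"
    by (metis bounded_iff compact_imp_bounded imageI real_norm_def)
  have "\<bar>\<phi> x\<bar> \<le> max B 0" for x
  proof (cases "\<phi> x = 0")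
    case False
    then have "x \<in> ?K" using closure_subset[of "{x. \<phi> x \<noteq> 0}"] by auto
    then show ?thesis using B by force
  qed auto
  then show ?thesis using that[of "max B 0"] by auto
qed

lemma pdiff_zero_outside:
  assumes "x \<notin> closure {x. \<phi> x \<noteq> 0}"
  shows "pdiff i \<phi> x = 0"
proof -
  have "(\<phi> has_derivative (\<lambda>_. 0)) (at x)"
  proof (rule has_derivative_transform_within_open[of "\<lambda>_. 0" _ _ _ "- closure {x. \<phi> x \<noteq> 0}"])
    show "0 = \<phi> y" if "y \<in> - closure {x. \<phi> x \<noteq> 0}" for y
    proof (rule ccontr)
      assume "0 \<noteq> \<phi> y"
      then have "y \<in> closure {x. \<phi> x \<noteq> 0}" by (intro closure_subset[THEN subsetD]) auto
      then show False using that by blast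
    qed
  qed (use assms in auto)
  then show ?thesis by (simp add: pdiff_eq)
qed

lemma test_fun_pdiff:
  assumes "test_fun \<Omega> \<phi>" "i \<in> Basis"
  shows "test_fun \<Omega> (pdiff i \<phi>)"
proof -
  let ?K = "closure {x. \<phi> x \<noteq> 0}"
  have "{x. pdiff i \<phi> x \<noteq> 0} \<subseteq> ?K" using pdiff_zero_outside by blast
  then have *: "closure {x. pdiff i \<phi> x \<noteq> 0} \<subseteq> ?K" by (simp add: closure_minimal)
  have "compact ?K" "?K \<subseteq> \<Omega>" "smooth_fun \<phi>" using assms by (auto simp: test_fun_def)
  moreover have "compact (closure {x. pdiff i \<phi> x \<noteq> 0})"
    using * \<open>compact ?K\<close> by (metis closed_closure compact_Int_closed inf.absorb_iff2)
  ultimately show ?thesis using * assms(2) smooth_fun_pdiff unfolding test_fun_def by blast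
qed

lemma test_fun_lin:
  assumes "test_fun \<Omega> \<phi>" "test_fun \<Omega> \<psi>"
  shows "test_fun \<Omega> (\<lambda>x. a * \<phi> x + b * \<psi> x)"
proof -
  let ?S = "{x. a * \<phi> x + b * \<psi> x \<noteq> 0}" and ?K = "closure {x. \<phi> x \<noteq> 0} \<union> closure {x. \<psi> x \<noteq> 0}"
  have "?S \<subseteq> {x. \<phi> x \<noteq> 0} \<union> {x. \<psi> x \<noteq> 0}" by auto
  then have "closure ?S \<subseteq> ?K" using closure_Un closure_mono by blast
  moreover have "compact ?K" "?K \<subseteq> \<Omega>"
    using assms by (auto simp: test_fun_def)
  moreover have "compact (closure ?S)"
    using calculation compact_imp_bounded bounded_subset closed_closure compact_eq_bounded_closed by meson
  ultimately show ?thesis using assms smooth_fun_lin unfolding test_fun_def by blast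
qed

text \<open>Cauchy-Schwarz for a form that is only semidefinite, in a version that serves both the
  L2 product and the Dirichlet form. The discriminant argument needs c > 0, so negative and
  vanishing c are excluded or treated by hand.\<close>

lemma psd_quadratic_bound:
  fixes a b c :: real
  assumes q: "\<And>s. 0 \<le> a + 2 * b * s + c * s\<^sup>2"
  shows "\<bar>b\<bar> \<le> sqrt a * sqrt c"
proof -
  have a: "a \<ge> 0" using q[of 0] by simp
  have c: "c \<ge> 0"
  proof (rule ccontr)
    assume "\<not> c \<ge> 0"
    then have c: "c < 0" by simp
    \<comment> \<open>Large enough for the negative quadratic term to outweigh both a and 2 b
      s.\<close>
    define s where "s = 1 + (a + 2 * \<bar>b\<bar>) / (- c)"
    have s: "s \<ge> 1" "(- c) * s = - c + a + 2 * \<bar>b\<bar>" using c a by (auto simp: s_def field_simps)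
    have "b * s \<le> \<bar>b\<bar> * s" using s by (intro mult_right_mono) auto
    then have "a + 2 * b * s + c * s\<^sup>2 \<le> a * s + 2 * \<bar>b\<bar> * s + (c * s) * s"
      using mult_left_mono[OF s(1) a] by (simp add: power2_eq_square)
    also have "c * s = c - a - 2 * \<bar>b\<bar>" using s(2) by simp
    also have "a * s + 2 * \<bar>b\<bar> * s + (c - a - 2 * \<bar>b\<bar>) * s = c * s" by (simp add: algebra_simps)
    also have "\<dots> < 0" using c s(1) by (simp add: mult_neg_pos)
    finally show False using q[of s] by simp
  qed
  have "b\<^sup>2 \<le> a * c"
  proof (cases "c = 0")
    case True
    have "b = 0"
    proof (rule ccontr)
      assume "b \<noteq> 0"
      \<comment> \<open>At this point the remaining affine function a + 2 b s equals -1.\<close>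
      then show False using q[of "- (a + 1) / (2 * b)"] True by (simp add: field_simps)
    qed
    then show ?thesis using True by simp
  next
    case False
    then have "c * (a + 2 * b * (- b / c) + c * (- b / c)\<^sup>2) = a * c - b\<^sup>2"
      by (simp add: field_simps power2_eq_square)
    then show ?thesis using q[of "- b / c"] c by (metis diff_ge_0_iff_ge mult_nonneg_nonneg)
  qed
  then have "sqrt (b\<^sup>2) \<le> sqrt (a * c)" by (rule real_sqrt_le_mono)
  then show ?thesis by (simp add: real_sqrt_mult)
qed

section \<open>Square-integrable functions on a bounded open set\<close>

locale bounded_open =
  fixes \<Omega> :: "'d::euclidean_space set"
  assumes bounded_dom: "bounded \<Omega>" and open_dom: "open \<Omega>"
begin

abbreviation "M \<equiv> lebesgue_on \<Omega>"

lemma sets_dom [simp, intro]: "\<Omega> \<in> sets lebesgue"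
  by (simp add: borel_open open_dom)

lemma finite_M: "finite_measure M"
  by (intro finite_measure_lebesgue_on lmeasurable_open bounded_dom open_dom)

lemma integrable_const_M [simp]: "integrable M (\<lambda>x. c :: real)"
  using finite_M by (simp add: finite_measure.integrable_const)

lemma set_int_eq: "(LINT x:\<Omega>|lebesgue. f x) = integral\<^sup>L M f" for f :: "'d \<Rightarrow> real"
  unfolding set_lebesgue_integral_def by (subst integral_restrict_space) auto

lemma set_integrable_eq: "set_integrable lebesgue \<Omega> f \<longleftrightarrow> integrable M f" for f :: "'d \<Rightarrow> real"
  unfolding set_integrable_def by (subst integrable_restrict_space) auto

lemma L2_iff: "L2 \<Omega> v \<longleftrightarrow> v \<in> borel_measurable M \<and> integrable M (\<lambda>x. (v x)\<^sup>2)"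
  by (simp add: L2_def set_integrable_eq)

lemma L2inner_eq: "L2inner \<Omega> v w = integral\<^sup>L M (\<lambda>x. v x * w x)"
  by (simp add: L2inner_def set_int_eq)

lemma L2_measurable: "L2 \<Omega> v \<Longrightarrow> v \<in> borel_measurable M"
  by (simp add: L2_iff)

lemma L2_mult_integrable:
  assumes "L2 \<Omega> v" "L2 \<Omega> w"
  shows "integrable M (\<lambda>x. v x * w x)"
proof (rule Bochner_Integration.integrable_bound)
  show "integrable M (\<lambda>x. (v x)\<^sup>2 + (w x)\<^sup>2)" using assms by (simp add: L2_iff)
  show "(\<lambda>x. v x * w x) \<in> borel_measurable M"
    using assms by (intro borel_measurable_times) (auto simp: L2_iff)
  have "\<bar>a * b\<bar> \<le> a\<^sup>2 + b\<^sup>2" for a b :: real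
    using sum_squares_bound[of "\<bar>a\<bar>" "\<bar>b\<bar>"] zero_le_power2[of a] zero_le_power2[of b]
      mult_nonneg_nonneg[OF abs_ge_zero abs_ge_zero, of a b]
    unfolding abs_mult power2_abs by linarith
  then show "AE x in M. norm (v x * w x) \<le> norm ((v x)\<^sup>2 + (w x)\<^sup>2)" by simp
qed

lemma L2_const [simp]: "L2 \<Omega> (\<lambda>x. c)"
  by (simp add: L2_iff)

lemma L2_integrable: "L2 \<Omega> v \<Longrightarrow> integrable M v"
  using L2_mult_integrable[of v "\<lambda>x. 1"] by simp

lemma L2_lin:
  assumes "L2 \<Omega> v" "L2 \<Omega> w"
  shows "L2 \<Omega> (\<lambda>x. a * v x + b * w x)"
proof -
  have "integrable M (\<lambda>x. a\<^sup>2 * (v x * v x) + 2 * a * b * (v x * w x) + b\<^sup>2 * (w x * w x))"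
    by (intro Bochner_Integration.integrable_add integrable_mult_right L2_mult_integrable assms)
  then show ?thesis
    using assms by (auto simp: L2_iff algebra_simps power2_eq_square)
qed

lemma L2_diff: "L2 \<Omega> v \<Longrightarrow> L2 \<Omega> w \<Longrightarrow> L2 \<Omega> (\<lambda>x. v x - w x)"
  using L2_lin[of v w 1 "-1"] by simp

lemma L2inner_commute: "L2inner \<Omega> v w = L2inner \<Omega> w v"
  by (simp add: L2inner_eq mult.commute)

lemma L2inner_lin:
  assumes "L2 \<Omega> v" "L2 \<Omega> w" "L2 \<Omega> z"
  shows "L2inner \<Omega> (\<lambda>x. a * v x + b * w x) z = a * L2inner \<Omega> v z + b * L2inner \<Omega> w z"
proof -
  have "(\<lambda>x. (a * v x + b * w x) * z x) = (\<lambda>x. a * (v x * z x) + b * (w x * z x))"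
    by (simp add: algebra_simps)
  then show ?thesis
    by (simp add: L2inner_eq L2_mult_integrable assms)
qed

lemma L2norm_nonneg: "0 \<le> L2norm \<Omega> v"
  by (simp add: L2norm_def set_int_eq)

lemma L2inner_self_nonneg: "0 \<le> L2inner \<Omega> v v"
  by (simp add: L2inner_eq)

lemma L2norm_eq: "L2norm \<Omega> v = sqrt (L2inner \<Omega> v v)"
  by (simp add: L2norm_def set_int_eq L2inner_eq power2_eq_square)

lemma L2norm_sq: "(L2norm \<Omega> v)\<^sup>2 = L2inner \<Omega> v v"
  by (simp add: L2norm_eq L2inner_self_nonneg)

lemma L2inner_CS:
  assumes "L2 \<Omega> v" "L2 \<Omega> w"
  shows "\<bar>L2inner \<Omega> v w\<bar> \<le> L2norm \<Omega> v * L2norm \<Omega> w"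
  unfolding L2norm_eq
proof (rule psd_quadratic_bound)
  fix s :: real
  let ?z = "\<lambda>x. 1 * v x + s * w x"
  have z: "L2 \<Omega> ?z" using assms by (rule L2_lin)
  have "0 \<le> L2inner \<Omega> ?z ?z" by (rule L2inner_self_nonneg)
  also have "\<dots> = L2inner \<Omega> v ?z + s * L2inner \<Omega> w ?z"
    using L2inner_lin[OF assms z, of 1 s] by simp
  also have "\<dots> = L2inner \<Omega> v v + 2 * L2inner \<Omega> v w * s + L2inner \<Omega> w w * s\<^sup>2"
    unfolding L2inner_commute[of _ ?z]
    using L2inner_lin[OF assms assms(1), of 1 s] L2inner_lin[OF assms assms(2), of 1 s]
    by (simp add: L2inner_commute[of w v] algebra_simps power2_eq_square)
  finally show "0 \<le> \<dots>" .
qed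

lemma continuous_measurable: "continuous_on UNIV f \<Longrightarrow> f \<in> borel_measurable M" for f :: "'d \<Rightarrow> real"
  by (intro continuous_imp_measurable_on_sets_lebesgue) (auto intro: continuous_on_subset)

lemma bounded_L2:
  assumes "f \<in> borel_measurable M" "\<And>x. \<bar>f x\<bar> \<le> B"
  shows "L2 \<Omega> f"
proof -
  have "integrable M (\<lambda>x. (f x)\<^sup>2)"
  proof (rule Bochner_Integration.integrable_bound)
    show "integrable M (\<lambda>x. B\<^sup>2)" by simp
    show "AE x in M. norm ((f x)\<^sup>2) \<le> norm (B\<^sup>2)"
      using assms(2) by (auto simp: abs_le_square_iff[symmetric] intro: order_trans[OF _ abs_ge_self])
  qed (use assms in simp)
  then show ?thesis using assms by (simp add: L2_iff)
qed

lemma test_fun_L2: "test_fun \<Omega> \<phi> \<Longrightarrow> L2 \<Omega> \<phi>"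
  by (metis bounded_L2 continuous_measurable test_fun_bounded test_fun_continuous)

lemma weak_grad_iff:
  "is_weak_grad \<Omega> v G \<longleftrightarrow> (\<forall>\<phi>. test_fun \<Omega> \<phi> \<longrightarrow> (\<forall>i\<in>Basis.
      L2inner \<Omega> v (pdiff i \<phi>) = - L2inner \<Omega> (\<lambda>x. G x \<bullet> i) \<phi>))"
  by (simp add: is_weak_grad_def L2inner_def)

text \<open>Smooth bumps converge boundedly to indicators of boxes, so \<open>g\<close> integrates
  to 0 over every box whose closure lies in \<Omega>. Applied to all sub-boxes of one box, this
  annihilates \<open>g\<close> there, and countably many closed boxes fill \<Omega>.\<close>

lemma fundamental_lemma:
  assumes g: "L2 \<Omega> g" and 0: "\<And>\<phi>. test_fun \<Omega> \<phi> \<Longrightarrow> L2inner \<Omega> g \<phi> = 0"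
  shows "AE x in M. g x = 0"
proof -
  let ?g = "\<lambda>x. indicator \<Omega> x * g x"
  have gint: "integrable lebesgue ?g"
    using L2_integrable[OF g] by (subst (asm) integrable_restrict_space) auto
  \<comment> \<open>The generator argument lives on Borel sets with \<open>lborel\<close>, whereas
    \<open>g\<close> is only Lebesgue measurable; \<open>h\<close> is a Borel
    representative.\<close>
  then obtain h where h: "h \<in> borel_measurable lborel" and gh: "AE x in lborel. ?g x = h x"
    using completion_ex_borel_measurable_real[of ?g lborel] by auto
  have ghc: "AE x in lebesgue. ?g x = h x" using gh by (rule AE_completion)
  have hint: "integrable lborel h"
    using integrable_cong_AE[THEN iffD1, OF _ _ ghc] gint h
    by (simp add: integrable_completion measurable_completion borel_measurable_integrable)
  have box: "integral\<^sup>L lborel (\<lambda>x. indicator (box a b) x * h x) = 0" if ab: "cbox a b \<subseteq> \<Omega>" for a b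
  proof -
    have "(\<lambda>n. integral\<^sup>L M (\<lambda>x. g x * box_bump a b n x)) \<longlonglongrightarrow> integral\<^sup>L M (\<lambda>x. g x * indicator (box a b) x)"
    proof (rule integral_dominated_convergence[where w="\<lambda>x. \<bar>g x\<bar>"])
      show "integrable M (\<lambda>x. \<bar>g x\<bar>)" using L2_integrable[OF g] by simp
      show "(\<lambda>x. g x * box_bump a b n x) \<in> borel_measurable M" for n
        by (intro borel_measurable_times L2_measurable g test_fun_L2 box_bump_test_fun ab)
      have "box a b \<in> sets lebesgue" by simp
      then have ind: "(\<lambda>x. indicator (box a b) x) \<in> borel_measurable M"
        by (intro measurable_restrict_space1 borel_measurable_indicator)
      show "(\<lambda>x. g x * indicator (box a b) x) \<in> borel_measurable M"
        by (intro borel_measurable_times L2_measurable[OF g] ind)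
      show "AE x in M. norm (g x * box_bump a b n x) \<le> \<bar>g x\<bar>" for n
        using box_bump_bounds[of a b n] by (auto simp: abs_mult mult_left_le)
      show "AE x in M. (\<lambda>n. g x * box_bump a b n x) \<longlonglongrightarrow> g x * indicator (box a b) x"
        by (intro AE_I2 tendsto_mult tendsto_const box_bump_tendsto)
    qed
    moreover have "integral\<^sup>L M (\<lambda>x. g x * box_bump a b n x) = 0" for n
      using 0[OF box_bump_test_fun[OF ab]] by (simp add: L2inner_eq)
    ultimately have "integral\<^sup>L M (\<lambda>x. g x * indicator (box a b) x) = 0"
      by (simp add: LIMSEQ_const_iff)
    then have "integral\<^sup>L lebesgue (\<lambda>x. indicator \<Omega> x *\<^sub>R (g x * indicator (box a b) x)) = 0"
      by (subst (asm) integral_restrict_space) auto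
    moreover have "integral\<^sup>L lebesgue (\<lambda>x. indicator \<Omega> x *\<^sub>R (g x * indicator (box a b) x)) =
        integral\<^sup>L lebesgue (\<lambda>x. indicator (box a b) x * h x)"
    proof (rule integral_cong_AE)
      have "box a b \<in> sets lebesgue" by simp
      then have "(\<lambda>x. ?g x * indicator (box a b) x) \<in> borel_measurable lebesgue"
        using gint by (intro borel_measurable_times borel_measurable_indicator borel_measurable_integrable)
      then show "(\<lambda>x. indicator \<Omega> x *\<^sub>R (g x * indicator (box a b) x)) \<in> borel_measurable lebesgue"
        by (simp add: mult.assoc)
      show "(\<lambda>x. indicator (box a b) x * h x) \<in> borel_measurable lebesgue"
        using h by (intro measurable_completion) simp
      show "AE x in lebesgue. indicator \<Omega> x *\<^sub>R (g x * indicator (box a b) x) = indicator (box a b) x * h x"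
        using ghc by eventually_elim (auto simp: indicator_def)
    qed
    moreover have "integral\<^sup>L lebesgue (\<lambda>x. indicator (box a b) x * h x) = integral\<^sup>L lborel (\<lambda>x. indicator (box a b) x * h x)"
      using h by (intro integral_completion) simp
    ultimately show ?thesis by simp
  qed
  have AE_box: "AE x in lborel. x \<in> box a b \<longrightarrow> h x = 0" if ab: "cbox a b \<subseteq> \<Omega>" for a b
  proof -
    have "AE x in lborel. indicator (box a b) x * h x = 0"
    proof (rule box_integrals_zero_AE)
      show "integrable lborel (\<lambda>x. indicator (box a b) x * h x)"
        using integrable_mult_indicator[OF _ hint, of "box a b"] by simp
      fix c d :: 'd
      obtain p q where pq: "box c d \<inter> box a b = box p q" using box_Int_box[of c d a b] by blast
      \<comment> \<open>An empty \<open>box p q\<close> says nothing about \<open>cbox p q\<close>,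
        which might be nonempty and leave \<Omega>. In that case the pair \<open>One\<close>,
        \<open>0\<close>, for which both boxes are empty, is used instead.\<close>
      have "\<exists>p q. box c d \<inter> box a b = box p q \<and> cbox p q \<subseteq> \<Omega>"
      proof (cases "box p q = {}")
        case True
        have e: "cbox One (0 :: 'd) = {}"
          unfolding box_eq_empty by (intro bexI[OF _ SOME_Basis]) (simp add: SOME_Basis)
        then have "box One (0 :: 'd) = {}" using box_subset_cbox by blast
        with e show ?thesis using True pq empty_subsetI by metis
      next
        case False
        then have "cbox p q \<subseteq> cbox a b"
          using pq by (metis Int_lower2 closure_box closure_mono closure_subset bot.extremum_uniqueI)
        then show ?thesis using pq ab by blast
      qed
      then obtain p q where pq: "box c d \<inter> box a b = box p q" and "cbox p q \<subseteq> \<Omega>" by blast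
      then have "(LINT x|lborel. indicator (box p q) x * h x) = 0" by (intro box)
      then show "(LINT x:box c d|lborel. indicator (box a b) x * h x) = 0"
        unfolding pq[symmetric] by (simp add: set_lebesgue_integral_def indicator_inter_arith mult.assoc)
    qed
    then show ?thesis by eventually_elim (auto simp: indicator_def)
  qed
  have AE_cbox: "AE x in lebesgue. x \<in> cbox a b \<longrightarrow> h x = 0" if ab: "cbox a b \<subseteq> \<Omega>" for a b
  proof -
    have "AE x in lebesgue. x \<notin> cbox a b - box a b"
      using negligible_frontier_interval[of a b] unfolding negligible_iff_null_sets by (rule AE_not_in)
    moreover have "AE x in lebesgue. x \<in> box a b \<longrightarrow> h x = 0" using AE_box[OF ab] by (rule AE_completion)
    ultimately show ?thesis by eventually_elim auto
  qed
  obtain D where D: "countable D" "D \<subseteq> Pow \<Omega>" "\<And>X. X \<in> D \<Longrightarrow> \<exists>a b. X = cbox a b" "\<Union>D = \<Omega>"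
    using open_countable_Union_open_cbox[OF open_dom] by metis
  have "AE x in lebesgue. x \<in> X \<longrightarrow> h x = 0" if "X \<in> D" for X
    using D(2) D(3)[OF that] that AE_cbox by blast
  then have "AE x in lebesgue. \<forall>X\<in>D. x \<in> X \<longrightarrow> h x = 0"
    by (intro iffD2[OF AE_ball_countable[OF D(1)]]) blast
  with ghc have "AE x in lebesgue. x \<in> \<Omega> \<longrightarrow> g x = 0"
    by eventually_elim (use D(4) in \<open>auto simp: indicator_def\<close>)
  then show ?thesis by (simp add: AE_restrict_space_iff)
qed

section \<open>Weak gradients\<close>


text \<open>The difference of two weak gradients is orthogonal to all test functions, component by
  component. This is what makes statements about the chosen \<open>wgrad\<close> independent of the
  choice.\<close>

lemma weak_grad_unique:
  assumes "is_weak_grad \<Omega> v G" "is_weak_grad \<Omega> v H"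
    and L: "\<And>i. i \<in> Basis \<Longrightarrow> L2 \<Omega> (\<lambda>x. G x \<bullet> i)" "\<And>i. i \<in> Basis \<Longrightarrow> L2 \<Omega> (\<lambda>x. H x \<bullet> i)"
  shows "AE x in M. G x = H x"
proof -
  have "AE x in M. G x \<bullet> i - H x \<bullet> i = 0" if i: "i \<in> Basis" for i
  proof (rule fundamental_lemma)
    show "L2 \<Omega> (\<lambda>x. G x \<bullet> i - H x \<bullet> i)" by (intro L2_diff L i)
    fix \<phi> assume t: "test_fun \<Omega> \<phi>"
    have "L2inner \<Omega> (\<lambda>x. 1 * (G x \<bullet> i) + (-1) * (H x \<bullet> i)) \<phi> =
        1 * L2inner \<Omega> (\<lambda>x. G x \<bullet> i) \<phi> + (-1) * L2inner \<Omega> (\<lambda>x. H x \<bullet> i) \<phi>"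
      by (intro L2inner_lin L i test_fun_L2 t)
    moreover have "L2inner \<Omega> (\<lambda>x. G x \<bullet> i) \<phi> = L2inner \<Omega> (\<lambda>x. H x \<bullet> i) \<phi>"
      using assms(1,2) t i unfolding weak_grad_iff by (metis neg_equal_iff_equal)
    ultimately show "L2inner \<Omega> (\<lambda>x. G x \<bullet> i - H x \<bullet> i) \<phi> = 0" by simp
  qed
  then have "AE x in M. \<forall>i\<in>Basis. G x \<bullet> i - H x \<bullet> i = 0"
    by (intro AE_finite_allI) auto
  then show ?thesis
    by eventually_elim (auto intro: euclidean_eqI)
qed

lemma H1_L2: "H1 \<Omega> v \<Longrightarrow> L2 \<Omega> v"
  by (simp add: H1_def)

lemma wgrad_props:
  assumes "H1 \<Omega> v"
  shows wgrad_weak_grad: "is_weak_grad \<Omega> v (wgrad \<Omega> v)"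
    and wgrad_L2: "i \<in> Basis \<Longrightarrow> L2 \<Omega> (\<lambda>x. wgrad \<Omega> v x \<bullet> i)"
proof -
  have "\<exists>G. is_weak_grad \<Omega> v G \<and> (\<forall>i\<in>Basis. L2 \<Omega> (\<lambda>x. G x \<bullet> i))"
    using assms by (simp add: H1_def)
  from someI_ex[OF this] show "is_weak_grad \<Omega> v (wgrad \<Omega> v)"
      "i \<in> Basis \<Longrightarrow> L2 \<Omega> (\<lambda>x. wgrad \<Omega> v x \<bullet> i)"
    unfolding wgrad_def by blast+
qed

lemma wgrad_eq:
  assumes "L2 \<Omega> v" "is_weak_grad \<Omega> v G" "\<And>i. i \<in> Basis \<Longrightarrow> L2 \<Omega> (\<lambda>x. G x \<bullet> i)"
  shows "H1 \<Omega> v" "AE x in M. wgrad \<Omega> v x = G x"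
proof -
  show "H1 \<Omega> v" using assms unfolding H1_def by blast
  then show "AE x in M. wgrad \<Omega> v x = G x"
    by (intro weak_grad_unique[OF wgrad_weak_grad assms(2)] wgrad_L2 assms(3))
qed

lemma weak_grad_lin:
  assumes v: "H1 \<Omega> v" and w: "H1 \<Omega> w"
  shows "is_weak_grad \<Omega> (\<lambda>x. a * v x + b * w x) (\<lambda>x. a *\<^sub>R wgrad \<Omega> v x + b *\<^sub>R wgrad \<Omega> w x)"
  unfolding weak_grad_iff
proof (intro allI impI ballI)
  fix \<phi> and i :: 'd assume t: "test_fun \<Omega> \<phi>" and i: "i \<in> Basis"
  have "L2inner \<Omega> (\<lambda>x. a * v x + b * w x) (pdiff i \<phi>) = a * L2inner \<Omega> v (pdiff i \<phi>) + b * L2inner \<Omega> w (pdiff i \<phi>)"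
    by (intro L2inner_lin H1_L2 v w test_fun_L2 test_fun_pdiff t i)
  also have "\<dots> = - (a * L2inner \<Omega> (\<lambda>x. wgrad \<Omega> v x \<bullet> i) \<phi> + b * L2inner \<Omega> (\<lambda>x. wgrad \<Omega> w x \<bullet> i) \<phi>)"
    using wgrad_weak_grad[OF v] wgrad_weak_grad[OF w] t i unfolding weak_grad_iff by simp
  also have "a * L2inner \<Omega> (\<lambda>x. wgrad \<Omega> v x \<bullet> i) \<phi> + b * L2inner \<Omega> (\<lambda>x. wgrad \<Omega> w x \<bullet> i) \<phi> =
      L2inner \<Omega> (\<lambda>x. a * (wgrad \<Omega> v x \<bullet> i) + b * (wgrad \<Omega> w x \<bullet> i)) \<phi>"
    by (intro L2inner_lin[symmetric] wgrad_L2 v w test_fun_L2 t i)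
  finally show "L2inner \<Omega> (\<lambda>x. a * v x + b * w x) (pdiff i \<phi>) =
      - L2inner \<Omega> (\<lambda>x. (a *\<^sub>R wgrad \<Omega> v x + b *\<^sub>R wgrad \<Omega> w x) \<bullet> i) \<phi>"
    by (simp add: inner_add_left)
qed

lemma wgrad_lin_L2:
  assumes v: "H1 \<Omega> v" and w: "H1 \<Omega> w" and i: "i \<in> Basis"
  shows "L2 \<Omega> (\<lambda>x. (a *\<^sub>R wgrad \<Omega> v x + b *\<^sub>R wgrad \<Omega> w x) \<bullet> i)"
  using L2_lin[OF wgrad_L2[OF v i] wgrad_L2[OF w i]] by (simp add: inner_add_left)

lemma H1_lin:
  assumes v: "H1 \<Omega> v" and w: "H1 \<Omega> w"
  shows "H1 \<Omega> (\<lambda>x. a * v x + b * w x)"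
    and wgrad_lin: "AE x in M. wgrad \<Omega> (\<lambda>x. a * v x + b * w x) x = a *\<^sub>R wgrad \<Omega> v x + b *\<^sub>R wgrad \<Omega> w x"
  using wgrad_eq[OF L2_lin[OF H1_L2[OF v] H1_L2[OF w]] weak_grad_lin[OF v w] wgrad_lin_L2[OF v w]]
  by blast+

lemma H1_diff: "H1 \<Omega> v \<Longrightarrow> H1 \<Omega> w \<Longrightarrow> H1 \<Omega> (\<lambda>x. v x - w x)"
  using H1_lin(1)[of v w 1 "-1"] by simp

lemma L2inner_cong_AE:
  assumes "AE x in M. v x = v' x" "L2 \<Omega> v" "L2 \<Omega> v'" "L2 \<Omega> w"
  shows "L2inner \<Omega> v w = L2inner \<Omega> v' w"
  unfolding L2inner_eq
proof (rule integral_cong_AE)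
  show "(\<lambda>x. v x * w x) \<in> borel_measurable M" "(\<lambda>x. v' x * w x) \<in> borel_measurable M"
    using assms by (intro borel_measurable_times L2_measurable; simp)+
  show "AE x in M. v x * w x = v' x * w x" using assms(1) by eventually_elim simp
qed

lemma dform_eq:
  assumes "H1 \<Omega> v" "H1 \<Omega> w"
  shows "dform \<Omega> v w = (\<Sum>i\<in>Basis. L2inner \<Omega> (\<lambda>x. wgrad \<Omega> v x \<bullet> i) (\<lambda>x. wgrad \<Omega> w x \<bullet> i))"
proof -
  have "(\<lambda>x. wgrad \<Omega> v x \<bullet> wgrad \<Omega> w x) = (\<lambda>x. \<Sum>i\<in>Basis. (wgrad \<Omega> v x \<bullet> i) * (wgrad \<Omega> w x \<bullet> i))"
    by (rule ext) (rule euclidean_inner)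
  then show ?thesis
    unfolding dform_def set_int_eq L2inner_eq
    by (simp only:) (intro Bochner_Integration.integral_sum L2_mult_integrable wgrad_L2 assms)
qed

lemma dform_commute: "dform \<Omega> v w = dform \<Omega> w v"
  by (simp add: dform_def inner_commute)

lemma dform_lin:
  assumes v: "H1 \<Omega> v" and w: "H1 \<Omega> w" and z: "H1 \<Omega> z"
  shows "dform \<Omega> (\<lambda>x. a * v x + b * w x) z = a * dform \<Omega> v z + b * dform \<Omega> w z"
proof -
  have "L2inner \<Omega> (\<lambda>x. wgrad \<Omega> (\<lambda>x. a * v x + b * w x) x \<bullet> i) (\<lambda>x. wgrad \<Omega> z x \<bullet> i) =
     a * L2inner \<Omega> (\<lambda>x. wgrad \<Omega> v x \<bullet> i) (\<lambda>x. wgrad \<Omega> z x \<bullet> i) +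
     b * L2inner \<Omega> (\<lambda>x. wgrad \<Omega> w x \<bullet> i) (\<lambda>x. wgrad \<Omega> z x \<bullet> i)" if i: "i \<in> Basis" for i
  proof -
    have "AE x in M. wgrad \<Omega> (\<lambda>x. a * v x + b * w x) x \<bullet> i = (a *\<^sub>R wgrad \<Omega> v x + b *\<^sub>R wgrad \<Omega> w x) \<bullet> i"
      using wgrad_lin[OF v w, of a b] by eventually_elim simp
    then have "L2inner \<Omega> (\<lambda>x. wgrad \<Omega> (\<lambda>x. a * v x + b * w x) x \<bullet> i) (\<lambda>x. wgrad \<Omega> z x \<bullet> i) =
        L2inner \<Omega> (\<lambda>x. (a *\<^sub>R wgrad \<Omega> v x + b *\<^sub>R wgrad \<Omega> w x) \<bullet> i) (\<lambda>x. wgrad \<Omega> z x \<bullet> i)"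
      by (intro L2inner_cong_AE wgrad_lin_L2 wgrad_L2 H1_lin v w z i)
    also have "\<dots> = L2inner \<Omega> (\<lambda>x. a * (wgrad \<Omega> v x \<bullet> i) + b * (wgrad \<Omega> w x \<bullet> i)) (\<lambda>x. wgrad \<Omega> z x \<bullet> i)"
      by (simp add: inner_add_left)
    also have "\<dots> = a * L2inner \<Omega> (\<lambda>x. wgrad \<Omega> v x \<bullet> i) (\<lambda>x. wgrad \<Omega> z x \<bullet> i) +
     b * L2inner \<Omega> (\<lambda>x. wgrad \<Omega> w x \<bullet> i) (\<lambda>x. wgrad \<Omega> z x \<bullet> i)"
      by (intro L2inner_lin wgrad_L2 v w z i)
    finally show ?thesis .
  qed
  then show ?thesis
    using assms by (simp add: dform_eq H1_lin sum.distrib sum_distrib_left)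
qed

lemma dform_self_nonneg: "0 \<le> dform \<Omega> v v"
  by (simp add: dform_def set_int_eq)

lemma dform_CS:
  assumes v: "H1 \<Omega> v" and w: "H1 \<Omega> w"
  shows "\<bar>dform \<Omega> v w\<bar> \<le> sqrt (dform \<Omega> v v) * sqrt (dform \<Omega> w w)"
proof (rule psd_quadratic_bound)
  fix s :: real
  let ?z = "\<lambda>x. 1 * v x + s * w x"
  have z: "H1 \<Omega> ?z" using assms by (rule H1_lin)
  have "0 \<le> dform \<Omega> ?z ?z" by (rule dform_self_nonneg)
  also have "\<dots> = dform \<Omega> v ?z + s * dform \<Omega> w ?z"
    using dform_lin[OF v w z, of 1 s] by simp
  also have "\<dots> = dform \<Omega> v v + 2 * dform \<Omega> v w * s + dform \<Omega> w w * s\<^sup>2"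
    unfolding dform_commute[of _ ?z] dform_lin[OF v w v, of 1 s] dform_lin[OF v w w, of 1 s]
    by (simp add: dform_commute[of w v] algebra_simps power2_eq_square)
  finally show "0 \<le> \<dots>" .
qed

lemma H1norm_sq: "(H1norm \<Omega> v)\<^sup>2 = L2inner \<Omega> v v + dform \<Omega> v v"
proof -
  have "H1norm \<Omega> v = sqrt (L2inner \<Omega> v v + dform \<Omega> v v)"
    by (simp add: H1norm_def L2norm_sq dform_def power2_norm_eq_inner)
  then show ?thesis by (simp add: L2inner_self_nonneg dform_self_nonneg)
qed

lemma H1norm_nonneg: "0 \<le> H1norm \<Omega> v"
proof -
  have "0 \<le> (L2norm \<Omega> v)\<^sup>2 + (LINT x:\<Omega>|lebesgue. (norm (wgrad \<Omega> v x))\<^sup>2)"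
    by (simp add: set_int_eq)
  then show ?thesis by (simp add: H1norm_def)
qed

lemma L2norm_le_H1norm: "L2norm \<Omega> v \<le> H1norm \<Omega> v"
  by (rule power2_le_imp_le) (use dform_self_nonneg[of v] H1norm_nonneg[of v] in \<open>auto simp: L2norm_sq H1norm_sq\<close>)

lemma gradnorm_le_H1norm: "sqrt (dform \<Omega> v v) \<le> H1norm \<Omega> v"
  by (rule power2_le_imp_le)
    (use L2inner_self_nonneg[of v] dform_self_nonneg[of v] H1norm_nonneg[of v] in \<open>auto simp: H1norm_sq\<close>)

text \<open>The parallelogram identity for a v + b w and a v - b w, with the square of the second
  norm dropped. It replaces the triangle inequality where only convergence to 0 matters.\<close>

lemma H1norm_lin_sq:
  assumes v: "H1 \<Omega> v" and w: "H1 \<Omega> w"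
  shows "(H1norm \<Omega> (\<lambda>x. a * v x + b * w x))\<^sup>2 \<le> 2 * a\<^sup>2 * (H1norm \<Omega> v)\<^sup>2 + 2 * b\<^sup>2 * (H1norm \<Omega> w)\<^sup>2"
proof -
  let ?p = "\<lambda>x. a * v x + b * w x" and ?m = "\<lambda>x. a * v x + (- b) * w x"
  note L = H1_L2[OF v] H1_L2[OF w]
  have q: "L2inner \<Omega> (\<lambda>x. a * v x + c * w x) (\<lambda>x. a * v x + c * w x) =
      a\<^sup>2 * L2inner \<Omega> v v + 2 * a * c * L2inner \<Omega> v w + c\<^sup>2 * L2inner \<Omega> w w" for c
    unfolding L2inner_lin[OF L L2_lin[OF L, of a c]] L2inner_commute[of _ "\<lambda>x. a * v x + c * w x"]
      L2inner_lin[OF L L(1)] L2inner_lin[OF L L(2)]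
    by (simp add: L2inner_commute[of w v] algebra_simps power2_eq_square)
  have d: "dform \<Omega> (\<lambda>x. a * v x + c * w x) (\<lambda>x. a * v x + c * w x) =
      a\<^sup>2 * dform \<Omega> v v + 2 * a * c * dform \<Omega> v w + c\<^sup>2 * dform \<Omega> w w" for c
    unfolding dform_lin[OF v w H1_lin(1)[OF v w, of a c]] dform_commute[of _ "\<lambda>x. a * v x + c * w x"]
      dform_lin[OF v w v] dform_lin[OF v w w]
    by (simp add: dform_commute[of w v] algebra_simps power2_eq_square)
  have "0 \<le> (H1norm \<Omega> ?m)\<^sup>2" by simp
  then show ?thesis
    unfolding H1norm_sq q d by (simp add: algebra_simps)
qed

section \<open>Integration by parts against test functions\<close>

lemma integral_pdiff_zero:
  fixes f :: "'d \<Rightarrow> real"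
  assumes diff: "\<And>x. f differentiable (at x)" and cont: "continuous_on UNIV (pdiff i f)"
    and B: "\<And>x. \<bar>pdiff i f x\<bar> \<le> B" and K: "compact K" "K \<subseteq> \<Omega>" "\<And>x. x \<notin> K \<Longrightarrow> f x = 0"
    and i: "i \<in> Basis"
  shows "integral\<^sup>L M (pdiff i f) = 0"
proof -
  have B0: "B \<ge> 0" using B[of undefined] by linarith
  have fcont: "continuous_on UNIV f"
    using diff by (simp add: continuous_at_imp_continuous_on differentiable_imp_continuous_within)
  then have fm: "f \<in> borel_measurable borel" by (rule borel_measurable_continuous_onI)
  obtain R where R: "\<And>x. x \<in> K \<Longrightarrow> norm x \<le> R"
    using K(1) compact_imp_bounded bounded_iff by metis
  define h where "h n = 1 / real (Suc n)" for n
  have h: "h n > 0" "h n \<le> 1" for n by (auto simp: h_def field_simps)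
  have h0: "h \<longlonglongrightarrow> 0" unfolding h_def using LIMSEQ_inverse_real_of_nat by (simp add: inverse_eq_divide)
  have fint: "integrable lborel f"
  proof -
    have "compact (f ` K)" using fcont K(1) by (intro compact_continuous_image) (auto intro: continuous_on_subset)
    then obtain A where A: "\<And>x. x \<in> K \<Longrightarrow> \<bar>f x\<bar> \<le> A"
      by (metis bounded_iff compact_imp_bounded imageI real_norm_def)
    show ?thesis
    proof (rule Bochner_Integration.integrable_bound[where f="\<lambda>x. indicator (cball 0 R) x * A"])
      show "integrable lborel (\<lambda>x::'d. indicator (cball 0 R) x * A)"
        by (intro integrable_mult_left integrable_real_indicator) (use emeasure_bounded_finite[OF bounded_cball] in simp_all)
      show "AE x in lborel. norm (f x) \<le> norm (indicator (cball 0 R) x * A)"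
      proof (rule AE_I2)
        fix x show "norm (f x) \<le> norm (indicator (cball 0 R) x * A)"
        proof (cases "x \<in> K")
          case True
          then show ?thesis using A[OF True] R[OF True] by auto
        qed (simp add: K)
      qed
    qed (use fm in simp)
  qed
  \<comment> \<open>Translation invariance makes each difference quotient integrate to 0, and
    dominated convergence passes this on to the derivative. The mean value theorem bounds the
    quotients by B, and steps of length at most 1 keep their supports in the ball of radius R +
    1.\<close>
  define D where "D n x = (f (h n *\<^sub>R i + x) - f x) / h n" for n x
  have Dint: "integral\<^sup>L lborel (D n) = 0" for n
  proof -
    have "integral\<^sup>L lborel f = integral\<^sup>L (distr lborel borel ((+) (h n *\<^sub>R i))) f"
      by (simp add: lborel_distr_plus)
    also have "\<dots> = integral\<^sup>L lborel (\<lambda>x. f (h n *\<^sub>R i + x))"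
      using fm by (intro integral_distr) auto
    finally have *: "integral\<^sup>L lborel f = integral\<^sup>L lborel (\<lambda>x. f (h n *\<^sub>R i + x))" .
    have "integrable (distr lborel borel ((+) (h n *\<^sub>R i))) f" using fint by (simp add: lborel_distr_plus)
    then have "integrable lborel (\<lambda>x. f (h n *\<^sub>R i + x))"
      using fm by (subst (asm) integrable_distr_eq) auto
    then show ?thesis unfolding D_def using * fint by simp
  qed
  have der: "((\<lambda>s. f (s *\<^sub>R i + x)) has_field_derivative pdiff i f (s *\<^sub>R i + x)) (at s)" for s x
  proof -
    obtain f' where f': "(f has_derivative f') (at (s *\<^sub>R i + x))"
      using diff by (auto simp: differentiable_def)
    have "((\<lambda>s. s *\<^sub>R i + x) has_derivative (\<lambda>r. r *\<^sub>R i)) (at s)"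
      by (auto intro!: derivative_eq_intros)
    from has_derivative_compose[OF this f']
    have "((\<lambda>s. f (s *\<^sub>R i + x)) has_derivative (\<lambda>r. f' (r *\<^sub>R i))) (at s)" .
    moreover have "f' (r *\<^sub>R i) = pdiff i f (s *\<^sub>R i + x) * r" for r
      using linear_scale[OF has_derivative_linear[OF f']] pdiff_eq[OF f'] by simp
    ultimately show ?thesis by (simp add: has_field_derivative_def)
  qed
  have "(\<lambda>n. integral\<^sup>L lborel (D n)) \<longlonglongrightarrow> integral\<^sup>L lborel (pdiff i f)"
  proof (rule integral_dominated_convergence[where w="\<lambda>x. indicator (cball 0 (R + 1)) x * B"])
    show "pdiff i f \<in> borel_measurable lborel" using cont borel_measurable_continuous_onI by simp
    show "D n \<in> borel_measurable lborel" for n unfolding D_def using fm by measurable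
    show "integrable lborel (\<lambda>x::'d. indicator (cball 0 (R + 1)) x * B)"
      by (intro integrable_mult_left integrable_real_indicator) (use emeasure_bounded_finite[OF bounded_cball] in simp_all)
    show "AE x in lborel. (\<lambda>n. D n x) \<longlonglongrightarrow> pdiff i f x"
    proof (rule AE_I2)
      fix x
      have "filterlim h (at 0) sequentially"
        using h0 h(1) by (auto simp: filterlim_at intro!: eventuallyI less_imp_neq[THEN not_sym])
      from filterlim_compose[OF der[of x 0, unfolded DERIV_def] this]
      show "(\<lambda>n. D n x) \<longlonglongrightarrow> pdiff i f x" by (simp add: D_def)
    qed
    show "AE x in lborel. norm (D n x) \<le> indicator (cball 0 (R + 1)) x * B" for n
    proof (rule AE_I2)
      fix x :: 'd
      show "norm (D n x) \<le> indicator (cball 0 (R + 1)) x * B"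
      proof (cases "x \<in> cball 0 (R + 1)")
        case True
        obtain z where "f (h n *\<^sub>R i + x) - f (0 *\<^sub>R i + x) = (h n - 0) * pdiff i f (z *\<^sub>R i + x)"
          using MVT2[OF h(1)[of n], of "\<lambda>s. f (s *\<^sub>R i + x)" "\<lambda>s. pdiff i f (s *\<^sub>R i + x)"] der by blast
        then have "D n x = pdiff i f (z *\<^sub>R i + x)" using h(1)[of n] by (simp add: D_def)
        then show ?thesis using True B by simp
      next
        case False
        then have n: "norm x > R + 1" by simp
        have "norm x \<le> norm (h n *\<^sub>R i + x) + norm (h n *\<^sub>R i)"
          using norm_triangle_ineq4[of "h n *\<^sub>R i + x" "h n *\<^sub>R i"] by simp
        then have "norm (h n *\<^sub>R i + x) > R" using n h[of n] i by simp
        then have "h n *\<^sub>R i + x \<notin> K" "x \<notin> K" using R n by fastforce+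
        then show ?thesis using K(3) B0 by (simp add: D_def)
      qed
    qed
  qed
  then have "integral\<^sup>L lborel (pdiff i f) = 0" by (simp add: Dint LIMSEQ_const_iff)
  moreover have "integral\<^sup>L lborel (pdiff i f) = integral\<^sup>L lebesgue (pdiff i f)"
    using cont by (intro integral_completion[symmetric]) (simp add: borel_measurable_continuous_onI)
  moreover have "integral\<^sup>L lebesgue (pdiff i f) = integral\<^sup>L M (pdiff i f)"
  proof -
    have "pdiff i f x = 0" if "x \<notin> \<Omega>" for x
    proof (rule pdiff_zero_outside)
      have "closure {x. f x \<noteq> 0} \<subseteq> K"
        using K by (intro closure_minimal) (auto simp: compact_imp_closed)
      then show "x \<notin> closure {x. f x \<noteq> 0}" using that K(2) by blast
    qed
    then have "(\<lambda>x. indicator \<Omega> x *\<^sub>R pdiff i f x) = pdiff i f" by (auto simp: indicator_def fun_eq_iff)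
    then show ?thesis by (subst integral_restrict_space) auto
  qed
  ultimately show ?thesis by simp
qed

text \<open>The product of two test functions again has compact support in \<Omega>, so its partial
  derivatives integrate to 0, and the product rule shows that the classical gradient is a weak
  one.\<close>

lemma test_fun_weak_grad:
  assumes t: "test_fun \<Omega> \<phi>"
  shows test_fun_H1: "H1 \<Omega> \<phi>"
    and test_fun_wgrad: "AE x in M. wgrad \<Omega> \<phi> x = (\<Sum>i\<in>Basis. pdiff i \<phi> x *\<^sub>R i)"
proof -
  let ?G = "\<lambda>x. (\<Sum>i\<in>Basis. pdiff i \<phi> x *\<^sub>R i)"
  have G: "?G x \<bullet> i = pdiff i \<phi> x" if "i \<in> Basis" for x i
    using that by simp
  have wg: "is_weak_grad \<Omega> \<phi> ?G"
    unfolding weak_grad_iff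
  proof (intro allI impI ballI)
    fix \<psi> and i :: 'd assume s: "test_fun \<Omega> \<psi>" and i: "i \<in> Basis"
    let ?f = "\<lambda>x. \<phi> x * \<psi> x"
    have d: "\<phi> differentiable (at x)" "\<psi> differentiable (at x)" for x
      using t s test_fun_smooth smooth_fun_differentiable by blast+
    have pd: "pdiff i ?f = (\<lambda>x. \<phi> x * pdiff i \<psi> x + pdiff i \<phi> x * \<psi> x)"
      by (simp add: fun_eq_iff pdiff_mult d)
    note ts = test_fun_pdiff[OF t i] test_fun_pdiff[OF s i]
    obtain B1 where B1: "\<And>x. \<bar>\<phi> x\<bar> \<le> B1" using test_fun_bounded[OF t] by blast
    obtain B2 where B2: "\<And>x. \<bar>\<psi> x\<bar> \<le> B2" using test_fun_bounded[OF s] by blast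
    obtain B3 where B3: "\<And>x. \<bar>pdiff i \<phi> x\<bar> \<le> B3" using test_fun_bounded[OF ts(1)] by blast
    obtain B4 where B4: "\<And>x. \<bar>pdiff i \<psi> x\<bar> \<le> B4" using test_fun_bounded[OF ts(2)] by blast
    have "integral\<^sup>L M (pdiff i ?f) = 0"
    proof (rule integral_pdiff_zero)
      show "?f differentiable (at x)" for x using d by simp
      show "continuous_on UNIV (pdiff i ?f)"
        unfolding pd by (intro continuous_intros test_fun_continuous[OF t] test_fun_continuous[OF s]
          test_fun_continuous[OF ts(1)] test_fun_continuous[OF ts(2)])
      show "\<bar>pdiff i ?f x\<bar> \<le> B1 * B4 + B3 * B2" for x
      proof -
        have "\<bar>\<phi> x * pdiff i \<psi> x\<bar> \<le> B1 * B4" "\<bar>pdiff i \<phi> x * \<psi> x\<bar> \<le> B3 * B2"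
          unfolding abs_mult using order_trans[OF abs_ge_zero B1] order_trans[OF abs_ge_zero B3]
          by (intro mult_mono B1 B2 B3 B4; simp)+
        then show ?thesis unfolding pd by linarith
      qed
      show "compact (closure {x. \<phi> x \<noteq> 0})" "closure {x. \<phi> x \<noteq> 0} \<subseteq> \<Omega>" using t by (auto simp: test_fun_def)
      show "?f x = 0" if "x \<notin> closure {x. \<phi> x \<noteq> 0}" for x
        using that closure_subset[of "{x. \<phi> x \<noteq> 0}"] by auto
    qed (rule i)
    then have "L2inner \<Omega> \<phi> (pdiff i \<psi>) + L2inner \<Omega> (pdiff i \<phi>) \<psi> = 0"
      unfolding pd L2inner_eq
      by (subst (asm) Bochner_Integration.integral_add) (auto intro!: L2_mult_integrable test_fun_L2 t s ts)
    then show "L2inner \<Omega> \<phi> (pdiff i \<psi>) = - L2inner \<Omega> (\<lambda>x. ?G x \<bullet> i) \<psi>"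
      using i by (simp add: G)
  qed
  have "L2 \<Omega> (\<lambda>x. ?G x \<bullet> i)" if "i \<in> Basis" for i
    using that t by (simp add: G test_fun_L2 test_fun_pdiff)
  from wgrad_eq[OF test_fun_L2[OF t] wg this]
  show "H1 \<Omega> \<phi>" "AE x in M. wgrad \<Omega> \<phi> x = ?G x" by blast+
qed

text \<open>Both derivatives end up on the test function, so against test functions the Dirichlet
  form is continuous with respect to L2 convergence of \<open>v\<close>.\<close>

lemma dform_test_fun:
  assumes v: "H1 \<Omega> v" and t: "test_fun \<Omega> \<phi>"
  shows "dform \<Omega> v \<phi> = - (\<Sum>i\<in>Basis. L2inner \<Omega> v (pdiff i (pdiff i \<phi>)))"
proof -
  have "L2inner \<Omega> (\<lambda>x. wgrad \<Omega> v x \<bullet> i) (\<lambda>x. wgrad \<Omega> \<phi> x \<bullet> i) = - L2inner \<Omega> v (pdiff i (pdiff i \<phi>))"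
    if i: "i \<in> Basis" for i
  proof -
    have "AE x in M. wgrad \<Omega> \<phi> x \<bullet> i = pdiff i \<phi> x"
      using test_fun_wgrad[OF t] by eventually_elim (use i in simp)
    then have "L2inner \<Omega> (\<lambda>x. wgrad \<Omega> \<phi> x \<bullet> i) (\<lambda>x. wgrad \<Omega> v x \<bullet> i) = L2inner \<Omega> (pdiff i \<phi>) (\<lambda>x. wgrad \<Omega> v x \<bullet> i)"
      by (intro L2inner_cong_AE wgrad_L2 v i test_fun_H1 t test_fun_L2 test_fun_pdiff)
    also have "\<dots> = - L2inner \<Omega> v (pdiff i (pdiff i \<phi>))"
      using wgrad_weak_grad[OF v] test_fun_pdiff[OF t i] i
      unfolding weak_grad_iff by (simp add: L2inner_commute)
    finally show ?thesis by (simp add: L2inner_commute)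
  qed
  then show ?thesis
    by (simp add: dform_eq[OF v test_fun_H1[OF t]] sum_negf)
qed

section \<open>Functions with zero boundary values and weak convergence\<close>

lemma H01_H1: "H01 \<Omega> v \<Longrightarrow> H1 \<Omega> v"
  by (simp add: H01_def)

lemma H01_lin:
  assumes v: "H01 \<Omega> v" and w: "H01 \<Omega> w"
  shows "H01 \<Omega> (\<lambda>x. a * v x + b * w x)"
proof -
  obtain \<phi> \<psi> where p: "\<And>n. test_fun \<Omega> (\<phi> n)" "(\<lambda>n. H1norm \<Omega> (\<lambda>x. v x - \<phi> n x)) \<longlonglongrightarrow> 0"
    and q: "\<And>n. test_fun \<Omega> (\<psi> n)" "(\<lambda>n. H1norm \<Omega> (\<lambda>x. w x - \<psi> n x)) \<longlonglongrightarrow> 0"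
    using v w unfolding H01_def by metis
  let ?p = "\<lambda>n x. v x - \<phi> n x" and ?q = "\<lambda>n x. w x - \<psi> n x"
  let ?t = "\<lambda>n x. a * \<phi> n x + b * \<psi> n x"
  have hp: "H1 \<Omega> (?p n)" and hq: "H1 \<Omega> (?q n)" for n
    by (intro H1_diff H01_H1 v w test_fun_H1 p q)+
  have up: "(H1norm \<Omega> (\<lambda>x. (a * v x + b * w x) - ?t n x))\<^sup>2 \<le>
      2 * a\<^sup>2 * (H1norm \<Omega> (?p n))\<^sup>2 + 2 * b\<^sup>2 * (H1norm \<Omega> (?q n))\<^sup>2" for n
  proof -
    have "(\<lambda>x. (a * v x + b * w x) - ?t n x) = (\<lambda>x. a * ?p n x + b * ?q n x)"
      by (simp add: algebra_simps)
    then show ?thesis using H1norm_lin_sq[OF hp hq] by simp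
  qed
  have "(\<lambda>n. 2 * a\<^sup>2 * (H1norm \<Omega> (?p n))\<^sup>2 + 2 * b\<^sup>2 * (H1norm \<Omega> (?q n))\<^sup>2) \<longlonglongrightarrow> 2 * a\<^sup>2 * 0\<^sup>2 + 2 * b\<^sup>2 * 0\<^sup>2"
    by (intro tendsto_intros p q)
  then have lim: "(\<lambda>n. 2 * a\<^sup>2 * (H1norm \<Omega> (?p n))\<^sup>2 + 2 * b\<^sup>2 * (H1norm \<Omega> (?q n))\<^sup>2) \<longlonglongrightarrow> 0"
    by simp
  have "(\<lambda>n. (H1norm \<Omega> (\<lambda>x. (a * v x + b * w x) - ?t n x))\<^sup>2) \<longlonglongrightarrow> 0"
    by (rule tendsto_sandwich[OF _ _ tendsto_const lim]) (use up in auto)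
  then have "(\<lambda>n. sqrt ((H1norm \<Omega> (\<lambda>x. (a * v x + b * w x) - ?t n x))\<^sup>2)) \<longlonglongrightarrow> sqrt 0"
    by (intro tendsto_real_sqrt)
  then have "(\<lambda>n. H1norm \<Omega> (\<lambda>x. (a * v x + b * w x) - ?t n x)) \<longlonglongrightarrow> 0"
    by (simp add: H1norm_nonneg)
  moreover have "test_fun \<Omega> (?t n)" for n by (intro test_fun_lin p q)
  ultimately show ?thesis
    unfolding H01_def using H1_lin(1)[OF H01_H1[OF v] H01_H1[OF w]] by (intro conjI exI[of _ ?t]) auto
qed

lemma H01_diff: "H01 \<Omega> v \<Longrightarrow> H01 \<Omega> w \<Longrightarrow> H01 \<Omega> (\<lambda>x. v x - w x)"
  using H01_lin[of v w 1 "-1"] by simp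

text \<open>Approximating \<open>v\<close> by a test function, the L2 limit controls the main part
  through \<open>dform_test_fun\<close>, and the gradient bound controls the remainder uniformly in
  s.\<close>

lemma H1_bounded_L2_limit_weak:
  assumes u: "eventually (\<lambda>s. H1 \<Omega> (u s) \<and> sqrt (dform \<Omega> (u s) (u s)) \<le> B) F"
    and u0: "H1 \<Omega> u0" and lim: "((\<lambda>s. L2norm \<Omega> (\<lambda>x. u s x - u0 x)) \<longlongrightarrow> 0) F"
    and v: "H01 \<Omega> v"
  shows "((\<lambda>s. dform \<Omega> (u s) v) \<longlongrightarrow> dform \<Omega> u0 v) F"
proof (rule tendstoI)
  fix e :: real assume e: "e > 0"
  \<comment> \<open>Dominates the sum of the gradient seminorms of \<open>u s\<close> and
    \<open>u0\<close>; the summand 1 keeps it positive, so that e / (2 A) is meaningful.\<close>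
  define A where "A = \<bar>B\<bar> + sqrt (dform \<Omega> u0 u0) + 1"
  have A: "A > 0" unfolding A_def using dform_self_nonneg[of u0] by (smt (verit) real_sqrt_ge_zero)
  obtain \<phi> where \<phi>: "\<And>n. test_fun \<Omega> (\<phi> n)" "(\<lambda>n. H1norm \<Omega> (\<lambda>x. v x - \<phi> n x)) \<longlonglongrightarrow> 0"
    using v unfolding H01_def by metis
  have "eventually (\<lambda>n. H1norm \<Omega> (\<lambda>x. v x - \<phi> n x) < e / (2 * A)) sequentially"
    using order_tendstoD(2)[OF \<phi>(2)] e A by simp
  then obtain n where n: "H1norm \<Omega> (\<lambda>x. v x - \<phi> n x) < e / (2 * A)"
    by (auto simp: eventually_sequentially)
  define t where "t = \<phi> n"
  have t: "test_fun \<Omega> t" using \<phi> by (simp add: t_def)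
  have vH: "H1 \<Omega> v" using v by (rule H01_H1)
  have tH: "H1 \<Omega> t" using t by (rule test_fun_H1)
  have rH: "H1 \<Omega> (\<lambda>x. v x - t x)" using vH tH by (rule H1_diff)
  have rs: "sqrt (dform \<Omega> (\<lambda>x. v x - t x) (\<lambda>x. v x - t x)) \<le> e / (2 * A)"
    using gradnorm_le_H1norm[of "\<lambda>x. v x - t x"] n by (simp add: t_def)
  have split: "dform \<Omega> w v = dform \<Omega> w t + dform \<Omega> w (\<lambda>x. v x - t x)" if "H1 \<Omega> w" for w
    using dform_lin[OF vH tH that, of 1 "-1"] by (simp add: dform_commute)
  have small: "\<bar>dform \<Omega> w (\<lambda>x. v x - t x)\<bar> \<le> sqrt (dform \<Omega> w w) * (e / (2 * A))" if "H1 \<Omega> w" for w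
    using dform_CS[OF that rH] mult_left_mono[OF rs, of "sqrt (dform \<Omega> w w)"] dform_self_nonneg[of w] by simp
  have conv: "((\<lambda>s. \<Sum>i\<in>Basis. L2norm \<Omega> (\<lambda>x. u s x - u0 x) * L2norm \<Omega> (pdiff i (pdiff i t))) \<longlongrightarrow>
      (\<Sum>i\<in>(Basis::'d set). 0 * L2norm \<Omega> (pdiff i (pdiff i t)))) F"
    by (intro tendsto_sum tendsto_mult lim tendsto_const)
  have "eventually (\<lambda>s. (\<Sum>i\<in>Basis. L2norm \<Omega> (\<lambda>x. u s x - u0 x) * L2norm \<Omega> (pdiff i (pdiff i t))) < e / 2) F"
    using order_tendstoD(2)[OF conv, of "e / 2"] e by simp
  with u show "eventually (\<lambda>s. dist (dform \<Omega> (u s) v) (dform \<Omega> u0 v) < e) F"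
  proof eventually_elim
    case (elim s)
    then have us: "H1 \<Omega> (u s)" and usB: "sqrt (dform \<Omega> (u s) (u s)) \<le> B" by auto
    have "dform \<Omega> (u s) t - dform \<Omega> u0 t = - (\<Sum>i\<in>Basis. L2inner \<Omega> (\<lambda>x. u s x - u0 x) (pdiff i (pdiff i t)))"
    proof -
      have "L2inner \<Omega> (\<lambda>x. u s x - u0 x) (pdiff i (pdiff i t)) =
          L2inner \<Omega> (u s) (pdiff i (pdiff i t)) - L2inner \<Omega> u0 (pdiff i (pdiff i t))" if "i \<in> Basis" for i
        using L2inner_lin[OF H1_L2[OF us] H1_L2[OF u0] test_fun_L2[OF test_fun_pdiff[OF test_fun_pdiff[OF t that] that]], of 1 "-1"]
        by simp
      then show ?thesis
        by (simp add: dform_test_fun[OF us t] dform_test_fun[OF u0 t] sum_subtractf)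
    qed
    also have "\<bar>\<dots>\<bar> \<le> (\<Sum>i\<in>Basis. L2norm \<Omega> (\<lambda>x. u s x - u0 x) * L2norm \<Omega> (pdiff i (pdiff i t)))"
      unfolding abs_minus
      by (rule order_trans[OF sum_abs sum_mono])
        (intro L2inner_CS H1_L2 H1_diff us u0 test_fun_L2 test_fun_pdiff t)
    finally have 1: "\<bar>dform \<Omega> (u s) t - dform \<Omega> u0 t\<bar> < e / 2" using elim(2) by linarith
    have "\<bar>dform \<Omega> (u s) (\<lambda>x. v x - t x)\<bar> + \<bar>dform \<Omega> u0 (\<lambda>x. v x - t x)\<bar> \<le>
        (sqrt (dform \<Omega> (u s) (u s)) + sqrt (dform \<Omega> u0 u0)) * (e / (2 * A))"
      using small[OF us] small[OF u0] unfolding distrib_right by linarith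
    also have "\<dots> \<le> A * (e / (2 * A))"
      using usB e A by (intro mult_right_mono) (auto simp: A_def)
    also have "\<dots> = e / 2" using A by simp
    finally show ?case
      using 1 unfolding split[OF us] split[OF u0] dist_real_def by linarith
  qed
qed

end

section \<open>Discrete energy stability\<close>

text \<open>Applied to \<open>p j = \<parallel>v - e j\<parallel>\<^sup>2\<close>, since \<open>2 (e j - e (j-1), v) - (\<parallel>e j\<parallel>\<^sup>2 - \<parallel>e (j-1)\<parallel>\<^sup>2) = p (j-1) - p j\<close>.\<close>

lemma weighted_telescoping_nonneg:
  fixes A p :: "nat \<Rightarrow> real"
  assumes k: "k \<ge> 1" and A1: "0 \<le> A 1" and mono: "\<And>j. 1 \<le> j \<Longrightarrow> j < k \<Longrightarrow> A j \<le> A (j + 1)"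
    and last: "k \<ge> 2 \<Longrightarrow> \<sigma> * A (k - 1) \<le> (2 * \<sigma> - 1) * A k"
    and \<sigma>: "1 / 2 \<le> \<sigma>" "\<sigma> \<le> 1"
    and p: "\<And>j. 0 \<le> p j" and pk: "p (k - 1) = \<sigma>\<^sup>2 * d" "p k = (1 - \<sigma>)\<^sup>2 * d" and d: "d \<ge> 0"
  shows "0 \<le> (\<Sum>j=1..k. A j * (p (j - 1) - p j))"
proof -
  \<comment> \<open>Summation by parts with nondecreasing weights: all interior contributions have a
    good sign, and only the last boundary term can be negative.\<close>
  have low: "1 \<le> m \<Longrightarrow> m < k \<Longrightarrow> 0 \<le> A m \<and> - A m * p m \<le> (\<Sum>j=1..m. A j * (p (j - 1) - p j))" for m
  proof (induction m)
    case (Suc m)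
    show ?case
    proof (cases "m = 0")
      case True
      then show ?thesis using A1 p[of 0] by (simp add: algebra_simps)
    next
      case False
      then have IH: "0 \<le> A m" "- A m * p m \<le> (\<Sum>j=1..m. A j * (p (j - 1) - p j))" using Suc by auto
      have m: "A m \<le> A (Suc m)" using mono[of m] False Suc by simp
      have "A m * p m \<le> A (Suc m) * p m" using m p by (intro mult_right_mono) auto
      then show ?thesis using IH m by (simp add: algebra_simps)
    qed
  qed simp
  show ?thesis
  proof (cases "k = 1")
    case True
    have "(1 - \<sigma>)\<^sup>2 \<le> \<sigma>\<^sup>2" using \<sigma> by (intro power_mono) auto
    then have "(1 - \<sigma>)\<^sup>2 * d \<le> \<sigma>\<^sup>2 * d" using d by (intro mult_right_mono)
    then show ?thesis using True A1 pk by simp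
  next
    case False
    then obtain m where m: "k = Suc m" "1 \<le> m" using k by (cases k) auto
    have l: "0 \<le> A m" "- A m * p m \<le> (\<Sum>j=1..m. A j * (p (j - 1) - p j))" using low[of m] m by auto
    \<comment> \<open>The partial sum may be as low as - \<sigma>^2 A m d, while the final
      difference contributes exactly (2 \<sigma> - 1) A k d, because \<sigma>^2 - (1 - \<sigma>)^2 =
      2 \<sigma> - 1.\<close>
    have "\<sigma>\<^sup>2 * A m \<le> (2 * \<sigma> - 1) * A k"
    proof -
      have "\<sigma>\<^sup>2 * A m \<le> \<sigma> * A m"
        using l \<sigma> by (intro mult_right_mono) (auto simp: power2_eq_square mult_left_le)
      then show ?thesis using last m by simp
    qed
    then have "(\<sigma>\<^sup>2 * A m) * d \<le> ((2 * \<sigma> - 1) * A k) * d" using d by (intro mult_right_mono)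
    moreover have pm: "p m = \<sigma>\<^sup>2 * d" using pk m by simp
    moreover have "A k * (p m - p k) = ((2 * \<sigma> - 1) * A k) * d"
      unfolding pm pk by (simp add: algebra_simps power2_eq_square)
    ultimately show ?thesis using l m by (simp add: algebra_simps)
  qed
qed

lemma sum_by_parts:
  fixes A y :: "nat \<Rightarrow> real"
  assumes "k \<ge> 1"
  shows "(\<Sum>j=1..k. A j * (y j - y (j - 1))) = A k * y k - A 1 * y 0 - (\<Sum>j=1..k-1. (A (j + 1) - A j) * y j)"
  using assms
proof (induction k rule: nat_induct_at_least)
  case base
  show ?case by (simp add: algebra_simps)
next
  case (Suc k)
  then have "(\<Sum>j=1..Suc k - 1. (A (j + 1) - A j) * y j) =
      (\<Sum>j=1..k-1. (A (j + 1) - A j) * y j) + (A (k + 1) - A k) * y k"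
    by (cases k) auto
  then show ?case using Suc by (simp add: algebra_simps)
qed

text \<open>Put P = 2 E S + Q. Inserting P - 2 E G j for the earlier \<open>y j\<close> cancels the
  sum with the \<open>G j\<close> exactly and leaves 2 E H k A k k + q k A k 1 + P (A k k - A k 1).
  The bounds S and Q turn this into at most A k k (P - 2 E G k). The conclusion keeps the term with
  \<open>G k\<close> because the cancellation at later indices depends on it.\<close>

lemma discrete_stability:
  fixes A :: "nat \<Rightarrow> nat \<Rightarrow> real" and y G H q :: "nat \<Rightarrow> real"
  assumes pos: "\<And>k. 1 \<le> k \<Longrightarrow> k \<le> n \<Longrightarrow> 0 < A k 1"
    and mono: "\<And>k j. 1 \<le> j \<Longrightarrow> j < k \<Longrightarrow> k \<le> n \<Longrightarrow> A k j \<le> A k (j + 1)"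
    and y0: "y 0 = 0" and E: "E \<ge> 0"
    and ineq: "\<And>k. 1 \<le> k \<Longrightarrow> k \<le> n \<Longrightarrow> (\<Sum>j=1..k. A k j * (y j - y (j - 1))) \<le>
        2 * E * ((\<Sum>j=1..k-1. G j * (A k (j + 1) - A k j)) + H k * A k k) + q k * A k 1"
    and S: "\<And>k. 1 \<le> k \<Longrightarrow> k \<le> n \<Longrightarrow> A k k * (G k + H k) \<le> S * A k 1"
    and Q: "\<And>k. 1 \<le> k \<Longrightarrow> k \<le> n \<Longrightarrow> q k \<le> Q"
    and k: "1 \<le> k" "k \<le> n"
  shows "y k \<le> 2 * E * S + Q - 2 * E * G k"
  using k
proof (induction k rule: less_induct)
  case (less k)
  let ?P = "2 * E * S + Q"
  have kk: "A k 1 \<le> A k m" if "1 \<le> m" "m \<le> k" for m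
    using that
  proof (induction m rule: nat_induct_at_least)
    case (Suc m)
    then show ?case using mono[of m k] less.prems by simp
  qed simp
  then have Akk: "A k k > 0" using pos[of k] less.prems by force
  have tele: "(\<Sum>j=1..k-1. A k (j + 1) - A k j) = A k k - A k 1"
    using sum_by_parts[OF less.prems(1), of "A k" "\<lambda>_. 1"] by simp
  have "A k k * y k = (\<Sum>j=1..k. A k j * (y j - y (j - 1))) + (\<Sum>j=1..k-1. (A k (j + 1) - A k j) * y j)"
    using sum_by_parts[OF less.prems(1), of "A k" y] y0 by simp
  also have "\<dots> \<le> 2 * E * ((\<Sum>j=1..k-1. G j * (A k (j + 1) - A k j)) + H k * A k k) + q k * A k 1
      + (\<Sum>j=1..k-1. (A k (j + 1) - A k j) * y j)"
    using ineq[OF less.prems] by simp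
  also have "(\<Sum>j=1..k-1. (A k (j + 1) - A k j) * y j) \<le>
      (\<Sum>j=1..k-1. (A k (j + 1) - A k j) * (?P - 2 * E * G j))"
    using less mono by (intro sum_mono mult_left_mono) auto
  also have "\<dots> = ?P * (\<Sum>j=1..k-1. A k (j + 1) - A k j) - 2 * E * (\<Sum>j=1..k-1. G j * (A k (j + 1) - A k j))"
    unfolding sum_distrib_left sum_subtractf[symmetric] by (intro sum.cong) (auto simp: algebra_simps)
  also have "\<dots> = ?P * (A k k - A k 1) - 2 * E * (\<Sum>j=1..k-1. G j * (A k (j + 1) - A k j))"
    unfolding tele ..
  finally have 1: "A k k * y k \<le> 2 * E * (H k * A k k) + q k * A k 1 + ?P * (A k k - A k 1)"
    by (simp add: algebra_simps)
  have "2 * E * (A k k * (G k + H k)) \<le> 2 * E * (S * A k 1)"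
    using S[OF less.prems] E by (intro mult_left_mono) auto
  moreover have "q k * A k 1 \<le> Q * A k 1"
    using Q[OF less.prems] pos[OF less.prems] by (intro mult_right_mono) auto
  ultimately have "A k k * y k \<le> A k k * (?P - 2 * E * G k)"
    using 1 by (simp add: algebra_simps)
  then show ?case using Akk by simp
qed

lemma le_of_quadratic_bound:
  fixes E S q :: real
  assumes "E\<^sup>2 \<le> 2 * E * S + q\<^sup>2" "q \<ge> 0" "S \<ge> 0"
  shows "E \<le> 2 * S + q"
proof (rule ccontr)
  assume "\<not> E \<le> 2 * S + q"
  then have E: "E > 2 * S + q" by simp
  have "q * q \<le> q * E" using E assms by (intro mult_left_mono) auto
  also have "E * (E - (2 * S + q)) > 0" using E assms by (intro mult_pos_pos) auto
  ultimately show False using assms(1) by (simp add: algebra_simps power2_eq_square)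
qed

context bounded_open
begin

lemma L2inner_diff:
  assumes "L2 \<Omega> a" "L2 \<Omega> b" "L2 \<Omega> z"
  shows "L2inner \<Omega> (\<lambda>x. a x - b x) z = L2inner \<Omega> a z - L2inner \<Omega> b z"
  using L2inner_lin[OF assms, of 1 "-1"] by simp

text \<open>The point v lies on the segment between the last two iterates, so its squared distances
  to them are \<sigma>^2 d and (1 - \<sigma>)^2 d with d the squared length of the last step. The
  difference of the two sides is then a weighted telescoping sum of squared distances to v.\<close>

lemma energy_inequality:
  fixes e :: "nat \<Rightarrow> 'd \<Rightarrow> real" and A :: "nat \<Rightarrow> real"
  assumes k: "k \<ge> 1" and A: "0 \<le> A 1" "\<And>j. 1 \<le> j \<Longrightarrow> j < k \<Longrightarrow> A j \<le> A (j + 1)"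
    "k \<ge> 2 \<Longrightarrow> \<sigma> * A (k - 1) \<le> (2 * \<sigma> - 1) * A k"
    and \<sigma>: "1 / 2 \<le> \<sigma>" "\<sigma> \<le> 1"
    and e: "\<And>j. j \<le> k \<Longrightarrow> L2 \<Omega> (e j)"
  defines "v \<equiv> \<lambda>x. \<sigma> * e k x + (1 - \<sigma>) * e (k - 1) x"
  shows "(\<Sum>j=1..k. A j * (L2inner \<Omega> (e j) (e j) - L2inner \<Omega> (e (j - 1)) (e (j - 1)))) \<le>
    2 * (\<Sum>j=1..k. A j * L2inner \<Omega> (\<lambda>x. e j x - e (j - 1) x) v)"
proof -
  have v: "L2 \<Omega> v" unfolding v_def by (intro L2_lin e) auto
  define p where "p j = (L2norm \<Omega> (\<lambda>x. v x - e (min j k) x))\<^sup>2" for j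
  define d where "d = (L2norm \<Omega> (\<lambda>x. e k x - e (k - 1) x))\<^sup>2"
  have ekk: "L2 \<Omega> (\<lambda>x. e k x - e (k - 1) x)" by (intro L2_diff e) auto
  have sc: "(L2norm \<Omega> (\<lambda>x. c * (e k x - e (k - 1) x)))\<^sup>2 = c\<^sup>2 * d" for c
  proof -
    have "(\<lambda>x. (c * (e k x - e (k - 1) x)) * (c * (e k x - e (k - 1) x))) =
        (\<lambda>x. c\<^sup>2 * ((e k x - e (k - 1) x) * (e k x - e (k - 1) x)))"
      by (simp add: power2_eq_square algebra_simps)
    then show ?thesis unfolding d_def L2norm_sq L2inner_eq by (simp only: integral_mult_right_zero)
  qed
  have pexp: "p j = L2inner \<Omega> v v - 2 * L2inner \<Omega> (e j) v + L2inner \<Omega> (e j) (e j)" if "j \<le> k" for j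
  proof -
    let ?w = "\<lambda>x. v x - e j x"
    have "p j = L2inner \<Omega> ?w ?w" using that by (simp add: p_def L2norm_sq min_absorb1)
    also have "\<dots> = L2inner \<Omega> ?w v - L2inner \<Omega> ?w (e j)"
      using L2inner_diff[OF v e[OF that] L2_diff[OF v e[OF that]]] L2inner_commute by metis
    finally show ?thesis
      unfolding L2inner_diff[OF v e[OF that] v] L2inner_diff[OF v e[OF that] e[OF that]]
        L2inner_commute[of v "e j"] by simp
  qed
  have "0 \<le> (\<Sum>j=1..k. A j * (p (j - 1) - p j))"
  proof (rule weighted_telescoping_nonneg[OF k A \<sigma>])
    show "0 \<le> p j" for j by (simp add: p_def)
    show "0 \<le> d" by (simp add: d_def)
    have "(\<lambda>x. v x - e (k - 1) x) = (\<lambda>x. \<sigma> * (e k x - e (k - 1) x))" by (simp add: v_def algebra_simps)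
    then show "p (k - 1) = \<sigma>\<^sup>2 * d" using sc k by (simp add: p_def)
    have "(\<lambda>x. v x - e k x) = (\<lambda>x. - (1 - \<sigma>) * (e k x - e (k - 1) x))" by (simp add: v_def algebra_simps)
    then have "p k = (- (1 - \<sigma>))\<^sup>2 * d" unfolding sc[symmetric] by (simp only: p_def min.idem)
    then show "p k = (1 - \<sigma>)\<^sup>2 * d" by (simp only: power2_minus)
  qed
  also have "\<dots> = (\<Sum>j=1..k. 2 * (A j * L2inner \<Omega> (\<lambda>x. e j x - e (j - 1) x) v) -
      A j * (L2inner \<Omega> (e j) (e j) - L2inner \<Omega> (e (j - 1)) (e (j - 1))))"
  proof (intro sum.cong refl)
    fix j assume "j \<in> {1..k}"
    then have j: "j \<le> k" "j - 1 \<le> k" by auto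
    show "A j * (p (j - 1) - p j) = 2 * (A j * L2inner \<Omega> (\<lambda>x. e j x - e (j - 1) x) v) -
      A j * (L2inner \<Omega> (e j) (e j) - L2inner \<Omega> (e (j - 1)) (e (j - 1)))"
      unfolding pexp[OF j(1)] pexp[OF j(2)] L2inner_diff[OF e[OF j(1)] e[OF j(2)] v]
      by (simp add: algebra_simps)
  qed
  finally show ?thesis by (simp add: sum_subtractf sum_distrib_left)
qed

end

section \<open>The convolution weights\<close>

lemma LBINT01_eq_integral:
  fixes f :: "real \<Rightarrow> real"
  assumes "continuous_on {0..1} f"
  shows "(LBINT \<theta>=0..1. f \<theta>) = integral {0..1} f"
  using interval_integral_eq_integral[of 0 1 f] borel_integrable_atLeastAtMost'[OF assms]
  by (simp add: zero_ereal_def one_ereal_def)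

lemma FTC_real:
  fixes F f :: "real \<Rightarrow> real"
  assumes "a \<le> b" "\<And>x. a \<le> x \<Longrightarrow> x \<le> b \<Longrightarrow> (F has_real_derivative f x) (at x within {a..b})"
  shows "(f has_integral (F b - F a)) {a..b}"
  using assms by (intro fundamental_theorem_of_calculus)
    (auto simp: has_real_derivative_iff_has_vector_derivative[symmetric])

text \<open>Two-sided slope bounds stand in for convexity. Since 2 \<theta> - 1 has mean 0, g(1/2)
  can be subtracted in B, which puts the integrand between 0 and D1 (2 \<theta> - 1)^2 / 2. The
  third bound uses that W - B has the nonnegative density 2 - 2 \<theta>, the last one compares g
  with a line through its value at 1.\<close>

lemma kernel_moments:
  fixes g :: "real \<Rightarrow> real"
  assumes cont: "continuous_on {0..1} g"
    and slope: "\<And>x y. 0 \<le> x \<Longrightarrow> x \<le> y \<Longrightarrow> y \<le> 1 \<Longrightarrow> D0 * (y - x) \<le> g y - g x \<and> g y - g x \<le> D1 * (y - x)"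
    and D0: "D0 \<ge> 0"
  defines "W \<equiv> integral {0..1} g" and "B \<equiv> integral {0..1} (\<lambda>\<theta>. (2 * \<theta> - 1) * g \<theta>)"
  shows "0 \<le> B" "B \<le> D1 / 6" "g 0 + D0 / 3 \<le> W - B" "W \<le> g 1 - D0 / 2"
proof -
  have Wi: "(g has_integral W) {0..1}"
    unfolding W_def using cont by (simp add: integrable_continuous_real integrable_integral)
  have Bi: "((\<lambda>\<theta>. (2 * \<theta> - 1) * g \<theta>) has_integral B) {0..1}"
    unfolding B_def by (intro integrable_integral integrable_continuous_real continuous_intros cont)
  have i1: "((\<lambda>\<theta>::real. (2 * \<theta> - 1) * c) has_integral 0) {0..1}" for c
    using FTC_real[of 0 1 "\<lambda>\<theta>. (\<theta>\<^sup>2 - \<theta>) * c" "\<lambda>\<theta>. (2 * \<theta> - 1) * c"]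
    by (force intro!: derivative_eq_intros)
  have i2: "((\<lambda>\<theta>::real. D1 * (2 * \<theta> - 1)\<^sup>2 / 2) has_integral D1 / 6) {0..1}"
    using FTC_real[of 0 1 "\<lambda>\<theta>. D1 * (2 * \<theta> - 1) ^ 3 / 12" "\<lambda>\<theta>. D1 * (2 * \<theta> - 1)\<^sup>2 / 2"]
    by (force intro!: derivative_eq_intros simp: power2_eq_square)
  have i3: "((\<lambda>\<theta>::real. (2 - 2 * \<theta>) * (g 0 + D0 * \<theta>)) has_integral (g 0 + D0 / 3)) {0..1}"
    using FTC_real[of 0 1 "\<lambda>\<theta>. g 0 * (2 * \<theta> - \<theta>\<^sup>2) + D0 * (\<theta>\<^sup>2 - 2 / 3 * \<theta> ^ 3)" "\<lambda>\<theta>. (2 - 2 * \<theta>) * (g 0 + D0 * \<theta>)"]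
    by (force intro!: derivative_eq_intros simp: power2_eq_square algebra_simps)
  have i4: "((\<lambda>\<theta>::real. g 1 - D0 * (1 - \<theta>)) has_integral (g 1 - D0 / 2)) {0..1}"
    using FTC_real[of 0 1 "\<lambda>\<theta>. g 1 * \<theta> - D0 * (\<theta> - \<theta>\<^sup>2 / 2)" "\<lambda>\<theta>. g 1 - D0 * (1 - \<theta>)"]
    by (force intro!: derivative_eq_intros simp: algebra_simps)
  have mid: "0 \<le> (2 * \<theta> - 1) * (g \<theta> - g (1 / 2)) \<and> (2 * \<theta> - 1) * (g \<theta> - g (1 / 2)) \<le> D1 * (2 * \<theta> - 1)\<^sup>2 / 2"
    if t: "0 \<le> \<theta>" "\<theta> \<le> 1" for \<theta>
  proof (cases "\<theta> \<ge> 1 / 2")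
    case True
    have s: "D0 * (\<theta> - 1 / 2) \<le> g \<theta> - g (1 / 2)" "g \<theta> - g (1 / 2) \<le> D1 * (\<theta> - 1 / 2)"
      using slope[of "1/2" \<theta>] True t by auto
    have "0 \<le> D0 * (\<theta> - 1 / 2)" using D0 True by simp
    then have "0 \<le> (2 * \<theta> - 1) * (g \<theta> - g (1 / 2))" using s True by simp
    moreover have "(2 * \<theta> - 1) * (g \<theta> - g (1 / 2)) \<le> (2 * \<theta> - 1) * (D1 * (\<theta> - 1 / 2))"
      using s True by (intro mult_left_mono) auto
    ultimately show ?thesis by (simp add: power2_eq_square algebra_simps)
  next
    case False
    have s: "D0 * (1 / 2 - \<theta>) \<le> g (1 / 2) - g \<theta>" "g (1 / 2) - g \<theta> \<le> D1 * (1 / 2 - \<theta>)"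
      using slope[of \<theta> "1/2"] False t by auto
    have "0 \<le> D0 * (1 / 2 - \<theta>)" using D0 False by simp
    then have "0 \<le> (1 - 2 * \<theta>) * (g (1 / 2) - g \<theta>)" using s False by simp
    moreover have "(1 - 2 * \<theta>) * (g (1 / 2) - g \<theta>) \<le> (1 - 2 * \<theta>) * (D1 * (1 / 2 - \<theta>))"
      using s False by (intro mult_left_mono) auto
    ultimately show ?thesis by (simp add: power2_eq_square algebra_simps)
  qed
  have Bm: "((\<lambda>\<theta>. (2 * \<theta> - 1) * (g \<theta> - g (1 / 2))) has_integral B) {0..1}"
    using has_integral_diff[OF Bi i1[of "g (1/2)"]] by (simp add: algebra_simps)
  show "0 \<le> B" using has_integral_nonneg[OF Bm] mid by auto
  show "B \<le> D1 / 6" using has_integral_le[OF Bm i2] mid by auto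
  have "((\<lambda>\<theta>. (2 - 2 * \<theta>) * g \<theta>) has_integral (W - B)) {0..1}"
    using has_integral_diff[OF Wi Bi] by (simp add: algebra_simps)
  from i3 this show "g 0 + D0 / 3 \<le> W - B"
  proof (rule has_integral_le)
    fix \<theta> :: real assume "\<theta> \<in> {0..1}"
    then show "(2 - 2 * \<theta>) * (g 0 + D0 * \<theta>) \<le> (2 - 2 * \<theta>) * g \<theta>"
      using slope[of 0 \<theta>] by (intro mult_left_mono) auto
  qed
  from has_integral_le[OF Wi i4] show "W \<le> g 1 - D0 / 2"
    using slope[of _ 1] by (auto simp: algebra_simps)
qed

lemma eta_root: "eta > 0 \<and> 1 - 3 * eta\<^sup>2 * (1 + eta) = 0"
  unfolding eta_def
proof (rule theI')
  have mono: "3 * x\<^sup>2 * (1 + x) < 3 * y\<^sup>2 * (1 + y)" if "0 < x" "x < y" for x y :: real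
    using that by (intro mult_strict_mono mult_strict_left_mono power_strict_mono) auto
  have "\<exists>x\<ge>0. x \<le> 1 \<and> 3 * x\<^sup>2 * (1 + x) = (1 :: real)"
    by (rule IVT') (auto intro!: continuous_intros)
  then obtain x :: real where x: "x \<ge> 0" "3 * x\<^sup>2 * (1 + x) = 1" by auto
  then have "x > 0" by (cases "x = 0") auto
  then show "\<exists>!\<rho>. \<rho> > 0 \<and> 1 - 3 * \<rho>\<^sup>2 * (1 + \<rho>) = (0 :: real)"
  proof (intro ex1I[of _ x])
    fix y :: real assume y: "y > 0 \<and> 1 - 3 * y\<^sup>2 * (1 + y) = 0"
    show "y = x"
      using mono[of x y] mono[of y x] x y \<open>x > 0\<close> by (cases x y rule: linorder_cases) auto
  qed (use x in simp)
qed

text \<open>At 2/5 the cubic 3 x^2 (1 + x) has the value 84/125 < 1. This convenient rational bound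
  is the source of the factor 5/2 between neighbouring step sizes.\<close>

lemma eta_ge: "2 / 5 \<le> eta"
proof (rule ccontr)
  assume "\<not> 2 / 5 \<le> eta"
  then have "3 * eta\<^sup>2 * (1 + eta) \<le> 3 * (2 / 5)\<^sup>2 * (1 + 2 / 5)"
    using eta_root by (intro mult_mono power_mono) auto
  then show False using eta_root by (simp add: power2_eq_square)
qed

lemma eta_cubic:
  assumes "eta \<le> r" shows "1 \<le> 3 * r\<^sup>2 * (1 + r)"
proof -
  have "3 * eta\<^sup>2 * (1 + eta) \<le> 3 * r\<^sup>2 * (1 + r)"
    using eta_root assms by (intro mult_mono power_mono) auto
  then show ?thesis using eta_root by simp
qed

section \<open>The mesh and the singular kernel\<close>

locale l21_mesh =
  fixes \<alpha> :: real and t :: "nat \<Rightarrow> real"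
  assumes \<alpha>: "0 < \<alpha>" "\<alpha> < 1" and t0: "t 0 = 0" and mono_t: "strict_mono t"
    and ratio: "\<And>k. k \<ge> 2 \<Longrightarrow> rho t k \<ge> eta"
begin

definition "\<sigma> = 1 - \<alpha> / 2"

definition w :: "nat \<Rightarrow> real \<Rightarrow> real" where "w k s = (tstar \<alpha> t k - s) powr (- \<alpha>)"

definition dw :: "nat \<Rightarrow> real \<Rightarrow> real" where "dw k s = \<alpha> * (tstar \<alpha> t k - s) powr (- \<alpha> - 1)"

lemma \<sigma>: "1 / 2 < \<sigma>" "\<sigma> < 1" "2 * \<sigma> - 1 = 1 - \<alpha>" "1 - \<alpha> < \<sigma>"
  using \<alpha> by (auto simp: \<sigma>_def)

lemma tstar_eq: "tstar \<alpha> t k = t (k - 1) + \<sigma> * tau t k"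
  by (simp add: tstar_def \<sigma>_def)

lemma t_less: "i < j \<Longrightarrow> t i < t j"
  using mono_t by (simp add: strict_mono_def)

lemma t_le: "i \<le> j \<Longrightarrow> t i \<le> t j"
  using mono_t by (simp add: strict_mono_less_eq)

lemma t_nonneg: "0 \<le> t i" using t_le[of 0 i] t0 by simp

lemma tau_pos: "k \<ge> 1 \<Longrightarrow> tau t k > 0"
  using t_less[of "k - 1" k] by (simp add: tau_def)

lemma t_Suc: "k \<ge> 1 \<Longrightarrow> t k = t (k - 1) + tau t k"
  by (simp add: tau_def)

lemma tstar_bounds: "k \<ge> 1 \<Longrightarrow> t (k - 1) < tstar \<alpha> t k \<and> tstar \<alpha> t k < t k"
  using tau_pos[of k] \<sigma> t_Suc[of k] by (simp add: tstar_eq)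

lemma tstar_pos: "k \<ge> 1 \<Longrightarrow> 0 < tstar \<alpha> t k"
  using tstar_bounds[of k] t_nonneg[of "k - 1"] by linarith

lemma less_tstar: "j < k \<Longrightarrow> s \<le> t j \<Longrightarrow> s < tstar \<alpha> t k"
  using tstar_bounds[of k] t_le[of j "k - 1"] by simp linarith

lemma tau_ratio: "k \<ge> 2 \<Longrightarrow> 2 / 5 * tau t (k - 1) \<le> tau t k"
proof -
  assume k: "k \<ge> 2"
  have "2 / 5 \<le> tau t k / tau t (k - 1)" using order_trans[OF eta_ge ratio[OF k]] by (simp only: rho_def)
  then show ?thesis using tau_pos[of "k - 1"] k by (simp add: field_simps)
qed

text \<open>The threshold condition cleared of denominators, in exactly the form in which
  \<open>coef_c_bounds\<close> needs it.\<close>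

lemma tau_cubic:
  assumes k: "k \<ge> 2"
  shows "tau t (k - 1) ^ 3 \<le> 3 * (tau t k)\<^sup>2 * (tau t (k - 1) + tau t k)"
proof -
  let ?a = "tau t (k - 1)" and ?b = "tau t k"
  have a: "?a > 0" using tau_pos[of "k - 1"] k by simp
  have "1 \<le> 3 * (?b / ?a)\<^sup>2 * (1 + ?b / ?a)" using eta_cubic[OF ratio[OF k]] by (simp add: rho_def)
  then have "?a ^ 3 * 1 \<le> ?a ^ 3 * (3 * (?b / ?a)\<^sup>2 * (1 + ?b / ?a))" using a by (intro mult_left_mono) auto
  also have "\<dots> = 3 * ?b\<^sup>2 * (?a + ?b)" using a by (simp add: field_simps power2_eq_square power3_eq_cube)
  finally show ?thesis by simp
qed

lemma w_deriv: "s < tstar \<alpha> t k \<Longrightarrow> (w k has_real_derivative dw k s) (at s within S)"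
  unfolding w_def[abs_def] dw_def by (auto intro!: derivative_eq_intros)

lemma w_continuous: "(\<And>s. s \<in> S \<Longrightarrow> s < tstar \<alpha> t k) \<Longrightarrow> continuous_on S (w k)"
  unfolding w_def[abs_def] by (intro continuous_intros) (force)

lemma w_pos: "s < tstar \<alpha> t k \<Longrightarrow> 0 < w k s"
  by (simp add: w_def)

lemma dw_nonneg: "0 \<le> dw k s"
  using \<alpha> by (simp add: dw_def)

lemma dw_mono: "s \<le> r \<Longrightarrow> r < tstar \<alpha> t k \<Longrightarrow> dw k s \<le> dw k r"
  unfolding dw_def using \<alpha> by (intro mult_left_mono powr_mono2') auto

lemma w_slope:
  assumes "a \<le> x" "x \<le> y" "y \<le> b" "b < tstar \<alpha> t k"
  shows "dw k a * (y - x) \<le> w k y - w k x \<and> w k y - w k x \<le> dw k b * (y - x)"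
proof (cases "x = y")
  case False
  then have "x < y" using assms by simp
  from MVT2[OF this, of "w k" "dw k"] obtain z where z: "x < z" "z < y" "w k y - w k x = (y - x) * dw k z"
    using w_deriv assms by (metis dual_order.strict_trans2 dual_order.trans)
  have "dw k a \<le> dw k z" "dw k z \<le> dw k b" using z assms by (auto intro!: dw_mono)
  then show ?thesis unfolding z(3) using \<open>x < y\<close> by (simp add: mult.commute mult_left_mono)
qed simp

section \<open>Kernel moments and bounds for the coefficients\<close>

definition "W k j = integral {0..1} (\<lambda>\<theta>. w k (t (j - 1) + \<theta> * tau t j))"

definition "B k j = integral {0..1} (\<lambda>\<theta>. (2 * \<theta> - 1) * w k (t (j - 1) + \<theta> * tau t j))"

lemma theta_less_tstar:
  assumes "1 \<le> j" "j < k" "\<theta> \<le> 1"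
  shows "t (j - 1) + \<theta> * tau t j < tstar \<alpha> t k"
proof (rule less_tstar[OF assms(2)])
  show "t (j - 1) + \<theta> * tau t j \<le> t j"
    using assms tau_pos[of j] t_Suc[of j] mult_right_mono[of \<theta> 1 "tau t j"] by simp
qed

lemma theta_kernel_continuous:
  assumes "1 \<le> j" "j < k"
  shows "continuous_on {0..1} (\<lambda>\<theta>. w k (t (j - 1) + \<theta> * tau t j))"
  unfolding w_def using theta_less_tstar[OF assms] by (intro continuous_intros) force

lemma moment_bounds:
  assumes j: "1 \<le> j" "j < k"
  shows "0 \<le> B k j" "B k j \<le> tau t j * dw k (t j) / 6"
    "w k (t (j - 1)) + tau t j * dw k (t (j - 1)) / 3 \<le> W k j - B k j"
    "W k j \<le> w k (t j) - tau t j * dw k (t (j - 1)) / 2"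
proof -
  let ?g = "\<lambda>\<theta>. w k (t (j - 1) + \<theta> * tau t j)"
  have tp: "tau t j > 0" using tau_pos j by simp
  have sl: "tau t j * dw k (t (j - 1)) * (y - x) \<le> ?g y - ?g x \<and> ?g y - ?g x \<le> tau t j * dw k (t j) * (y - x)"
    if "0 \<le> x" "x \<le> y" "y \<le> 1" for x y
  proof -
    have "y * tau t j \<le> tau t j" using that tp by (simp add: mult_left_le_one_le)
    then show ?thesis
      using w_slope[of "t (j - 1)" "t (j - 1) + x * tau t j" "t (j - 1) + y * tau t j" "t j" k]
        that tp t_Suc[OF j(1)] less_tstar[OF j(2)]
      by (simp add: mult_right_mono algebra_simps)
  qed
  have D0: "0 \<le> tau t j * dw k (t (j - 1))" using tp dw_nonneg by simp
  note km = kernel_moments[OF theta_kernel_continuous[OF j] sl D0, folded W_def B_def]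
  show "0 \<le> B k j" "B k j \<le> tau t j * dw k (t j) / 6"
    "w k (t (j - 1)) + tau t j * dw k (t (j - 1)) / 3 \<le> W k j - B k j"
    "W k j \<le> w k (t j) - tau t j * dw k (t (j - 1)) / 2"
    using km t_Suc[OF j(1)] by simp_all
qed

lemma coef_c_eq:
  assumes j: "1 \<le> j" "j < k"
  shows "coef_c \<alpha> t j k = (tau t j)\<^sup>2 / (tau t (j + 1) * (tau t j + tau t (j + 1))) * B k j"
proof -
  let ?c = "(tau t j)\<^sup>2 / (tau t (j + 1) * (tau t j + tau t (j + 1)))"
  have "coef_c \<alpha> t j k = (LBINT \<theta>=0..1. ?c * ((2 * \<theta> - 1) * w k (t (j - 1) + \<theta> * tau t j)))"
    using j by (simp add: coef_c_def w_def powr_minus divide_simps mult_ac algebra_simps)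
  also have "\<dots> = integral {0..1} (\<lambda>\<theta>. ?c * ((2 * \<theta> - 1) * w k (t (j - 1) + \<theta> * tau t j)))"
    by (intro LBINT01_eq_integral continuous_intros theta_kernel_continuous j)
  finally show ?thesis by (simp add: B_def)
qed

text \<open>The numerator splits as tau_j (2 \<theta> - 1) - (tau_j + tau_(j+1)), so the coefficient
  is a combination of the mean of the kernel and its first moment about the midpoint.\<close>

lemma coef_a_eq:
  assumes j: "1 \<le> j" "j < k"
  shows "- coef_a \<alpha> t j k = W k j - tau t j / (tau t j + tau t (j + 1)) * B k j"
proof -
  let ?c = "tau t j / (tau t j + tau t (j + 1))"
  let ?g = "\<lambda>\<theta>. w k (t (j - 1) + \<theta> * tau t j)"
  have tp: "tau t j > 0" "tau t (j + 1) > 0" using tau_pos j by auto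
  have "(- 2 * tau t j * (1 - \<theta>) - tau t (j + 1)) / ((tau t j + tau t (j + 1)) * y powr \<alpha>) =
      ?c * ((2 * \<theta> - 1) * y powr (- \<alpha>)) - y powr (- \<alpha>)" for \<theta> y
    using tp by (simp add: powr_minus divide_simps) (simp add: algebra_simps)
  then have "coef_a \<alpha> t j k = (LBINT \<theta>=0..1. ?c * ((2 * \<theta> - 1) * ?g \<theta>) - ?g \<theta>)"
    using j by (simp add: coef_a_def w_def diff_diff_eq)
  also have "\<dots> = integral {0..1} (\<lambda>\<theta>. ?c * ((2 * \<theta> - 1) * ?g \<theta>) - ?g \<theta>)"
    by (intro LBINT01_eq_integral continuous_intros theta_kernel_continuous j)
  also have "\<dots> = ?c * B k j - W k j"
    unfolding B_def W_def integral_mult_right[symmetric]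
    by (intro Henstock_Kurzweil_Integration.integral_diff integrable_continuous_real continuous_intros theta_kernel_continuous j)
  finally show ?thesis by simp
qed

lemma coef_a_lower:
  assumes j: "1 \<le> j" "j < k"
  shows "w k (t (j - 1)) + tau t j * dw k (t (j - 1)) / 3 \<le> - coef_a \<alpha> t j k"
proof -
  have "tau t j / (tau t j + tau t (j + 1)) * B k j \<le> 1 * B k j"
    using tau_pos[of j] tau_pos[of "j + 1"] j moment_bounds[OF j] by (intro mult_right_mono) auto
  then show ?thesis using moment_bounds[OF j] unfolding coef_a_eq[OF j] by linarith
qed

lemma coef_a_upper:
  assumes j: "1 \<le> j" "j < k"
  shows "- coef_a \<alpha> t j k \<le> w k (t j) - tau t j * dw k (t (j - 1)) / 2"
proof -
  have "0 \<le> tau t j / (tau t j + tau t (j + 1)) * B k j"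
    using tau_pos[of j] tau_pos[of "j + 1"] j moment_bounds[OF j] by simp
  then show ?thesis using moment_bounds[OF j] unfolding coef_a_eq[OF j] by linarith
qed

text \<open>The moment bound tau_j dw / 6 produces tau_j^3 in the numerator; the cubic step-size
  condition trades it for tau_(j+1), with the constant 1/2. That constant is the margin left by
  \<open>coef_a_upper\<close> on the next interval, which explains the threshold
  \<open>eta\<close>.\<close>

lemma coef_c_bounds:
  assumes j: "1 \<le> j" "j < k"
  shows "0 \<le> coef_c \<alpha> t j k" "coef_c \<alpha> t j k \<le> tau t (j + 1) * dw k (t j) / 2"
proof -
  let ?a = "tau t j" and ?b = "tau t (j + 1)"
  have ab: "?a > 0" "?b > 0" using tau_pos j by auto
  show "0 \<le> coef_c \<alpha> t j k"
    unfolding coef_c_eq[OF j] using ab moment_bounds[OF j] by simp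
  have "coef_c \<alpha> t j k \<le> ?a\<^sup>2 / (?b * (?a + ?b)) * (?a * dw k (t j) / 6)"
    unfolding coef_c_eq[OF j] using ab moment_bounds[OF j] by (intro mult_left_mono) auto
  also have "\<dots> = ?a ^ 3 * dw k (t j) / (6 * ?b * (?a + ?b))"
    by (simp add: power2_eq_square power3_eq_cube mult_ac)
  also have "\<dots> \<le> (3 * ?b\<^sup>2 * (?a + ?b)) * dw k (t j) / (6 * ?b * (?a + ?b))"
    using tau_cubic[of "j + 1"] j ab dw_nonneg by (intro divide_right_mono mult_right_mono) auto
  also have "\<dots> = ?b * dw k (t j) / 2"
  proof -
    have "(3 * b\<^sup>2 * s) * d / (6 * b * s) = b * d / 2" if "b > 0" "s > 0" for b s d :: real
      using that by (simp add: power2_eq_square field_simps)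
    then show ?thesis using ab by simp
  qed
  finally show "coef_c \<alpha> t j k \<le> ?b * dw k (t j) / 2" .
qed

text \<open>\<open>wt k j\<close> is \<open>\<Gamma>(1 - \<alpha>)\<close> times the coefficient of \<open>\<delta>\<^sub>j\<close> in \<open>Lstar\<close>; for \<open>k = 1\<close> the first summand is \<open>coef_c\<close> at \<open>k = 1\<close>, which is \<open>0\<close>.\<close>

definition wt :: "nat \<Rightarrow> nat \<Rightarrow> real" where
  "wt k j = (if j = k then coef_c \<alpha> t (k - 1) k + \<sigma> powr (1 - \<alpha>) / ((1 - \<alpha>) * tau t k powr \<alpha>)
     else if j = 1 then - coef_a \<alpha> t 1 k else coef_d \<alpha> t j k)"

section \<open>Ordering and size of the weights\<close>

lemma w_last: "k \<ge> 1 \<Longrightarrow> w k (t (k - 1)) = \<sigma> powr (- \<alpha>) * tau t k powr (- \<alpha>)"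
  using tau_pos[of k] \<sigma> by (simp add: w_def tstar_eq powr_mult)

lemma last_term_eq:
  assumes "k \<ge> 1"
  shows "\<sigma> powr (1 - \<alpha>) / ((1 - \<alpha>) * tau t k powr \<alpha>) = \<sigma> / (1 - \<alpha>) * w k (t (k - 1))"
proof -
  have *: "\<sigma> powr (1 - \<alpha>) = \<sigma> * \<sigma> powr (- \<alpha>)"
    using \<sigma> powr_add[of \<sigma> 1 "- \<alpha>"] by simp
  show ?thesis unfolding w_last[OF assms] * powr_minus[of "tau t k"] by (simp add: divide_inverse mult_ac)
qed

lemma coef_c_last_nonneg: "k \<ge> 1 \<Longrightarrow> 0 \<le> coef_c \<alpha> t (k - 1) k"
  using coef_c_bounds(1)[of "k - 1" k] by (cases "k = 1") (auto simp: coef_c_def)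

lemma wt_last_lower: "k \<ge> 1 \<Longrightarrow> \<sigma> / (1 - \<alpha>) * w k (t (k - 1)) \<le> wt k k"
  using last_term_eq[of k] coef_c_last_nonneg[of k] by (simp add: wt_def)

text \<open>The contribution of \<open>coef_c\<close> from the preceding interval, at most tau_j dw
  / 2 at the left end, is cancelled by the deficit in the upper bound for -
  \<open>coef_a\<close>.\<close>

lemma wt_upper:
  assumes j: "1 \<le> j" "j < k"
  shows "wt k j \<le> w k (t j)"
proof (cases "j = 1")
  case True
  then show ?thesis
    using coef_a_upper[OF j] j mult_nonneg_nonneg[OF less_imp_le[OF tau_pos[OF j(1)]] dw_nonneg[of k "t (j - 1)"]]
    by (simp add: wt_def)
next
  case False
  then have "coef_c \<alpha> t (j - 1) k \<le> tau t j * dw k (t (j - 1)) / 2"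
    using coef_c_bounds(2)[of "j - 1" k] j by simp
  then show ?thesis using False coef_a_upper[OF j] j by (simp add: wt_def coef_d_def)
qed

lemma wt_lower:
  assumes j: "1 \<le> j" "j < k"
  shows "w k (t (j - 1)) + tau t j * dw k (t (j - 1)) / 3 \<le> wt k j"
proof (cases "j = 1")
  case True
  then show ?thesis using coef_a_lower[OF j] j by (simp add: wt_def)
next
  case False
  then have "0 \<le> coef_c \<alpha> t (j - 1) k" using coef_c_bounds(1)[of "j - 1" k] j by simp
  then show ?thesis using False coef_a_lower[OF j] j by (simp add: wt_def coef_d_def)
qed

text \<open>The first weight is the smallest of its row and is what the stability argument divides
  by; comparing it with the kernel at 0 brings powers of \<open>tstar\<close> into the final
  estimate.\<close>

lemma wt_first_ge:
  assumes "k \<ge> 1"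
  shows "w k 0 \<le> wt k 1"
proof (cases "k = 1")
  case True
  have "1 * w 1 (t 0) \<le> \<sigma> / (1 - \<alpha>) * w 1 (t 0)"
    using \<sigma> \<alpha> w_pos[of 0 1] tstar_pos[of 1] t0 by (intro mult_right_mono) (auto simp: field_simps)
  then show ?thesis using wt_last_lower[of 1] True t0 by simp
next
  case False
  have "0 \<le> tau t 1 * dw k (t 0)" using tau_pos[of 1] dw_nonneg by simp
  then show ?thesis using False assms wt_lower[of 1 k] t0 by simp
qed

lemma wt_first_pos: "k \<ge> 1 \<Longrightarrow> 0 < wt k 1"
  using wt_first_ge[of k] w_pos[of 0 k] tstar_pos[of k] by simp

text \<open>The local term exceeds the kernel value at t (k - 1) by the factor \<sigma> / (1 -
  \<alpha>), and 2 \<sigma> - 1 = 1 - \<alpha>, so the two sides are separated by the same kernel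
  value.\<close>

lemma wt_penultimate:
  assumes "k \<ge> 2"
  shows "\<sigma> * wt k (k - 1) \<le> (2 * \<sigma> - 1) * wt k k"
proof -
  have "\<sigma> * wt k (k - 1) \<le> \<sigma> * w k (t (k - 1))"
    using wt_upper[of "k - 1" k] \<sigma> assms by (intro mult_left_mono) auto
  also have "\<dots> = (1 - \<alpha>) * (\<sigma> / (1 - \<alpha>) * w k (t (k - 1)))" using \<alpha> by simp
  also have "\<dots> \<le> (1 - \<alpha>) * wt k k"
    using wt_last_lower[of k] assms \<alpha> by (intro mult_left_mono) auto
  finally show ?thesis by (simp add: \<sigma>)
qed

lemma dw_last:
  assumes k: "k \<ge> 1"
  shows "tau t k * dw k (t (k - 1)) \<le> 2 * \<alpha> * w k (t (k - 1))"
proof -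
  have tp: "tau t k > 0" using tau_pos k by simp
  have "dw k (t (k - 1)) = \<alpha> * (w k (t (k - 1)) / (\<sigma> * tau t k))"
    using tp \<sigma> by (simp add: dw_def w_def tstar_eq powr_diff)
  then have "tau t k * dw k (t (k - 1)) = \<alpha> / \<sigma> * w k (t (k - 1))" using tp by simp
  also have "\<dots> \<le> 2 * \<alpha> * w k (t (k - 1))"
    using \<sigma> \<alpha> w_pos[of "t (k - 1)" k] tstar_bounds[of k] k by (intro mult_right_mono) (auto simp: field_simps)
  finally show ?thesis .
qed

text \<open>Integration by parts yields kernel increments, while the stability argument absorbs
  increments of the weights; this comparison, uniform in \<alpha> and in the mesh, connects
  them.\<close>

lemma ker_step_le:
  assumes j: "1 \<le> j" "j < k"
  shows "w k (t j) - w k (t (j - 1)) \<le> 10 * (wt k (j + 1) - wt k j)"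
proof -
  have up: "w k (t j) - w k (t (j - 1)) \<le> tau t j * dw k (t j)"
    using w_slope[of "t (j - 1)" "t (j - 1)" "t j" "t j" k] less_tstar[OF j(2)] t_less[of "j - 1" j] j
    by (simp add: tau_def mult.commute)
  have r: "tau t j * dw k (t j) \<le> 5 / 2 * (tau t (j + 1) * dw k (t j))"
    using tau_ratio[of "j + 1"] j dw_nonneg mult_right_mono[of "2 / 5 * tau t j" "tau t (j + 1)" "dw k (t j)"] by simp
  show ?thesis
  proof (cases "j + 1 = k")
    case False
    \<comment> \<open>Away from the last index the weights differ by at least a third of tau_(j+1)
      dw, so with the ratio bound 5/2 a factor 15/2 suffices.\<close>
    then have "w k (t j) + tau t (j + 1) * dw k (t j) / 3 \<le> wt k (j + 1)"
      using wt_lower[of "j + 1" k] j by simp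
    moreover have "0 \<le> tau t (j + 1) * dw k (t j)" using tau_pos[of "j + 1"] dw_nonneg by simp
    moreover note wt_upper[OF j] up r
    ultimately show ?thesis by argo
  next
    case True
    let ?w = "w k (t j)"
    have wp: "?w > 0" using w_pos less_tstar[OF j(2)] by simp
    have "\<sigma> / (1 - \<alpha>) * ?w \<le> wt k (j + 1)" using wt_last_lower[of k] True by auto
    \<comment> \<open>The last gap is thus at least (\<alpha> / 2) w, against a kernel increment of
      at most (5/2) 2 \<alpha> w = 5 \<alpha> w; this case sets the factor 10.\<close>
    moreover have "(1 + \<alpha> / 2) * ?w \<le> \<sigma> / (1 - \<alpha>) * ?w"
    proof (intro mult_right_mono)
      have "(1 + \<alpha> / 2) * (1 - \<alpha>) \<le> \<sigma>" using \<alpha> by (simp add: \<sigma>_def algebra_simps)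
      then show "1 + \<alpha> / 2 \<le> \<sigma> / (1 - \<alpha>)" using \<alpha> by (simp add: field_simps)
    qed (use wp in simp)
    moreover have "tau t (j + 1) * dw k (t j) \<le> 2 * \<alpha> * ?w" using dw_last[of k] True by auto
    ultimately show ?thesis using wt_upper[OF j] up r by (simp add: algebra_simps)
  qed
qed

lemma wt_mono:
  assumes j: "1 \<le> j" "j < k"
  shows "wt k j \<le> wt k (j + 1)"
proof -
  have "0 \<le> dw k (t (j - 1)) * (t j - t (j - 1))" using t_le[of "j - 1" j] dw_nonneg by simp
  also have "\<dots> \<le> w k (t j) - w k (t (j - 1))"
    using w_slope[of "t (j - 1)" "t (j - 1)" "t j" "t j" k] less_tstar[OF j(2)] t_le[of "j - 1" j] by simp
  finally have "0 \<le> w k (t j) - w k (t (j - 1))" .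
  then show ?thesis using ker_step_le[OF j] by argo
qed

lemma \<sigma>_powr: "\<sigma> powr (- \<alpha>) \<le> 2" "1 / 2 \<le> \<sigma> powr (1 - \<alpha>)" "\<sigma> powr (1 - \<alpha>) \<le> 1"
proof -
  have "\<sigma> powr 1 \<le> \<sigma> powr (1 - \<alpha>)" using \<sigma> \<alpha> by (intro powr_mono') auto
  then show 1: "1 / 2 \<le> \<sigma> powr (1 - \<alpha>)" using \<sigma> by simp
  show "\<sigma> powr (1 - \<alpha>) \<le> 1" using \<sigma> \<alpha> by (intro powr_le1) auto
  have "\<sigma> powr (- \<alpha>) = 1 / \<sigma> powr \<alpha>" by (simp add: powr_minus divide_simps)
  also have "\<sigma> powr 1 \<le> \<sigma> powr \<alpha>" using \<sigma> \<alpha> by (intro powr_mono') auto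
  then have "1 / \<sigma> powr \<alpha> \<le> 2" using \<sigma> by (simp add: field_simps)
  finally show "\<sigma> powr (- \<alpha>) \<le> 2" .
qed

lemma wt_last_le:
  assumes k: "k \<ge> 1"
  shows "wt k k \<le> 5 * tau t k powr (- \<alpha>) / (1 - \<alpha>)"
proof -
  let ?p = "tau t k powr (- \<alpha>)"
  have "coef_c \<alpha> t (k - 1) k \<le> 2 * ?p"
  proof (cases "k = 1")
    case False
    then have "coef_c \<alpha> t (k - 1) k \<le> tau t k * dw k (t (k - 1)) / 2" using coef_c_bounds(2)[of "k - 1" k] k by simp
    also have "\<dots> \<le> \<alpha> * w k (t (k - 1))" using dw_last[OF k] by simp
    also have "\<dots> \<le> 1 * (2 * ?p)" unfolding w_last[OF k] using \<alpha> \<sigma>_powr by (intro mult_mono) auto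
    finally show ?thesis by simp
  qed (simp add: coef_c_def)
  moreover have "\<sigma> powr (1 - \<alpha>) / ((1 - \<alpha>) * tau t k powr \<alpha>) \<le> ?p / (1 - \<alpha>)"
  proof -
    have "\<sigma> powr (1 - \<alpha>) / ((1 - \<alpha>) * tau t k powr \<alpha>) = \<sigma> powr (1 - \<alpha>) * ?p / (1 - \<alpha>)"
      unfolding powr_minus[of "tau t k"] by (simp add: divide_inverse mult_ac)
    also have "\<dots> \<le> 1 * ?p / (1 - \<alpha>)"
      using \<sigma>_powr(3) \<alpha> by (intro divide_right_mono mult_right_mono) auto
    finally show ?thesis by simp
  qed
  moreover have "2 * ?p \<le> 2 * ?p / (1 - \<alpha>)" using \<alpha> by (simp add: field_simps)
  ultimately have "wt k k \<le> 2 * ?p / (1 - \<alpha>) + ?p / (1 - \<alpha>)" by (simp add: wt_def)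
  also have "\<dots> = 3 * ?p / (1 - \<alpha>)" by (simp add: add_divide_distrib[symmetric])
  also have "\<dots> \<le> 5 * ?p / (1 - \<alpha>)" using \<alpha> by (intro divide_right_mono) auto
  finally show ?thesis .
qed

lemma wt_11: "wt 1 1 = \<sigma> powr (1 - \<alpha>) * tau t 1 powr (- \<alpha>) / (1 - \<alpha>)"
  by (simp add: wt_def coef_c_def powr_minus divide_simps)

text \<open>The functional equation \<Gamma>(2 - \<alpha>) = (1 - \<alpha>) \<Gamma>(1 - \<alpha>)
  brings the local term under the common prefactor. For k = 1 the conventions make the first
  coefficients vanish and only the local term survives.\<close>

lemma Lstar_eq:
  assumes k: "k \<ge> 1"
  shows "Lstar \<alpha> t U k x = (1 / Gamma (1 - \<alpha>)) * (\<Sum>j=1..k. wt k j * (U j x - U (j - 1) x))"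
proof -
  define \<delta> where "\<delta> j = U j x - U (j - 1) x" for j
  have G: "Gamma (2 - \<alpha>) = (1 - \<alpha>) * Gamma (1 - \<alpha>)"
  proof -
    have "1 - \<alpha> \<notin> \<int>\<^sub>\<le>\<^sub>0" using \<alpha> by (auto elim!: nonpos_Ints_cases)
    from Gamma_plus1[OF this] show ?thesis by (simp add: algebra_simps)
  qed
  have "(\<Sum>j=1..k. wt k j * \<delta> j) = wt k k * \<delta> k + (\<Sum>j=1..k-1. wt k j * \<delta> j)"
    using k by (cases k) auto
  also have "(\<Sum>j=1..k-1. wt k j * \<delta> j) = - coef_a \<alpha> t 1 k * \<delta> 1 + (\<Sum>j=2..k-1. coef_d \<alpha> t j k * \<delta> j)"
  proof (cases "k = 1")
    case False
    then have "(\<Sum>j=1..k-1. wt k j * \<delta> j) = wt k 1 * \<delta> 1 + (\<Sum>j=2..k-1. wt k j * \<delta> j)"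
      using k by (subst sum.atLeast_Suc_atMost) (auto simp: numeral_2_eq_2)
    also have "(\<Sum>j=2..k-1. wt k j * \<delta> j) = (\<Sum>j=2..k-1. coef_d \<alpha> t j k * \<delta> j)"
      by (intro sum.cong) (auto simp: wt_def)
    finally show ?thesis using False k by (simp add: wt_def)
  qed (simp add: coef_a_def)
  finally have "(\<Sum>j=1..k. wt k j * \<delta> j) = wt k k * \<delta> k + (- coef_a \<alpha> t 1 k * \<delta> 1 + (\<Sum>j=2..k-1. coef_d \<alpha> t j k * \<delta> j))" .
  moreover have "Lstar \<alpha> t U k x =
      (1 / Gamma (1 - \<alpha>)) * (coef_c \<alpha> t (k - 1) k * \<delta> k - coef_a \<alpha> t 1 k * \<delta> 1 + (\<Sum>j=2..k-1. coef_d \<alpha> t j k * \<delta> j))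
      + \<sigma> powr (1 - \<alpha>) / (Gamma (2 - \<alpha>) * tau t k powr \<alpha>) * \<delta> k"
    unfolding Lstar_def Let_def \<delta>_def \<sigma>_def ..
  moreover have "wt k k = coef_c \<alpha> t (k - 1) k + \<sigma> powr (1 - \<alpha>) / ((1 - \<alpha>) * tau t k powr \<alpha>)"
    by (simp add: wt_def)
  moreover have "\<sigma> powr (1 - \<alpha>) / (Gamma (2 - \<alpha>) * tau t k powr \<alpha>) =
      (1 / Gamma (1 - \<alpha>)) * (\<sigma> powr (1 - \<alpha>) / ((1 - \<alpha>) * tau t k powr \<alpha>))"
    unfolding G by (simp add: divide_inverse mult_ac)
  ultimately show ?thesis
    unfolding \<delta>_def[symmetric] by (simp only: ring_distribs mult.assoc)
qed

end

section \<open>Truncation errors\<close>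

text \<open>Derivatives are required in the open interval only, because those of the solution may
  blow up at 0, the left end of the first interval.\<close>

lemma mvt_open:
  fixes f f' :: "real \<Rightarrow> real"
  assumes "a < b" "continuous_on {a..b} f" "\<And>x. a < x \<Longrightarrow> x < b \<Longrightarrow> (f has_real_derivative f' x) (at x)"
  obtains z where "a < z" "z < b" "f b - f a = (b - a) * f' z"
proof -
  have "\<exists>l z. a < z \<and> z < b \<and> DERIV f z :> l \<and> f b - f a = (b - a) * l"
    using assms by (intro MVT) (auto simp: real_differentiable_def)
  then show ?thesis using that assms(3) DERIV_unique by blast
qed

lemma derivative_bound_open:
  fixes f f' :: "real \<Rightarrow> real"
  assumes "\<And>x. a < x \<Longrightarrow> x < b \<Longrightarrow> (f has_real_derivative f' x) (at x)" "\<And>x. a < x \<Longrightarrow> x < b \<Longrightarrow> \<bar>f' x\<bar> \<le> M"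
    and "a < x" "x < b" "a < y" "y < b"
  shows "\<bar>f x - f y\<bar> \<le> M * \<bar>x - y\<bar>"
  using field_differentiable_bound[of "{a<..<b}" f f' M x y] assms
  by (auto intro: has_field_derivative_at_within)

lemma two_point_error:
  fixes f f1 f2 :: "real \<Rightarrow> real"
  assumes ab: "a < b" and cont: "continuous_on {a..b} f" and zero: "f a = 0" "f b = 0"
    and d1: "\<And>x. a < x \<Longrightarrow> x < b \<Longrightarrow> (f has_real_derivative f1 x) (at x)"
    and d2: "\<And>x. a < x \<Longrightarrow> x < b \<Longrightarrow> (f1 has_real_derivative f2 x) (at x)"
    and M: "\<And>x. a < x \<Longrightarrow> x < b \<Longrightarrow> \<bar>f2 x\<bar> \<le> M" and s: "a \<le> s" "s \<le> b"
  shows "\<bar>f s\<bar> \<le> M * (b - a)\<^sup>2"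
proof -
  have M0: "0 \<le> M" using order_trans[OF abs_ge_zero M[of "(a + b) / 2"]] ab by simp
  obtain z where z: "a < z" "z < b" "f1 z = 0" using mvt_open[OF ab cont d1] zero ab by auto
  have f1: "\<bar>f1 x\<bar> \<le> M * (b - a)" if "a < x" "x < b" for x
  proof -
    have "\<bar>f1 x - f1 z\<bar> \<le> M * \<bar>x - z\<bar>" using derivative_bound_open[OF d2 M that z(1,2)] .
    also have "\<dots> \<le> M * (b - a)" using M0 that z by (intro mult_left_mono) auto
    finally show ?thesis using z by simp
  qed
  show ?thesis
  proof (cases "s = a \<or> s = b")
    case False
    then have as: "a < s" "s < b" using s by auto
    obtain x where x: "a < x" "x < s" "f s - f a = (s - a) * f1 x"
      using mvt_open[OF as(1), of f f1] continuous_on_subset[OF cont, of "{a..s}"] as d1 by auto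
    have "\<bar>f s\<bar> = (s - a) * \<bar>f1 x\<bar>" using x zero as by (simp add: abs_mult)
    also have "\<dots> \<le> (b - a) * (M * (b - a))" using f1[of x] x as M0 by (intro mult_mono) auto
    finally show ?thesis by (simp add: power2_eq_square algebra_simps)
  qed (use zero M0 in auto)
qed

text \<open>Three zeros of f give two of f1 and hence one of f2, which bounds f2 by M (c - a). On
  [a, b] the function vanishes at both ends, so the two-point estimate finishes.\<close>

lemma three_point_error:
  fixes f f1 f2 f3 :: "real \<Rightarrow> real"
  assumes ab: "a < b" "b < c" and cont: "continuous_on {a..c} f" and zero: "f a = 0" "f b = 0" "f c = 0"
    and d1: "\<And>x. a < x \<Longrightarrow> x < c \<Longrightarrow> (f has_real_derivative f1 x) (at x)"
    and d2: "\<And>x. a < x \<Longrightarrow> x < c \<Longrightarrow> (f1 has_real_derivative f2 x) (at x)"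
    and d3: "\<And>x. a < x \<Longrightarrow> x < c \<Longrightarrow> (f2 has_real_derivative f3 x) (at x)"
    and M: "\<And>x. a < x \<Longrightarrow> x < c \<Longrightarrow> \<bar>f3 x\<bar> \<le> M" and s: "a \<le> s" "s \<le> b"
  shows "\<bar>f s\<bar> \<le> M * (c - a) * (b - a)\<^sup>2"
proof -
  have M0: "0 \<le> M" using order_trans[OF abs_ge_zero M[of b]] ab by simp
  obtain z1 where z1: "a < z1" "z1 < b" "f1 z1 = 0"
    using mvt_open[OF ab(1), of f f1] continuous_on_subset[OF cont, of "{a..b}"] zero ab d1 by auto
  obtain z2 where z2: "b < z2" "z2 < c" "f1 z2 = 0"
    using mvt_open[OF ab(2), of f f1] continuous_on_subset[OF cont, of "{b..c}"] zero ab d1 by auto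
  have "continuous_on {z1..z2} f1"
    using z1 z2 d2 by (intro DERIV_continuous_on[where D=f2]) (auto intro: has_field_derivative_at_within)
  then obtain z where z: "z1 < z" "z < z2" "f2 z = 0"
    using mvt_open[of z1 z2 f1 f2] z1 z2 d2 by auto
  have f2: "\<bar>f2 x\<bar> \<le> M * (c - a)" if "a < x" "x < c" for x
  proof -
    have "\<bar>f2 x - f2 z\<bar> \<le> M * \<bar>x - z\<bar>" using derivative_bound_open[OF d3 M that, of z] z z1 z2 by auto
    also have "\<dots> \<le> M * (c - a)" using M0 that z z1 z2 by (intro mult_left_mono) auto
    finally show ?thesis using z by simp
  qed
  show ?thesis
    by (rule two_point_error[OF ab(1) _ zero(1,2) _ _ _ s, of f1 f2])
      (use continuous_on_subset[OF cont, of "{a..b}"] d1 d2 f2 ab in auto)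
qed

lemma affine_change:
  fixes f :: "real \<Rightarrow> real"
  assumes f: "continuous_on {a..b} f" and ab: "a < b"
  shows "(f has_integral ((b - a) * integral {0..1} (\<lambda>\<theta>. f (a + \<theta> * (b - a))))) {a..b}"
proof -
  have i: "(f has_integral integral {a..b} f) (cbox a b)"
    using f by (simp add: integrable_continuous_real integrable_integral)
  have "((\<lambda>x. f ((b - a) * x + a)) has_integral (integral {a..b} f / (b - a))) {0..1}"
    using has_integral_affinity'[OF i, of "b - a" a] ab by (simp add: divide_inverse mult.commute)
  then have "integral {0..1} (\<lambda>x. f ((b - a) * x + a)) = integral {a..b} f / (b - a)"
    by (rule integral_unique)
  moreover have "(\<lambda>x. f ((b - a) * x + a)) = (\<lambda>\<theta>. f (a + \<theta> * (b - a)))" by (simp add: algebra_simps)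
  ultimately have "(b - a) * integral {0..1} (\<lambda>\<theta>. f (a + \<theta> * (b - a))) = integral {a..b} f" using ab by simp
  then show ?thesis using i by simp
qed

lemma FTC_open:
  fixes F f :: "real \<Rightarrow> real"
  assumes "a \<le> b" "continuous_on {a..b} F" "\<And>x. a < x \<Longrightarrow> x < b \<Longrightarrow> (F has_real_derivative f x) (at x)"
  shows "(f has_integral (F b - F a)) {a..b}"
  using assms by (intro fundamental_theorem_of_calculus_interior)
    (auto simp: has_real_derivative_iff_has_vector_derivative)

lemma has_integral_abs_le:
  fixes f g :: "real \<Rightarrow> real"
  assumes "(f has_integral I) S" "(g has_integral J) S" "\<And>x. x \<in> S \<Longrightarrow> \<bar>f x\<bar> \<le> g x"
  shows "\<bar>I\<bar> \<le> J"
proof -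
  have "norm (integral S f) \<le> integral S g"
    using assms by (intro Henstock_Kurzweil_Integration.integral_norm_bound_integral) (auto simp: integrable_on_def)
  then show ?thesis using integral_unique[OF assms(1)] integral_unique[OF assms(2)] by simp
qed

lemma powr_integral:
  assumes "0 < a" "0 \<le> (b::real)"
  shows "((\<lambda>r. r powr (a - 1)) has_integral (b powr a / a)) {0..b}"
proof -
  have "((\<lambda>r. r powr (a - 1)) has_integral (b powr a / a - 0 powr a / a)) {0..b}"
  proof (rule FTC_open[OF assms(2)])
    show "continuous_on {0..b} (\<lambda>r. r powr a / a)"
      using assms by (intro continuous_intros continuous_on_powr') auto
    show "((\<lambda>r. r powr a / a) has_real_derivative x powr (a - 1)) (at x)" if "0 < x" for x
      using that assms by (auto intro!: derivative_eq_intros)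
  qed
  then show ?thesis by simp
qed

section \<open>Kernel integrals and the weights regrouped by intervals\<close>

context l21_mesh
begin

lemma dw_integral:
  assumes "a \<le> b" "b < tstar \<alpha> t k"
  shows "(dw k has_integral (w k b - w k a)) {a..b}"
  using assms by (intro FTC_real w_deriv) auto

lemma w_integral:
  assumes "a \<le> tstar \<alpha> t k"
  shows "(w k has_integral ((tstar \<alpha> t k - a) powr (1 - \<alpha>) / (1 - \<alpha>))) {a..tstar \<alpha> t k}"
proof -
  let ?c = "tstar \<alpha> t k"
  let ?F = "\<lambda>s. - ((?c - s) powr (1 - \<alpha>) / (1 - \<alpha>))"
  have "(w k has_integral (?F ?c - ?F a)) {a..?c}"
  proof (rule FTC_open[OF assms])
    show "continuous_on {a..?c} ?F"
      using \<alpha> by (intro continuous_intros continuous_on_powr') auto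
    show "(?F has_real_derivative w k x) (at x)" if "x < ?c" for x
      using that \<alpha> by (auto intro!: derivative_eq_intros simp: w_def)
  qed
  then show ?thesis by simp
qed

text \<open>This identity is the reason for \<open>\<sigma> = 1 - \<alpha>/2\<close>.\<close>

lemma linear_moment:
  assumes k: "k \<ge> 1"
  shows "((\<lambda>s. w k s * (s - (t (k - 1) + tau t k / 2))) has_integral 0) {t (k - 1)..tstar \<alpha> t k}"
proof -
  let ?c = "tstar \<alpha> t k" and ?a = "t (k - 1)" and ?\<tau> = "tau t k"
  let ?F = "\<lambda>s. - ?\<tau> / 2 * (?c - s) powr (1 - \<alpha>) + (?c - s) powr (2 - \<alpha>) / (2 - \<alpha>)"
  have c: "?c - ?a = \<sigma> * ?\<tau>" by (simp add: tstar_eq)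
  have ac: "?a < ?c" using tstar_bounds[OF k] by simp
  have F: "((\<lambda>s. w k s * (s - (?a + ?\<tau> / 2))) has_integral (?F ?c - ?F ?a)) {?a..?c}"
  proof (rule FTC_open)
    show "?a \<le> ?c" using ac by simp
    show "continuous_on {?a..?c} ?F"
      using \<alpha> by (intro continuous_intros continuous_on_powr') auto
    fix x assume x: "x < ?c"
    have p: "(?c - x) powr (1 - \<alpha>) = (?c - x) * w k x"
      using x powr_add[of "?c - x" 1 "- \<alpha>"] by (simp add: w_def)
    have "(?F has_real_derivative (?\<tau> / 2 * (1 - \<alpha>) * (?c - x) powr (- \<alpha>) - (?c - x) powr (1 - \<alpha>))) (at x)"
      using x \<alpha> by (auto intro!: derivative_eq_intros)
    also have "?\<tau> / 2 * (1 - \<alpha>) * (?c - x) powr (- \<alpha>) - (?c - x) powr (1 - \<alpha>) = w k x * (x - (?a + ?\<tau> / 2))"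
    proof -
      have "(?c - x) powr (- \<alpha>) = w k x" by (simp add: w_def)
      moreover have "?\<tau> / 2 * (1 - \<alpha>) - (?c - x) = x - (?a + ?\<tau> / 2)"
        by (simp add: tstar_eq \<sigma>_def field_simps)
      moreover have "?\<tau> / 2 * (1 - \<alpha>) * w k x - (?c - x) * w k x = w k x * (?\<tau> / 2 * (1 - \<alpha>) - (?c - x))"
        by (simp add: algebra_simps)
      ultimately show ?thesis unfolding p by simp
    qed
    finally show "(?F has_real_derivative w k x * (x - (?a + ?\<tau> / 2))) (at x)" .
  qed
  have "?F ?a = 0"
  proof -
    have "(\<sigma> * ?\<tau>) powr (2 - \<alpha>) = (\<sigma> * ?\<tau>) * (\<sigma> * ?\<tau>) powr (1 - \<alpha>)"
      using powr_add[of "\<sigma> * ?\<tau>" 1 "1 - \<alpha>"] tau_pos[OF k] \<sigma> by simp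
    \<comment> \<open>With this value the two terms of the antiderivative cancel at the left end; at
      the right end both powers vanish.\<close>
    moreover have "\<sigma> / (2 - \<alpha>) = 1 / 2" using \<alpha> by (simp add: \<sigma>_def field_simps)
    then have "\<sigma> * ?\<tau> * X / (2 - \<alpha>) = ?\<tau> / 2 * X" for X
      by (metis (no_types, lifting) mult.assoc mult.commute mult.left_neutral times_divide_eq_left times_divide_eq_right)
    ultimately show ?thesis unfolding c by simp
  qed
  then have "?F ?c - ?F ?a = 0" by simp
  with F show ?thesis by (simp only:)
qed

text \<open>\<open>tau t k * P k\<close> is the kernel integral over the last partial interval, so
  \<open>P k\<close> times an increment is the kernel integrated against the slope of the linear
  interpolant.\<close>

definition P where "P k = \<sigma> powr (1 - \<alpha>) / ((1 - \<alpha>) * tau t k powr \<alpha>)"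

lemma P_nonneg: "0 \<le> P k" using \<alpha> by (simp add: P_def)

lemma w_integral_last:
  assumes k: "k \<ge> 1"
  shows "(w k has_integral (tau t k * P k)) {t (k - 1)..tstar \<alpha> t k}"
proof -
  have tp: "tau t k > 0" using tau_pos[OF k] .
  have "(tstar \<alpha> t k - t (k - 1)) powr (1 - \<alpha>) / (1 - \<alpha>) = tau t k * P k"
    using tp \<sigma> by (simp add: tstar_eq P_def powr_mult powr_diff mult_ac)
  then show ?thesis using w_integral[of "t (k - 1)" k] tstar_bounds[OF k] by simp
qed

lemma P_le_wt: "k \<ge> 1 \<Longrightarrow> P k \<le> wt k k"
  using coef_c_last_nonneg[of k] by (simp add: wt_def P_def)

text \<open>The weights collect everything that multiplies one increment; here the same sum is read
  by intervals, where interval j carries both \<delta>_j and \<delta>_(j+1). Each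
  \<open>coef_d\<close> splits between two neighbouring intervals.\<close>

lemma wt_sum_eq:
  assumes k: "k \<ge> 1"
  shows "(\<Sum>j=1..k. wt k j * \<delta> j) = (\<Sum>j=1..k-1. - coef_a \<alpha> t j k * \<delta> j + coef_c \<alpha> t j k * \<delta> (j + 1)) + P k * \<delta> k"
proof (cases "k = 1")
  case False
  have *: "1 \<le> m \<Longrightarrow> m < k \<Longrightarrow> (\<Sum>j=1..m. - coef_a \<alpha> t j k * \<delta> j + coef_c \<alpha> t j k * \<delta> (j + 1)) =
      (\<Sum>j=1..m. wt k j * \<delta> j) + coef_c \<alpha> t m k * \<delta> (m + 1)" for m
  proof (induction m rule: nat_induct_at_least)
    case base
    then show ?case by (simp add: wt_def)
  next
    case (Suc m)
    then show ?case by (simp add: wt_def coef_d_def algebra_simps)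
  qed
  have "(\<Sum>j=1..k. wt k j * \<delta> j) = wt k k * \<delta> k + (\<Sum>j=1..k-1. wt k j * \<delta> j)"
    using k by (cases k) auto
  then show ?thesis using *[of "k - 1"] False k by (simp add: wt_def P_def algebra_simps)
qed (simp add: wt_def P_def coef_c_def)

lemma quadratic_piece:
  fixes p q :: real
  assumes j: "1 \<le> j" "j < k"
  shows "((\<lambda>s. w k s * (p + (2 * s - t (j - 1) - t j) * q)) has_integral (tau t j * (p * W k j + tau t j * q * B k j))) {t (j - 1)..t j}"
proof -
  let ?a = "t (j - 1)" and ?b = "t j"
  have ba: "?b - ?a = tau t j" by (simp add: tau_def)
  have cont: "continuous_on {?a..?b} (\<lambda>s. w k s * (p + (2 * s - ?a - ?b) * q))"
    by (intro continuous_intros w_continuous) (use less_tstar[OF j(2)] in auto)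
  have "(\<lambda>\<theta>. w k (?a + \<theta> * (?b - ?a)) * (p + (2 * (?a + \<theta> * (?b - ?a)) - ?a - ?b) * q)) =
      (\<lambda>\<theta>. p * w k (?a + \<theta> * tau t j) + (tau t j * q) * ((2 * \<theta> - 1) * w k (?a + \<theta> * tau t j)))"
  proof
    fix \<theta>
    have e: "2 * (?a + \<theta> * tau t j) - ?a - ?b = (2 * \<theta> - 1) * tau t j" unfolding ba[symmetric] by (simp add: algebra_simps)
    show "w k (?a + \<theta> * (?b - ?a)) * (p + (2 * (?a + \<theta> * (?b - ?a)) - ?a - ?b) * q) =
        p * w k (?a + \<theta> * tau t j) + (tau t j * q) * ((2 * \<theta> - 1) * w k (?a + \<theta> * tau t j))"
      unfolding ba e by (simp add: algebra_simps)
  qed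
  note eq1 = this
  have eq2: "integral {0..1} (\<lambda>\<theta>. p * w k (?a + \<theta> * tau t j) + (tau t j * q) * ((2 * \<theta> - 1) * w k (?a + \<theta> * tau t j)))
     = p * W k j + tau t j * q * B k j"
    unfolding W_def B_def integral_mult_right[symmetric]
    by (intro Henstock_Kurzweil_Integration.integral_add integrable_continuous_real continuous_intros theta_kernel_continuous j)
  have "?a < ?b" using t_less[of "j - 1" j] j by simp
  from affine_change[OF cont this, unfolded eq1 eq2] show ?thesis by (simp only: ba)
qed

text \<open>The coefficients are the exact kernel integrals of the derivative of the quadratic
  interpolant through t (j - 1), t j and t (j + 1); the factor of \<open>B k j\<close> contains its
  second divided difference.\<close>

lemma interpolation_piece_value:
  assumes j: "1 \<le> j" "j < k"
  shows "tau t j * (d / tau t j * W k j + tau t j * ((d' / tau t (j + 1) - d / tau t j) / (tau t j + tau t (j + 1))) * B k j) =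
    - coef_a \<alpha> t j k * d + coef_c \<alpha> t j k * d'"
proof -
  define s where "s = tau t j + tau t (j + 1)"
  have tp: "tau t j > 0" "tau t (j + 1) > 0" "s > 0" using tau_pos j by (auto simp: s_def add_pos_pos)
  have "a * (d / a * X + a * ((d' / b - d / a) / s) * Y) = (X - a / s * Y) * d + a\<^sup>2 / (b * s) * Y * d'"
    if "a > 0" "b > 0" "s > 0" for a b s X Y :: real
    using that by (simp add: field_simps power2_eq_square)
  from this[OF tp] show ?thesis unfolding coef_a_eq[OF j] coef_c_eq[OF j] s_def[symmetric] by simp
qed

text \<open>The error vanishes at both ends, so the derivative moves onto the kernel without
  boundary terms and only the size of \<epsilon> matters, not that of \<epsilon>', which may be
  unbounded near 0. Integrability of the original product is obtained along the way.\<close>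

lemma by_parts_piece:
  assumes ab: "a < b" "b < tstar \<alpha> t k" and cont: "continuous_on {a..b} \<epsilon>" and zero: "\<epsilon> a = 0" "\<epsilon> b = 0"
    and der: "\<And>x. a < x \<Longrightarrow> x < b \<Longrightarrow> (\<epsilon> has_real_derivative \<epsilon>' x) (at x)"
    and M: "\<And>s. a \<le> s \<Longrightarrow> s \<le> b \<Longrightarrow> \<bar>\<epsilon> s\<bar> \<le> M"
  shows "\<exists>J. ((\<lambda>s. w k s * \<epsilon>' s) has_integral J) {a..b} \<and> \<bar>J\<bar> \<le> M * (w k b - w k a)"
proof -
  have lt: "s < tstar \<alpha> t k" if "s \<le> b" for s using that ab by simp
  have dwc: "continuous_on {a..b} (dw k)" unfolding dw_def[abs_def] using lt by (intro continuous_intros) force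
  have 1: "((\<lambda>s. w k s * \<epsilon>' s + dw k s * \<epsilon> s) has_integral (w k b * \<epsilon> b - w k a * \<epsilon> a)) {a..b}"
  proof (rule FTC_open)
    show "continuous_on {a..b} (\<lambda>s. w k s * \<epsilon> s)" using lt by (intro continuous_intros w_continuous cont) auto
    show "((\<lambda>s. w k s * \<epsilon> s) has_real_derivative w k x * \<epsilon>' x + dw k x * \<epsilon> x) (at x)" if "a < x" "x < b" for x
      using DERIV_mult'[OF w_deriv[of x k UNIV] der[OF that]] lt[of x] that by (simp add: algebra_simps)
  qed (use ab in simp)
  have "(\<lambda>s. dw k s * \<epsilon> s) integrable_on {a..b}"
    by (intro integrable_continuous_real continuous_intros dwc cont)
  then obtain J where J: "((\<lambda>s. dw k s * \<epsilon> s) has_integral J) {a..b}" by (auto simp: integrable_on_def)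
  have "\<bar>J\<bar> \<le> M * (w k b - w k a)"
  proof (rule has_integral_abs_le[OF J])
    show "((\<lambda>s. M * dw k s) has_integral M * (w k b - w k a)) {a..b}"
      using ab by (intro has_integral_mult_right dw_integral) auto
    show "\<bar>dw k s * \<epsilon> s\<bar> \<le> M * dw k s" if "s \<in> {a..b}" for s
      using M[of s] that dw_nonneg[of k s] by (simp add: abs_mult mult.commute mult_right_mono)
  qed
  moreover have "((\<lambda>s. w k s * \<epsilon>' s) has_integral - J) {a..b}"
    using has_integral_diff[OF 1 J] zero by simp
  ultimately show ?thesis by (intro exI[of _ "- J"]) auto
qed

text \<open>The antiderivative of 1 + s powr (\<alpha> - 1) that vanishes at 0, hence the growth
  allowed by the bound on the first derivative.\<close>

definition N :: "real \<Rightarrow> real" where "N s = s + s powr \<alpha> / \<alpha>"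

lemma N_mono: "0 \<le> s \<Longrightarrow> s \<le> r \<Longrightarrow> N s \<le> N r"
  unfolding N_def using \<alpha> by (intro add_mono divide_right_mono powr_mono2) auto

lemma N_nonneg: "0 \<le> s \<Longrightarrow> 0 \<le> N s"
  using \<alpha> by (simp add: N_def)

text \<open>\<open>Gf\<close> bounds the interpolation error on the \<open>j\<close>-th interval and \<open>Hf k * wt k k\<close> the local error on the last one.\<close>

definition Gf :: "real \<Rightarrow> real \<Rightarrow> nat \<Rightarrow> real" where
  "Gf K1 K3 j = (if j = 1 then 4 * K1 * N (t 2) else K3 * (1 + t (j - 1) powr (\<alpha> - 3)) * tau t j ^ 3 * (1 + rho t (j + 1)))"

definition Hf :: "real \<Rightarrow> real \<Rightarrow> nat \<Rightarrow> real" where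
  "Hf K1 K3 k = (if k = 1 then 5 * K1 * N (t 1) else K3 * (1 + t (k - 1) powr (\<alpha> - 3)) * tau t k ^ 3)"

end

text \<open>Models s -> \<Lambda> (u s) for a linear functional \<Lambda>; the constants are those
  of the solution times the norm of \<Lambda>. At 0 only right continuity is available.\<close>

locale l21_scalar = l21_mesh +
  fixes \<phi> \<phi>1 \<phi>2 \<phi>3 :: "real \<Rightarrow> real" and T K1 K2 K3 :: real
  assumes T: "0 < T" and K: "0 \<le> K1" "0 \<le> K2" "0 \<le> K3"
    and lim0: "(\<phi> \<longlongrightarrow> \<phi> 0) (at_right 0)"
    and d1: "\<And>s. 0 < s \<Longrightarrow> s \<le> T \<Longrightarrow> (\<phi> has_real_derivative \<phi>1 s) (at s within {0<..T})"
    and d2: "\<And>s. 0 < s \<Longrightarrow> s \<le> T \<Longrightarrow> (\<phi>1 has_real_derivative \<phi>2 s) (at s within {0<..T})"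
    and d3: "\<And>s. 0 < s \<Longrightarrow> s \<le> T \<Longrightarrow> (\<phi>2 has_real_derivative \<phi>3 s) (at s within {0<..T})"
    and b1: "\<And>s. 0 < s \<Longrightarrow> s \<le> T \<Longrightarrow> \<bar>\<phi>1 s\<bar> \<le> K1 * (1 + s powr (\<alpha> - 1))"
    and b2: "\<And>s. 0 < s \<Longrightarrow> s \<le> T \<Longrightarrow> \<bar>\<phi>2 s\<bar> \<le> K2 * (1 + s powr (\<alpha> - 2))"
    and b3: "\<And>s. 0 < s \<Longrightarrow> s \<le> T \<Longrightarrow> \<bar>\<phi>3 s\<bar> \<le> K3 * (1 + s powr (\<alpha> - 3))"
begin

section \<open>Growth and interpolation errors of a scalar solution\<close>

lemma at_eq: "0 < s \<Longrightarrow> s < T \<Longrightarrow> at s within {0<..T} = at s"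
  by (intro at_within_interior interiorI[of "{0<..<T}"]) auto

lemma
  assumes "0 < s" "s < T"
  shows der1: "(\<phi> has_real_derivative \<phi>1 s) (at s)"
    and der2: "(\<phi>1 has_real_derivative \<phi>2 s) (at s)"
    and der3: "(\<phi>2 has_real_derivative \<phi>3 s) (at s)"
  using d1[of s] d2[of s] d3[of s] assms at_eq[OF assms] by auto

lemma cont_pos:
  shows "continuous_on {0<..T} \<phi>" "continuous_on {0<..T} \<phi>1" "continuous_on {0<..T} \<phi>2"
  by (rule DERIV_continuous_on; use d1 d2 d3 in force)+

lemma cont: "continuous_on {0..T} \<phi>"
  unfolding continuous_on_def
proof
  fix s assume s: "s \<in> {0..T}"
  show "(\<phi> \<longlongrightarrow> \<phi> s) (at s within {0..T})"
  proof (cases "s = 0")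
    case True
    then show ?thesis using lim0 T by (simp add: at_within_Icc_at_right)
  next
    case False
    then have "at s within {0..T} = at s within {0<..T}"
      using s by (intro at_within_nhd[of s "{0<..}"]) auto
    then show ?thesis using cont_pos(1) s False by (simp add: continuous_on_def)
  qed
qed

lemma cont_sub: "0 \<le> a \<Longrightarrow> b \<le> T \<Longrightarrow> continuous_on {a..b} \<phi>"
  by (rule continuous_on_subset[OF cont]) auto

text \<open>The derivative is unbounded near 0, so a plain Lipschitz estimate fails; instead K1 N
  minus or plus \<phi> has a nonnegative derivative. The sign \<open>c\<close> treats both cases at
  once.\<close>

lemma growth:
  assumes "0 \<le> s" "s \<le> T"
  shows "\<bar>\<phi> s - \<phi> 0\<bar> \<le> K1 * N s"
proof (cases "s = 0")
  case False
  then have s: "0 < s" using assms by simp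
  have Nc: "continuous_on {0..s} N"
    unfolding N_def[abs_def] using \<alpha> by (intro continuous_intros continuous_on_powr') auto
  have Nd: "(N has_real_derivative (1 + x powr (\<alpha> - 1))) (at x)" if "0 < x" for x
    unfolding N_def[abs_def] using that \<alpha> by (auto intro!: derivative_eq_intros)
  have *: "0 \<le> K1 * N s - c * (\<phi> s - \<phi> 0)" if c: "\<bar>c\<bar> = 1" for c
  proof -
    obtain z where z: "0 < z" "z < s"
      "(K1 * N s - c * \<phi> s) - (K1 * N 0 - c * \<phi> 0) = (s - 0) * (K1 * (1 + z powr (\<alpha> - 1)) - c * \<phi>1 z)"
      by (rule mvt_open[OF s, of "\<lambda>s. K1 * N s - c * \<phi> s" "\<lambda>s. K1 * (1 + s powr (\<alpha> - 1)) - c * \<phi>1 s"])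
        (auto intro!: continuous_intros Nc cont_sub derivative_eq_intros Nd der1 simp: assms order.strict_trans2[OF _ assms(2)])
    have "\<bar>c * \<phi>1 z\<bar> \<le> K1 * (1 + z powr (\<alpha> - 1))" using b1[of z] z assms c by (simp add: abs_mult)
    then have "0 \<le> (s - 0) * (K1 * (1 + z powr (\<alpha> - 1)) - c * \<phi>1 z)" using s by simp
    then show ?thesis using z(3) \<alpha> by (simp add: N_def algebra_simps)
  qed
  show ?thesis using *[of 1] *[of "-1"] by (simp add: abs_le_iff)
qed (simp add: N_def)

lemma d3_bound:
  assumes "0 < a" "a \<le> s" "s \<le> T"
  shows "\<bar>\<phi>3 s\<bar> \<le> K3 * (1 + a powr (\<alpha> - 3))"
proof -
  have "s powr (\<alpha> - 3) \<le> a powr (\<alpha> - 3)" using assms \<alpha> by (intro powr_mono2') auto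
  then have "K3 * (1 + s powr (\<alpha> - 3)) \<le> K3 * (1 + a powr (\<alpha> - 3))" using K by (intro mult_left_mono) auto
  then show ?thesis using b3[of s] assms by simp
qed

lemma d2_bound:
  assumes "0 < a" "a \<le> s" "s \<le> T"
  shows "\<bar>\<phi>2 s\<bar> \<le> K2 * (1 + a powr (\<alpha> - 2))"
proof -
  have "s powr (\<alpha> - 2) \<le> a powr (\<alpha> - 2)" using assms \<alpha> by (intro powr_mono2') auto
  then have "K2 * (1 + s powr (\<alpha> - 2)) \<le> K2 * (1 + a powr (\<alpha> - 2))" using K by (intro mult_left_mono) auto
  then show ?thesis using b2[of s] assms by simp
qed

abbreviation "G \<equiv> Gf K1 K3"

abbreviation "H \<equiv> Hf K1 K3"

definition \<delta> :: "nat \<Rightarrow> real" where "\<delta> j = \<phi> (t j) - \<phi> (t (j - 1))"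

text \<open>The second divided difference of \<phi> at t (j - 1), t j, t (j + 1), which is the
  leading coefficient of the quadratic interpolant in Newton form.\<close>

definition q :: "nat \<Rightarrow> real" where
  "q j = (\<delta> (j + 1) / tau t (j + 1) - \<delta> j / tau t j) / (tau t j + tau t (j + 1))"

definition ierr :: "nat \<Rightarrow> real \<Rightarrow> real" where
  "ierr j s = \<phi> (t (j - 1)) + (s - t (j - 1)) * (\<delta> j / tau t j) + (s - t (j - 1)) * (s - t j) * q j - \<phi> s"

lemma ierr_zero:
  assumes j: "1 \<le> j"
  shows "ierr j (t (j - 1)) = 0" "ierr j (t j) = 0" "ierr j (t (j + 1)) = 0"
proof -
  have tp: "tau t j > 0" "tau t (j + 1) > 0" using tau_pos j by auto
  have tt: "t j - t (j - 1) = tau t j" "t (j + 1) - t j = tau t (j + 1)" "t (j + 1) - t (j - 1) = tau t j + tau t (j + 1)"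
    by (auto simp: tau_def)
  show "ierr j (t (j - 1)) = 0" by (simp add: ierr_def)
  show "ierr j (t j) = 0" unfolding ierr_def tt using tp by (simp add: \<delta>_def)
  have "(tau t j + tau t (j + 1)) * tau t (j + 1) * q j = tau t (j + 1) * (\<delta> (j + 1) / tau t (j + 1) - \<delta> j / tau t j)"
    unfolding q_def using tp by simp
  also have "\<dots> = \<delta> (j + 1) - tau t (j + 1) * (\<delta> j / tau t j)" using tp by (simp add: right_diff_distrib)
  finally have "ierr j (t (j + 1)) = \<phi> (t (j - 1)) + (tau t j + tau t (j + 1)) * (\<delta> j / tau t j) + (\<delta> (j + 1) - tau t (j + 1) * (\<delta> j / tau t j)) - \<phi> (t (j + 1))"
    unfolding ierr_def tt by simp
  also have "(tau t j + tau t (j + 1)) * (\<delta> j / tau t j) = \<delta> j + tau t (j + 1) * (\<delta> j / tau t j)"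
    unfolding distrib_right using tp by simp
  also have "\<phi> (t (j - 1)) + (\<delta> j + tau t (j + 1) * (\<delta> j / tau t j)) + (\<delta> (j + 1) - tau t (j + 1) * (\<delta> j / tau t j)) - \<phi> (t (j + 1))
    = \<phi> (t (j - 1)) + \<delta> j + \<delta> (j + 1) - \<phi> (t (j + 1))" by simp
  also have "\<dots> = 0" by (simp add: \<delta>_def)
  finally show "ierr j (t (j + 1)) = 0" .
qed

lemma ierr_deriv:
  assumes "0 < s" "s < T"
  shows "(ierr j has_real_derivative (\<delta> j / tau t j + (2 * s - t (j - 1) - t j) * q j - \<phi>1 s)) (at s)"
proof -
  have "((\<lambda>s. c + (s - a) * p + (s - a) * (s - b) * r - \<phi> s) has_real_derivative (p + (2 * s - a - b) * r - \<phi>1 s)) (at s)" for a b c p r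
    by (auto intro!: derivative_eq_intros der1[OF assms] simp: algebra_simps)
  then show ?thesis unfolding ierr_def[abs_def] .
qed

lemma ierr_cont: "0 \<le> a \<Longrightarrow> b \<le> T \<Longrightarrow> continuous_on {a..b} (ierr j)"
  unfolding ierr_def[abs_def] by (intro continuous_intros cont_sub)

text \<open>The third derivative is not controlled near 0, so each term of the interpolant is
  estimated through increments of \<phi>, all at most a multiple of R. The quadratic term uses s (t
  1 - s) \<le> (t 1)^2 / 4 and the step ratio.\<close>

lemma ierr_bound_first:
  assumes T2: "t 2 \<le> T" and s: "0 \<le> s" "s \<le> t 1"
  shows "\<bar>ierr 1 s\<bar> \<le> 4 * K1 * N (t 2)"
proof -
  let ?a = "tau t 1" and ?b = "tau t 2"
  define R where "R = K1 * N (t 2)"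
  have tp: "?a > 0" "?b > 0" using tau_pos by auto
  have t1: "t 1 = ?a" by (simp add: tau_def t0)
  have t12: "t 1 \<le> t 2" by (rule t_le) simp
  have gr: "\<bar>\<phi> r - \<phi> 0\<bar> \<le> R" if "0 \<le> r" "r \<le> t 2" for r
  proof -
    have "K1 * N r \<le> R" unfolding R_def using K that by (intro mult_left_mono N_mono) auto
    then show ?thesis using growth[of r] that T2 by simp
  qed
  have R: "0 \<le> R" using gr[of 0] t_nonneg[of 2] by simp
  have del: "\<bar>\<delta> 1\<bar> \<le> R" "\<bar>\<delta> 2\<bar> \<le> 2 * R"
    using gr[of "t 1"] gr[of "t 2"] t_nonneg[of 1] t_nonneg[of 2] t12 t0 by (auto simp: \<delta>_def)
  have q1: "\<bar>q 1\<bar> \<le> (2 * R / ?b + R / ?a) / ?a"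
  proof -
    have "\<bar>\<delta> 2 / ?b\<bar> \<le> 2 * R / ?b" "\<bar>\<delta> 1 / ?a\<bar> \<le> R / ?a" using tp del by (auto simp: divide_right_mono)
    then have n: "\<bar>\<delta> 2 / ?b - \<delta> 1 / ?a\<bar> \<le> 2 * R / ?b + R / ?a" by linarith
    have "\<bar>q 1\<bar> = \<bar>\<delta> 2 / ?b - \<delta> 1 / ?a\<bar> / (?a + ?b)" using tp by (simp add: q_def numeral_2_eq_2)
    also have "\<dots> \<le> (2 * R / ?b + R / ?a) / ?a" using n tp by (intro frac_le) auto
    finally show ?thesis .
  qed
  have "\<bar>s * (s - t 1) * q 1\<bar> \<le> (?a\<^sup>2 / 4) * ((2 * R / ?b + R / ?a) / ?a)"
    unfolding abs_mult
  proof (rule mult_mono[OF _ q1])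
    have "s * (?a - s) \<le> ?a\<^sup>2 / 4" using zero_le_power2[of "s - ?a / 2"] by (simp add: power2_eq_square algebra_simps)
    then show "\<bar>s\<bar> * \<bar>s - t 1\<bar> \<le> ?a\<^sup>2 / 4" using s t1 by (simp add: abs_mult)
  qed auto
  also have "\<dots> = R / 2 * (?a / ?b) + R / 4" using tp by (simp add: field_simps power2_eq_square)
  also have "\<dots> \<le> R / 2 * (5 / 2) + R / 4"
    using tau_ratio[of 2] tp R by (intro add_mono mult_left_mono) (auto simp: field_simps)
  finally have e2: "\<bar>s * (s - t 1) * q 1\<bar> \<le> 3 / 2 * R" by simp
  have e1: "\<bar>s * (\<delta> 1 / ?a)\<bar> \<le> R"
  proof -
    have "\<bar>s * (\<delta> 1 / ?a)\<bar> = (s / ?a) * \<bar>\<delta> 1\<bar>" using s tp by (simp add: abs_mult)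
    also have "\<dots> \<le> 1 * R" using s t1 tp del by (intro mult_mono) auto
    finally show ?thesis by simp
  qed
  have "ierr 1 s = s * (\<delta> 1 / ?a) + s * (s - t 1) * q 1 - (\<phi> s - \<phi> 0)"
    by (simp add: ierr_def t0)
  then have "\<bar>ierr 1 s\<bar> \<le> R + 3 / 2 * R + R" using e1 e2 gr[of s] s t12 by linarith
  then show ?thesis using R by (simp add: R_def)
qed

text \<open>The three nodes span tau_j + tau_(j+1) = tau_j (1 + rho_(j+1)), the origin of the factor
  with \<open>rho\<close> in the estimate. The bound on the third derivative is taken at the left
  end, where it is largest.\<close>

lemma ierr_bound:
  assumes j: "1 \<le> j" "t (j + 1) \<le> T" and s: "t (j - 1) \<le> s" "s \<le> t j"
  shows "\<bar>ierr j s\<bar> \<le> G j"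
proof (cases "j = 1")
  case True
  then show ?thesis using ierr_bound_first[of s] j s t0 by (simp add: Gf_def numeral_2_eq_2)
next
  case False
  let ?a = "t (j - 1)" and ?M = "K3 * (1 + t (j - 1) powr (\<alpha> - 3))"
  have a: "0 < ?a" using t_less[of 0 "j - 1"] False j t0 by simp
  have tp: "tau t j > 0" "tau t (j + 1) > 0" using tau_pos j by auto
  have ab: "?a < t j" "t j < t (j + 1)" using t_less j by auto
  have "\<bar>ierr j s\<bar> \<le> ?M * (t (j + 1) - ?a) * (t j - ?a)\<^sup>2"
  proof (rule three_point_error[OF ab ierr_cont ierr_zero[OF j(1)] ierr_deriv _ _ _ s])
    fix x assume x: "?a < x" "x < t (j + 1)"
    then have xT: "0 < x" "x < T" using a j by auto
    show "0 < x" "x < T" using xT by auto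
    show "((\<lambda>s. \<delta> j / tau t j + (2 * s - t (j - 1) - t j) * q j - \<phi>1 s) has_real_derivative (2 * q j - \<phi>2 x)) (at x)"
      by (auto intro!: derivative_eq_intros der2[OF xT])
    show "((\<lambda>s. 2 * q j - \<phi>2 s) has_real_derivative (- \<phi>3 x)) (at x)"
      by (auto intro!: derivative_eq_intros der3[OF xT])
    show "\<bar>- \<phi>3 x\<bar> \<le> ?M" using d3_bound[OF a, of x] x xT by simp
  qed (use a j in auto)
  also have "\<dots> = ?M * (tau t j + tau t (j + 1)) * (tau t j)\<^sup>2" by (simp add: tau_def)
  also have "tau t j + tau t (j + 1) = tau t j * (1 + rho t (j + 1))" using tp by (simp add: rho_def field_simps)
  finally show ?thesis using False by (simp add: Gf_def power2_eq_square power3_eq_cube mult_ac)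
qed

lemma piece_bound:
  assumes j: "1 \<le> j" "j < k" and kT: "t k \<le> T"
  shows "\<exists>J. ((\<lambda>s. w k s * \<phi>1 s) has_integral J) {t (j - 1)..t j} \<and>
    \<bar>(- coef_a \<alpha> t j k * \<delta> j + coef_c \<alpha> t j k * \<delta> (j + 1)) - J\<bar> \<le> G j * (w k (t j) - w k (t (j - 1)))"
proof -
  let ?a = "t (j - 1)" and ?b = "t j"
  let ?p = "\<delta> j / tau t j"
  have jT: "t (j + 1) \<le> T" using t_le[of "j + 1" k] j kT by simp
  have bT: "?b < T" using t_less[of j "j + 1"] jT by simp
  have ab: "?a < ?b" "?b < tstar \<alpha> t k" using t_less[of "j - 1" j] less_tstar[OF j(2)] j by auto
  obtain J where J: "((\<lambda>s. w k s * (?p + (2 * s - ?a - ?b) * q j - \<phi>1 s)) has_integral J) {?a..?b}"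
    "\<bar>J\<bar> \<le> G j * (w k ?b - w k ?a)"
    using by_parts_piece[OF ab ierr_cont ierr_zero(1,2)[OF j(1)] ierr_deriv ierr_bound[OF j(1) jT]]
      t_nonneg[of "j - 1"] bT by (smt (verit))
  define V where "V = tau t j * (?p * W k j + tau t j * q j * B k j)"
  have "((\<lambda>s. w k s * (?p + (2 * s - ?a - ?b) * q j)) has_integral V) {?a..?b}"
    unfolding V_def by (rule quadratic_piece[OF j])
  from has_integral_diff[OF this J(1)]
  have "((\<lambda>s. w k s * \<phi>1 s) has_integral (V - J)) {?a..?b}" by (simp add: algebra_simps)
  moreover have "V = - coef_a \<alpha> t j k * \<delta> j + coef_c \<alpha> t j k * \<delta> (j + 1)"
    unfolding V_def q_def by (rule interpolation_piece_value[OF j])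
  ultimately show ?thesis using J(2) by (intro exI[of _ "V - J"]) auto
qed

text \<open>Splitting \<open>(0, t\<^sup>*)\<close> at its midpoint bounds the product of the two singular factors by a sum.\<close>

definition dom :: "nat \<Rightarrow> real \<Rightarrow> real" where
  "dom k s = K1 * (w k s + (tstar \<alpha> t k / 2) powr (- \<alpha>) * s powr (\<alpha> - 1) + (tstar \<alpha> t k / 2) powr (\<alpha> - 1) * w k s)"

lemma dom_bound:
  assumes k: "k \<ge> 1" "t k \<le> T" and s: "0 < s" "s < tstar \<alpha> t k"
  shows "\<bar>w k s * \<phi>1 s\<bar> \<le> dom k s"
proof -
  let ?c = "tstar \<alpha> t k"
  have w0: "0 < w k s" using s by (simp add: w_pos)
  have "\<bar>w k s * \<phi>1 s\<bar> \<le> w k s * (K1 * (1 + s powr (\<alpha> - 1)))"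
    unfolding abs_mult using b1[of s] s tstar_bounds[OF k(1)] k w0 by (auto intro!: mult_mono)
  also have "\<dots> = K1 * (w k s + w k s * s powr (\<alpha> - 1))" by (simp add: algebra_simps)
  also have "\<dots> \<le> dom k s"
  proof -
    have "w k s * s powr (\<alpha> - 1) \<le> (?c / 2) powr (- \<alpha>) * s powr (\<alpha> - 1) + (?c / 2) powr (\<alpha> - 1) * w k s"
    proof (cases "s \<le> ?c / 2")
      case True
      have "w k s \<le> (?c / 2) powr (- \<alpha>)" unfolding w_def using True s \<alpha> by (intro powr_mono2') auto
      then have "w k s * s powr (\<alpha> - 1) \<le> (?c / 2) powr (- \<alpha>) * s powr (\<alpha> - 1)" by (intro mult_right_mono) auto
      then show ?thesis using w0 by (smt (verit) mult_nonneg_nonneg powr_ge_zero)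
    next
      case False
      have "s powr (\<alpha> - 1) \<le> (?c / 2) powr (\<alpha> - 1)" using False s \<alpha> by (intro powr_mono2') auto
      then have "w k s * s powr (\<alpha> - 1) \<le> (?c / 2) powr (\<alpha> - 1) * w k s" using w0 by (simp add: mult.commute)
      then show ?thesis by (smt (verit) mult_nonneg_nonneg powr_ge_zero)
    qed
    then show ?thesis unfolding dom_def using K by (intro mult_left_mono) auto
  qed
  finally show ?thesis .
qed

definition domint :: "nat \<Rightarrow> real" where
  "domint k = K1 * (tstar \<alpha> t k powr (1 - \<alpha>) / (1 - \<alpha>) + (tstar \<alpha> t k / 2) powr (- \<alpha>) * (tstar \<alpha> t k powr \<alpha> / \<alpha>) +
    (tstar \<alpha> t k / 2) powr (\<alpha> - 1) * (tstar \<alpha> t k powr (1 - \<alpha>) / (1 - \<alpha>)))"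

lemma dom_integral:
  assumes k: "k \<ge> 1"
  shows "(dom k has_integral domint k) {0..tstar \<alpha> t k}"
proof -
  have c: "0 \<le> tstar \<alpha> t k" using tstar_pos[OF k] by simp
  have w: "(w k has_integral (tstar \<alpha> t k powr (1 - \<alpha>) / (1 - \<alpha>))) {0..tstar \<alpha> t k}"
    using w_integral[of 0 k] c by simp
  show ?thesis
    unfolding dom_def[abs_def] domint_def
    using c \<alpha> by (intro has_integral_mult_right has_integral_add w powr_integral) auto
qed

text \<open>The equation uses the Lebesgue integral, the pieces use the gauge integral; domination
  by the integrable \<open>dom\<close> makes the product absolutely integrable, and then the two
  agree.\<close>

lemma caputo_integral:
  assumes k: "k \<ge> 1" "t k \<le> T"
  shows caputo_integrable: "(\<lambda>s. w k s * \<phi>1 s) integrable_on {0..tstar \<alpha> t k}"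
    and caputo_eq: "(LBINT r=0..tstar \<alpha> t k. (tstar \<alpha> t k - r) powr (- \<alpha>) * \<phi>1 r) = integral {0..tstar \<alpha> t k} (\<lambda>s. w k s * \<phi>1 s)"
proof -
  let ?c = "tstar \<alpha> t k" and ?f = "\<lambda>s. w k s * \<phi>1 s" and ?S = "{0<..<tstar \<alpha> t k}"
  have c: "0 < ?c" "?c < T" using tstar_pos tstar_bounds k by force+
  have fc: "continuous_on ?S ?f"
    by (intro continuous_intros w_continuous continuous_on_subset[OF cont_pos(2)]) (use c in auto)
  have "?f absolutely_integrable_on ?S"
  proof (rule measurable_bounded_by_integrable_imp_absolutely_integrable)
    show "?f \<in> borel_measurable (lebesgue_on ?S)" using fc by (intro continuous_imp_measurable_on_sets_lebesgue) auto
    show "dom k integrable_on ?S" using dom_integral[OF k(1)] by (auto simp: has_integral_Icc_iff_Ioo integrable_on_def)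
    show "norm (?f x) \<le> dom k x" if "x \<in> ?S" for x using dom_bound[OF k] that by auto
  qed auto
  then have "integrable lebesgue (\<lambda>x. indicator ?S x *\<^sub>R ?f x)" by (simp add: set_integrable_def)
  moreover have "(\<lambda>x. indicator ?S x *\<^sub>R ?f x) \<in> borel_measurable lborel"
    using borel_measurable_continuous_on_indicator[OF _ fc] by simp
  ultimately have "set_integrable lborel ?S ?f" by (simp add: set_integrable_def integrable_completion)
  note si = set_borel_integral_eq_integral[OF this]
  show "?f integrable_on {0..?c}" using si(1) by (simp add: integrable_on_Icc_iff_Ioo)
  have "integral ?S ?f = integral {0..?c} ?f"
    using si(1) by (metis has_integral_Icc_iff_Ioo integrable_integral integral_unique)
  moreover have "(LBINT r=0..?c. ?f r) = (LINT x:?S|lborel. ?f x)"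
    using c by (simp add: interval_lebesgue_integral_def einterval_def zero_ereal_def greaterThanLessThan_def greaterThan_def lessThan_def Int_def)
  ultimately show "(LBINT r=0..?c. (?c - r) powr (- \<alpha>) * \<phi>1 r) = integral {0..?c} ?f"
    using si(2) by (simp add: w_def)
qed

lemma last_piece:
  assumes k: "2 \<le> k" "t k \<le> T"
  shows "\<bar>P k * \<delta> k - integral {t (k - 1)..tstar \<alpha> t k} (\<lambda>s. w k s * \<phi>1 s)\<bar> \<le> H k * wt k k"
proof -
  let ?a = "t (k - 1)" and ?c = "tstar \<alpha> t k" and ?b = "t k" and ?\<tau> = "tau t k"
  define I where "I = integral {?a..?c} (\<lambda>s. w k s * \<phi>1 s)"
  define m where "m = ?a + ?\<tau> / 2"
  define M where "M = K3 * (1 + ?a powr (\<alpha> - 3))"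
  have k1: "1 \<le> k" using k by simp
  have a: "0 < ?a" using t_less[of 0 "k - 1"] k t0 by simp
  have tp: "?\<tau> > 0" using tau_pos[OF k1] .
  have b: "?b = ?a + ?\<tau>" using t_Suc[OF k1] .
  have c: "?a < ?c" "?c < ?b" using tstar_bounds[OF k1] by auto
  have m: "?a < m" "m < ?b" using tp b by (auto simp: m_def)
  have M0: "0 \<le> M" using K by (simp add: M_def)
  have in_T: "0 < x" "x < T" if "?a < x" "x < ?b" for x using that a k by auto
  \<comment> \<open>Removing the linear part at the midpoint m is free, since
    \<open>linear_moment\<close> makes the kernel orthogonal to s - m. The rest differs from \<phi>1
    m only at second order in the step size.\<close>
  define h where "h s = \<phi>1 s - \<phi>2 m * (s - m)" for s
  have h: "\<bar>h s - \<phi>1 m\<bar> \<le> M * ?\<tau>\<^sup>2 / 4" if s: "?a < s" "s < ?b" for s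
  proof -
    have d2m: "\<bar>\<phi>2 x - \<phi>2 m\<bar> \<le> M * (?\<tau> / 2)" if x: "?a < x" "x < ?b" for x
    proof -
      have "\<bar>\<phi>2 x - \<phi>2 m\<bar> \<le> M * \<bar>x - m\<bar>"
      proof (rule derivative_bound_open[of ?a ?b \<phi>2 \<phi>3, OF _ _ x m])
        show "(\<phi>2 has_real_derivative \<phi>3 y) (at y)" "\<bar>\<phi>3 y\<bar> \<le> M" if "?a < y" "y < ?b" for y
          using der3[of y] d3_bound[OF a, of y] in_T[OF that] that by (auto simp: M_def)
      qed
      also have "\<dots> \<le> M * (?\<tau> / 2)" using x b M0 unfolding m_def by (intro mult_left_mono) linarith+
      finally show ?thesis .
    qed
    have "\<bar>h s - h m\<bar> \<le> M * (?\<tau> / 2) * \<bar>s - m\<bar>"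
    proof (rule derivative_bound_open[of ?a ?b h "\<lambda>x. \<phi>2 x - \<phi>2 m", OF _ d2m s m])
      show "(h has_real_derivative \<phi>2 x - \<phi>2 m) (at x)" if "?a < x" "x < ?b" for x
        unfolding h_def[abs_def] by (auto intro!: derivative_eq_intros der2 in_T that)
    qed
    also have "\<dots> \<le> M * (?\<tau> / 2) * (?\<tau> / 2)" using s b M0 tp unfolding m_def by (intro mult_left_mono) (linarith | simp)+
    finally show ?thesis by (simp add: h_def power2_eq_square)
  qed
  have dl: "\<bar>\<delta> k / ?\<tau> - \<phi>1 m\<bar> \<le> M * ?\<tau>\<^sup>2 / 4"
  proof -
    \<comment> \<open>The square (s - m)^2 agrees at both ends, so the correction leaves the
      increment \<delta> k unchanged, and the mean slope is a value of the corrected derivative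
      \<open>h\<close>.\<close>
    let ?K = "\<lambda>s. \<phi> s - \<phi>2 m * (s - m)\<^sup>2 / 2"
    obtain z where z: "?a < z" "z < ?b" "?K ?b - ?K ?a = (?b - ?a) * h z"
    proof (rule mvt_open[of ?a ?b ?K h])
      show "continuous_on {?a..?b} ?K" using a k by (intro continuous_intros cont_sub) auto
      show "(?K has_real_derivative h x) (at x)" if "?a < x" "x < ?b" for x
        unfolding h_def by (auto intro!: derivative_eq_intros der1 in_T that)
    qed (use b tp in auto)
    have "?K ?b - ?K ?a = \<delta> k" by (simp add: b m_def \<delta>_def power2_eq_square)
    then have "\<delta> k / ?\<tau> = h z" using z(3) b tp by (simp add: field_simps)
    then show ?thesis using h[OF z(1,2)] by simp
  qed
  have int: "((\<lambda>s. w k s * \<phi>1 s) has_integral I) {?a..?c}"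
    unfolding I_def using a c
    by (intro integrable_integral integrable_on_subinterval[OF caputo_integrable[OF k1 k(2)]]) auto
  define p where "p = \<delta> k / ?\<tau>"
  have p: "?\<tau> * P k * p = P k * \<delta> k" using tp by (simp add: p_def)
  have "((\<lambda>s. w k s * \<phi>1 s - (w k s * p + w k s * (s - m) * \<phi>2 m)) has_integral (I - (?\<tau> * P k * p + 0 * \<phi>2 m))) {?a..?c}"
    by (intro has_integral_diff int has_integral_add has_integral_mult_left w_integral_last[OF k1] linear_moment[OF k1, folded m_def])
  moreover have "(\<lambda>s. w k s * \<phi>1 s - (w k s * p + w k s * (s - m) * \<phi>2 m)) = (\<lambda>s. w k s * (h s - p))"
    unfolding h_def fun_eq_iff by (intro allI) algebra
  ultimately have r: "((\<lambda>s. w k s * (h s - \<delta> k / ?\<tau>)) has_integral (I - P k * \<delta> k)) {?a<..<?c}"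
    unfolding has_integral_Icc_iff_Ioo[symmetric] p by (simp add: p_def)
  have "((\<lambda>s. w k s * (M * ?\<tau>\<^sup>2 / 2)) has_integral (?\<tau> * P k * (M * ?\<tau>\<^sup>2 / 2))) {?a<..<?c}"
    unfolding has_integral_Icc_iff_Ioo[symmetric] by (intro has_integral_mult_left w_integral_last[OF k1])
  from r this have "\<bar>I - P k * \<delta> k\<bar> \<le> ?\<tau> * P k * (M * ?\<tau>\<^sup>2 / 2)"
  proof (rule has_integral_abs_le)
    fix s assume s: "s \<in> {?a<..<?c}"
    then have "\<bar>h s - \<phi>1 m\<bar> \<le> M * ?\<tau>\<^sup>2 / 4" using h[of s] c by simp
    then have "\<bar>h s - \<delta> k / ?\<tau>\<bar> \<le> M * ?\<tau>\<^sup>2 / 2" using dl by linarith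
    then show "\<bar>w k s * (h s - \<delta> k / ?\<tau>)\<bar> \<le> w k s * (M * ?\<tau>\<^sup>2 / 2)"
      using w_pos[of s k] s unfolding abs_mult by (intro mult_mono) auto
  qed
  also have "\<dots> = (M * ?\<tau> ^ 3 / 2) * P k" by (simp add: power2_eq_square power3_eq_cube)
  also have "\<dots> \<le> (M * ?\<tau> ^ 3) * wt k k"
    using P_le_wt[OF k1] P_nonneg[of k] M0 tp by (intro mult_mono) auto
  finally show ?thesis using k by (simp add: I_def M_def Hf_def abs_minus_commute)
qed

text \<open>No cancellation is exploited at the singularity: the integral costs four multiples of K1
  N (t 1) P 1, the increment one more.\<close>

lemma first_piece:
  assumes T1: "t 1 \<le> T"
  shows "\<bar>P 1 * \<delta> 1 - integral {0..tstar \<alpha> t 1} (\<lambda>s. w 1 s * \<phi>1 s)\<bar> \<le> H 1 * wt 1 1"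
proof -
  let ?c = "tstar \<alpha> t 1" and ?\<tau> = "tau t 1"
  define I where "I = integral {0..?c} (\<lambda>s. w 1 s * \<phi>1 s)"
  have tp: "?\<tau> > 0" using tau_pos by simp
  have c: "?c = \<sigma> * ?\<tau>" "?c > 0" using tstar_pos[of 1] by (auto simp: tstar_eq t0)
  have t1: "t 1 = ?\<tau>" by (simp add: tau_def t0)
  have "\<bar>I\<bar> \<le> domint 1"
  proof (rule has_integral_abs_le)
    show "((\<lambda>s. w 1 s * \<phi>1 s) has_integral I) {0<..<?c}"
      using caputo_integrable[of 1] T1 unfolding I_def has_integral_Icc_iff_Ioo[symmetric] by (simp add: integrable_integral)
    show "(dom 1 has_integral domint 1) {0<..<?c}"
      using dom_integral[of 1] by (simp add: has_integral_Icc_iff_Ioo)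
    show "\<bar>w 1 s * \<phi>1 s\<bar> \<le> dom 1 s" if "s \<in> {0<..<?c}" for s
      using dom_bound[of 1 s] T1 that by auto
  qed
  also have "domint 1 \<le> K1 * (?\<tau> * P 1 + 4 * (?\<tau> powr \<alpha> / \<alpha>) * P 1)"
  proof -
    have 1: "?c powr (1 - \<alpha>) / (1 - \<alpha>) = ?\<tau> * P 1"
      unfolding c(1) P_def using tp \<sigma> by (simp add: powr_mult powr_diff mult_ac)
    have "(?c / 2) powr (- \<alpha>) * ?c powr \<alpha> = 2 powr \<alpha>"
      using c(2) by (simp add: powr_divide powr_minus divide_simps)
    then have 2: "(?c / 2) powr (- \<alpha>) * (?c powr \<alpha> / \<alpha>) = 2 powr \<alpha> / \<alpha>" by simp
    have "(?c / 2) powr (\<alpha> - 1) * ?c powr (1 - \<alpha>) = 2 powr (1 - \<alpha>)"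
    proof -
      have "(?c / 2) powr (\<alpha> - 1) = ?c powr (\<alpha> - 1) * 2 powr (1 - \<alpha>)"
        using c(2) powr_minus_divide[of 2 "1 - \<alpha>"] by (simp add: powr_divide powr_minus divide_simps mult.commute)
      moreover have "?c powr (\<alpha> - 1) * ?c powr (1 - \<alpha>) = 1" using c(2) by (simp flip: powr_add)
      ultimately show ?thesis by (simp add: mult_ac)
    qed
    then have 3: "(?c / 2) powr (\<alpha> - 1) * (?c powr (1 - \<alpha>) / (1 - \<alpha>)) = 2 powr (1 - \<alpha>) / (1 - \<alpha>)" by simp
    have "2 powr \<alpha> \<le> 2 powr 1" "2 powr (1 - \<alpha>) \<le> (2::real) powr 1" using \<alpha> by (intro powr_mono; simp)+
    then have "2 powr \<alpha> / \<alpha> + 2 powr (1 - \<alpha>) / (1 - \<alpha>) \<le> 2 / \<alpha> + 2 / (1 - \<alpha>)"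
      using \<alpha> by (intro add_mono divide_right_mono) auto
    \<comment> \<open>The contributions of both halves of the interval merge; the factor 1 / (1 -
      \<alpha>) goes into \<open>P 1\<close>, and only 1 / \<alpha> stays in
      \<open>N\<close>.\<close>
    also have "\<dots> = 2 / (\<alpha> * (1 - \<alpha>))" using \<alpha> by (simp add: field_simps)
    also have "\<dots> \<le> 4 * \<sigma> powr (1 - \<alpha>) / (\<alpha> * (1 - \<alpha>))"
      using \<sigma>_powr(2) \<alpha> by (intro divide_right_mono) auto
    also have "\<dots> = 4 * (?\<tau> powr \<alpha> / \<alpha>) * P 1" using tp \<alpha> by (simp add: P_def)
    finally have "?\<tau> * P 1 + 2 powr \<alpha> / \<alpha> + 2 powr (1 - \<alpha>) / (1 - \<alpha>) \<le> ?\<tau> * P 1 + 4 * (?\<tau> powr \<alpha> / \<alpha>) * P 1" by simp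
    then show ?thesis unfolding domint_def 1 2 3[unfolded 1] using K by (intro mult_left_mono)
  qed
  also have "\<dots> \<le> 4 * K1 * N (t 1) * P 1"
  proof -
    have "0 \<le> K1 * ?\<tau> * P 1" using K tp P_nonneg by simp
    then show ?thesis unfolding N_def t1 by (simp add: algebra_simps)
  qed
  finally have I: "\<bar>I\<bar> \<le> 4 * K1 * N (t 1) * P 1" .
  have "\<bar>P 1 * \<delta> 1\<bar> \<le> P 1 * (K1 * N (t 1))"
    unfolding abs_mult using growth[of "t 1"] t_nonneg[of 1] T1 P_nonneg[of 1] t0
    by (intro mult_mono) (auto simp: \<delta>_def)
  with I have "\<bar>P 1 * \<delta> 1 - I\<bar> \<le> (5 * K1 * N (t 1)) * P 1" by (simp add: algebra_simps)
  also have "\<dots> \<le> (5 * K1 * N (t 1)) * wt 1 1"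
    using P_le_wt[of 1] K N_nonneg[OF t_nonneg] by (intro mult_left_mono) auto
  finally show ?thesis by (simp add: I_def Hf_def)
qed

lemma Gf_nonneg: "1 \<le> j \<Longrightarrow> 0 \<le> G j"
  using K N_nonneg[OF t_nonneg] tau_pos[of j] tau_pos[of "j + 1"] by (simp add: Gf_def rho_def)

text \<open>Interpolation errors on full intervals appear with kernel increments, and exchanging
  these for weight increments costs the factor 10; the last partial interval is estimated separately
  and charged to the largest weight.\<close>

theorem truncation_error:
  assumes k: "1 \<le> k" "t k \<le> T"
  shows "\<bar>(\<Sum>j=1..k. wt k j * (\<phi> (t j) - \<phi> (t (j - 1)))) - (LBINT r=0..tstar \<alpha> t k. (tstar \<alpha> t k - r) powr (- \<alpha>) * \<phi>1 r)\<bar>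
    \<le> (\<Sum>j=1..k-1. 10 * G j * (wt k (j + 1) - wt k j)) + H k * wt k k"
proof -
  let ?f = "\<lambda>s. w k s * \<phi>1 s" and ?c = "tstar \<alpha> t k"
  note fi = caputo_integrable[OF k]
  define J where "J j = integral {t (j - 1)..t j} ?f" for j
  have J: "\<bar>(- coef_a \<alpha> t j k * \<delta> j + coef_c \<alpha> t j k * \<delta> (j + 1)) - J j\<bar> \<le> G j * (w k (t j) - w k (t (j - 1)))"
    if jk: "1 \<le> j" "j < k" for j
  proof -
    obtain I where I: "(?f has_integral I) {t (j - 1)..t j}"
      "\<bar>(- coef_a \<alpha> t j k * \<delta> j + coef_c \<alpha> t j k * \<delta> (j + 1)) - I\<bar> \<le> G j * (w k (t j) - w k (t (j - 1)))"
      using piece_bound[OF jk k(2)] by blast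
    show ?thesis unfolding J_def integral_unique[OF I(1)] by (rule I(2))
  qed
  have sum: "m < k \<Longrightarrow> integral {0..t m} ?f = (\<Sum>j=1..m. J j)" for m
  proof (induction m)
    case (Suc m)
    have "?f integrable_on {0..t (Suc m)}"
      using less_tstar[OF Suc.prems order_refl] by (intro integrable_on_subinterval[OF fi]) auto
    from Henstock_Kurzweil_Integration.integral_combine[OF t_nonneg t_le[of m "Suc m"] this]
    have "integral {0..t m} ?f + integral {t m..t (Suc m)} ?f = integral {0..t (Suc m)} ?f" by simp
    then show ?case using Suc by (simp add: J_def)
  qed (simp add: t0)
  have split: "integral {0..?c} ?f = (\<Sum>j=1..k-1. J j) + integral {t (k - 1)..?c} ?f"
    using Henstock_Kurzweil_Integration.integral_combine[OF _ _ fi, of "t (k - 1)"] t_nonneg[of "k - 1"] tstar_bounds[OF k(1)]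
      sum[of "k - 1"] k by simp
  have last: "\<bar>P k * \<delta> k - integral {t (k - 1)..?c} ?f\<bar> \<le> H k * wt k k"
    using last_piece[of k] first_piece k t0 by (cases "k = 1") auto
  have eq: "(\<Sum>j=1..k. wt k j * \<delta> j) - integral {0..?c} ?f =
      (\<Sum>j=1..k-1. (- coef_a \<alpha> t j k * \<delta> j + coef_c \<alpha> t j k * \<delta> (j + 1)) - J j) + (P k * \<delta> k - integral {t (k - 1)..?c} ?f)"
    unfolding wt_sum_eq[OF k(1)] split by (simp add: sum_subtractf)
  have "\<bar>(\<Sum>j=1..k-1. (- coef_a \<alpha> t j k * \<delta> j + coef_c \<alpha> t j k * \<delta> (j + 1)) - J j) + (P k * \<delta> k - integral {t (k - 1)..?c} ?f)\<bar>
      \<le> (\<Sum>j=1..k-1. 10 * G j * (wt k (j + 1) - wt k j)) + H k * wt k k"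
  proof (rule order_trans[OF abs_triangle_ineq add_mono[OF order_trans[OF sum_abs sum_mono] last]])
    fix j assume "j \<in> {1..k-1}"
    then have j: "1 \<le> j" "j < k" by auto
    have "G j * (w k (t j) - w k (t (j - 1))) \<le> G j * (10 * (wt k (j + 1) - wt k j))"
      using ker_step_le[OF j] Gf_nonneg[OF j(1)] by (intro mult_left_mono)
    then show "\<bar>(- coef_a \<alpha> t j k * \<delta> j + coef_c \<alpha> t j k * \<delta> (j + 1)) - J j\<bar> \<le> 10 * G j * (wt k (j + 1) - wt k j)"
      using order_trans[OF J[OF j]] by (simp only: mult_ac)
  qed
  then show ?thesis unfolding caputo_eq[OF k] \<delta>_def[symmetric] eq .
qed

lemma midpoint_error_first:
  assumes T1: "t 1 \<le> T"
  shows "\<bar>\<sigma> * \<phi> (t 1) + (1 - \<sigma>) * \<phi> 0 - \<phi> (tstar \<alpha> t 1)\<bar> \<le> 2 * K1 * N (t 1)"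
proof -
  have c: "0 < tstar \<alpha> t 1" "tstar \<alpha> t 1 < t 1" using tstar_pos[of 1] tstar_bounds[of 1] by auto
  have 1: "\<bar>\<phi> (t 1) - \<phi> 0\<bar> \<le> K1 * N (t 1)" using growth T1 t_nonneg by simp
  have "\<bar>\<phi> (tstar \<alpha> t 1) - \<phi> 0\<bar> \<le> K1 * N (tstar \<alpha> t 1)" using growth[of "tstar \<alpha> t 1"] T1 c by simp
  also have "\<dots> \<le> K1 * N (t 1)" using c K by (intro mult_left_mono N_mono) auto
  finally have 2: "\<bar>\<phi> (tstar \<alpha> t 1) - \<phi> 0\<bar> \<le> K1 * N (t 1)" .
  have "\<bar>\<sigma> * (\<phi> (t 1) - \<phi> 0)\<bar> \<le> 1 * (K1 * N (t 1))"
    unfolding abs_mult using 1 \<sigma> by (intro mult_mono) auto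
  then show ?thesis using 2 by (simp add: algebra_simps abs_le_iff)
qed

text \<open>The collocation point is the convex combination of the two mesh points with weights
  \<sigma> and 1 - \<sigma>, so the quantity is an error of linear interpolation.\<close>

lemma midpoint_error:
  assumes k: "2 \<le> k" "t k \<le> T"
  shows "\<bar>\<sigma> * \<phi> (t k) + (1 - \<sigma>) * \<phi> (t (k - 1)) - \<phi> (tstar \<alpha> t k)\<bar> \<le> K2 * (1 + t (k - 1) powr (\<alpha> - 2)) * (tau t k)\<^sup>2"
proof -
  let ?a = "t (k - 1)" and ?b = "t k"
  let ?f = "\<lambda>s. \<phi> ?a + (s - ?a) * (\<delta> k / tau t k) - \<phi> s"
  have a: "0 < ?a" using t_less[of 0 "k - 1"] k t0 by simp
  have tp: "tau t k > 0" using tau_pos k by simp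
  have ba: "?b - ?a = tau t k" by (simp add: tau_def)
  have c: "?a < tstar \<alpha> t k" "tstar \<alpha> t k < ?b" using tstar_bounds[of k] k by auto
  have "\<bar>?f (tstar \<alpha> t k)\<bar> \<le> K2 * (1 + ?a powr (\<alpha> - 2)) * (?b - ?a)\<^sup>2"
  proof (rule two_point_error[where f="?f" and s="tstar \<alpha> t k" and ?f1.0="\<lambda>x. \<delta> k / tau t k - \<phi>1 x" and ?f2.0="\<lambda>x. - \<phi>2 x"])
    show "continuous_on {?a..?b} ?f" using a k by (intro continuous_intros cont_sub) auto
    show "?f ?b = 0" unfolding ba using tp by (simp add: \<delta>_def)
    fix x assume x: "?a < x" "x < ?b"
    then have xT: "0 < x" "x < T" using a k by auto
    have "((\<lambda>s. c + (s - a) * p - \<phi> s) has_real_derivative (p - \<phi>1 x)) (at x)" for a c p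
      by (auto intro!: derivative_eq_intros der1 xT)
    then show "(?f has_real_derivative (\<delta> k / tau t k - \<phi>1 x)) (at x)" .
    show "((\<lambda>x. \<delta> k / tau t k - \<phi>1 x) has_real_derivative (- \<phi>2 x)) (at x)" by (auto intro!: derivative_eq_intros der2 xT)
    show "\<bar>- \<phi>2 x\<bar> \<le> K2 * (1 + ?a powr (\<alpha> - 2))" using d2_bound[OF a, of x] x xT by simp
  qed (use c in auto)
  moreover have "?f (tstar \<alpha> t k) = \<sigma> * \<phi> ?b + (1 - \<sigma>) * \<phi> ?a - \<phi> (tstar \<alpha> t k)"
  proof -
    have e: "(tstar \<alpha> t k - ?a) * (\<delta> k / tau t k) = \<sigma> * \<delta> k" using tp by (simp add: tstar_eq)
    show ?thesis unfolding e by (simp add: \<delta>_def algebra_simps)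
  qed
  ultimately show ?thesis by (simp only: ba)
qed

end

context l21_mesh
begin

text \<open>The largest weight is of order tau_k^(- \<alpha>) / (1 - \<alpha>), the smallest at
  least \<open>tstar \<alpha> t k powr (- \<alpha>)\<close>. The ratio tstar / tau is shifted from k
  to k - 1 at the cost of a factor 7, and 35 = 5 * 7.\<close>

lemma wt_ratio:
  assumes k: "k \<ge> 2"
  shows "wt k k \<le> 35 / (1 - \<alpha>) * (tstar \<alpha> t (k - 1) powr \<alpha> * tau t (k - 1) powr (- \<alpha>)) * wt k 1"
proof -
  let ?a = "tau t (k - 1)" and ?b = "tau t k" and ?c = "tstar \<alpha> t k" and ?d = "tstar \<alpha> t (k - 1)"
  have ab: "?a > 0" "?b > 0" using tau_pos k by auto
  have cd: "?c > 0" "?d > 0" using tstar_pos k by auto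
  have a1: "t (k - 1) = t (k - 1 - 1) + ?a" using t_Suc[of "k - 1"] k by simp
  have "t (k - 1) \<le> 2 * ?d"
  proof -
    have "?a \<le> 2 * (\<sigma> * ?a)" using \<sigma>(1) ab by simp
    moreover have "?d = t (k - 1 - 1) + \<sigma> * ?a" by (rule tstar_eq)
    ultimately show ?thesis using a1 t_nonneg[of "k - 1 - 1"] by linarith
  qed
  moreover have "?a \<le> t (k - 1)" using a1 t_nonneg[of "k - 1 - 1"] by simp
  moreover have "?c \<le> t (k - 1) + ?b" using \<sigma> ab by (simp add: tstar_eq mult_left_le_one_le)
  \<comment> \<open>Together: c a \<le> (t (k - 1) + b) a \<le> (5/2 + 1) t (k - 1) b \<le> 7 d
    b.\<close>
  ultimately have "?c * ?a \<le> (t (k - 1) + ?b) * ?a" "t (k - 1) * ?a \<le> t (k - 1) * (5 / 2 * ?b)"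
      "?b * ?a \<le> ?b * t (k - 1)" "7 / 2 * ?b * t (k - 1) \<le> 7 / 2 * ?b * (2 * ?d)"
    using tau_ratio[OF k] ab t_nonneg[of "k - 1"] by (auto intro!: mult_left_mono mult_right_mono)
  then have "?c * ?a \<le> 7 * ?d * ?b" by (simp add: algebra_simps)
  then have "?c / ?b \<le> 7 * (?d / ?a)" using ab by (simp add: field_simps)
  then have "(?c / ?b) powr \<alpha> \<le> (7 * (?d / ?a)) powr \<alpha>" using ab cd \<alpha> by (intro powr_mono2) auto
  also have "\<dots> = 7 powr \<alpha> * (?d / ?a) powr \<alpha>" using ab cd by (subst powr_mult) auto
  also have "\<dots> \<le> 7 powr 1 * (?d / ?a) powr \<alpha>" using \<alpha> by (intro mult_right_mono powr_mono) auto
  finally have "(?c / ?b) powr \<alpha> * ?c powr (- \<alpha>) \<le> (7 * (?d / ?a) powr \<alpha>) * ?c powr (- \<alpha>)"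
    by (intro mult_right_mono) auto
  moreover have "(?c / ?b) powr \<alpha> * ?c powr (- \<alpha>) = ?b powr (- \<alpha>)"
    using ab cd by (simp add: powr_divide powr_minus divide_simps)
  moreover have "(?d / ?a) powr \<alpha> = ?d powr \<alpha> * ?a powr (- \<alpha>)"
    using ab cd by (simp add: powr_divide powr_minus divide_simps)
  moreover have "?c powr (- \<alpha>) = w k 0" by (simp add: w_def)
  ultimately have "?b powr (- \<alpha>) \<le> 7 * (?d powr \<alpha> * ?a powr (- \<alpha>)) * w k 0" by simp
  also have "\<dots> \<le> 7 * (?d powr \<alpha> * ?a powr (- \<alpha>)) * wt k 1"
    using wt_first_ge[of k] k by (intro mult_left_mono) auto
  finally have b: "?b powr (- \<alpha>) \<le> 7 * (?d powr \<alpha> * ?a powr (- \<alpha>)) * wt k 1" .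
  have "wt k k \<le> 5 / (1 - \<alpha>) * ?b powr (- \<alpha>)" using wt_last_le[of k] k by simp
  also have "\<dots> \<le> 5 / (1 - \<alpha>) * (7 * (?d powr \<alpha> * ?a powr (- \<alpha>)) * wt k 1)"
    using b \<alpha> by (intro mult_left_mono) auto
  finally show ?thesis by simp
qed

end

section \<open>The error estimate\<close>

lemma le_of_square_le: "x * x \<le> b * x \<Longrightarrow> 0 \<le> x \<Longrightarrow> 0 \<le> b \<Longrightarrow> x \<le> (b :: real)"
  by (cases "x = 0") auto

lemma maxk_ge: "finite A \<Longrightarrow> k \<in> A \<Longrightarrow> g k \<le> maxk A g"
  by (simp add: maxk_def)

lemma maxk_nonneg: "finite A \<Longrightarrow> 0 \<le> maxk A g"
  by (simp add: maxk_def)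

lemma maxk_cases:
  assumes "finite A"
  obtains "maxk A g = 0" | k where "k \<in> A" "maxk A g = g k"
proof -
  have "maxk A g \<in> insert 0 (g ` A)"
    unfolding maxk_def by (rule Max_in) (use assms in auto)
  then show ?thesis using that by auto
qed

context bounded_open
begin

lemma L2inner_sum:
  assumes "\<And>j. j \<in> {1..k::nat} \<Longrightarrow> L2 \<Omega> (a j)" "L2 \<Omega> v"
  shows "L2 \<Omega> (\<lambda>x. \<Sum>j=1..k. c j * a j x) \<and>
    L2inner \<Omega> (\<lambda>x. \<Sum>j=1..k. c j * a j x) v = (\<Sum>j=1..k. c j * L2inner \<Omega> (a j) v)"
  using assms(1)
proof (induction k)
  case 0
  then show ?case by (simp add: L2inner_eq)
next
  case (Suc k)
  then have L: "L2 \<Omega> (\<lambda>x. \<Sum>j=1..k. c j * a j x)" "L2 \<Omega> (a (Suc k))" by auto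
  show ?case
    using Suc L2_lin[OF L, of 1 "c (Suc k)"] L2inner_lin[OF L assms(2), of 1 "c (Suc k)"] by simp
qed

text \<open>Pairing the combination with itself and applying Cauchy-Schwarz bounds the square of its
  norm by E times the norm, and one factor cancels.\<close>

lemma L2norm_convex:
  assumes a: "L2 \<Omega> a" and b: "L2 \<Omega> b" and s: "0 \<le> s" "s \<le> 1"
    and E: "L2norm \<Omega> a \<le> E" "L2norm \<Omega> b \<le> E"
  shows "L2norm \<Omega> (\<lambda>x. s * a x + (1 - s) * b x) \<le> E"
proof (rule power2_le_imp_le)
  let ?v = "\<lambda>x. s * a x + (1 - s) * b x"
  have v: "L2 \<Omega> ?v" using a b by (rule L2_lin)
  have E0: "0 \<le> E" using E(1) L2norm_nonneg[of a] by linarith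
  then show "0 \<le> E" .
  have "(L2norm \<Omega> ?v)\<^sup>2 = s * L2inner \<Omega> a ?v + (1 - s) * L2inner \<Omega> b ?v"
    using L2inner_lin[OF a b v, of s "1 - s"] by (simp add: L2norm_sq)
  also have "\<dots> \<le> s * (E * L2norm \<Omega> ?v) + (1 - s) * (E * L2norm \<Omega> ?v)"
  proof (intro add_mono mult_left_mono)
    show "L2inner \<Omega> a ?v \<le> E * L2norm \<Omega> ?v"
      using L2inner_CS[OF a v] mult_right_mono[OF E(1) L2norm_nonneg[of ?v]] by linarith
    show "L2inner \<Omega> b ?v \<le> E * L2norm \<Omega> ?v"
      using L2inner_CS[OF b v] mult_right_mono[OF E(2) L2norm_nonneg[of ?v]] by linarith
  qed (use s in auto)
  also have "\<dots> = E * L2norm \<Omega> ?v" by (simp add: algebra_simps)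
  finally have "L2norm \<Omega> ?v * L2norm \<Omega> ?v \<le> E * L2norm \<Omega> ?v" by (simp add: power2_eq_square)
  then have "L2norm \<Omega> ?v \<le> E" using L2norm_nonneg E0 by (rule le_of_square_le)
  then show "(L2norm \<Omega> ?v)\<^sup>2 \<le> E\<^sup>2" using L2norm_nonneg[of ?v] by (intro power_mono)
qed

lemma functional_deriv:
  fixes \<Lambda> :: "('d \<Rightarrow> real) \<Rightarrow> real"
  assumes lin: "\<And>a b v w. H1 \<Omega> v \<Longrightarrow> H1 \<Omega> w \<Longrightarrow> \<Lambda> (\<lambda>x. a * v x + b * w x) = a * \<Lambda> v + b * \<Lambda> w"
    and bd: "\<And>w. H1 \<Omega> w \<Longrightarrow> \<bar>\<Lambda> w\<bar> \<le> H1norm \<Omega> w * c"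
    and U: "\<And>s. s \<in> {0<..T} \<Longrightarrow> H1 \<Omega> (U s)" "\<And>s. s \<in> {0<..T} \<Longrightarrow> H1 \<Omega> (D s)"
    and der: "H1_deriv_on \<Omega> T U D" and r: "r \<in> {0<..T}"
  shows "((\<lambda>s. \<Lambda> (U s)) has_real_derivative \<Lambda> (D r)) (at r within {0<..T})"
proof -
  let ?q = "\<lambda>s x. (U s x - U r x) / (s - r) - D r x"
  have "((\<lambda>s. H1norm \<Omega> (?q s)) \<longlongrightarrow> 0) (at r within {0<..T})" using der r by (simp add: H1_deriv_on_def)
  then have "((\<lambda>s. H1norm \<Omega> (?q s) * c) \<longlongrightarrow> 0 * c) (at r within {0<..T})" by (intro tendsto_intros)
  then have lim: "((\<lambda>s. H1norm \<Omega> (?q s) * c) \<longlongrightarrow> 0) (at r within {0<..T})" by simp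
  have "((\<lambda>s. (\<Lambda> (U s) - \<Lambda> (U r)) / (s - r) - \<Lambda> (D r)) \<longlongrightarrow> 0) (at r within {0<..T})"
  proof (rule Lim_null_comparison[OF _ lim])
    show "\<forall>\<^sub>F s in at r within {0<..T}. norm ((\<Lambda> (U s) - \<Lambda> (U r)) / (s - r) - \<Lambda> (D r)) \<le> H1norm \<Omega> (?q s) * c"
      unfolding eventually_at_filter
    proof (intro always_eventually allI impI)
      fix s assume s: "s \<noteq> r" "s \<in> {0<..T}"
      have d: "H1 \<Omega> (\<lambda>x. 1 * U s x + (-1) * U r x)" by (intro H1_lin U s r)
      have q: "?q s = (\<lambda>x. (1 / (s - r)) * (1 * U s x + (-1) * U r x) + (-1) * D r x)" by (simp add: fun_eq_iff)
      have qH: "H1 \<Omega> (?q s)" unfolding q by (intro H1_lin d U r)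
      have "\<Lambda> (?q s) = (\<Lambda> (U s) - \<Lambda> (U r)) / (s - r) - \<Lambda> (D r)"
        unfolding q lin[OF d U(2)[OF r]] lin[OF U(1)[OF s(2)] U(1)[OF r]] by simp
      then show "norm ((\<Lambda> (U s) - \<Lambda> (U r)) / (s - r) - \<Lambda> (D r)) \<le> H1norm \<Omega> (?q s) * c"
        using bd[OF qH] by simp
    qed
  qed
  then show ?thesis unfolding has_field_derivative_iff by (subst (asm) LIM_zero_iff)
qed

end

section \<open>The solution tested against fixed functions\<close>

locale l21_problem = bounded_open \<Omega> + l21_mesh \<alpha> t
  for \<Omega> :: "'d::euclidean_space set" and \<alpha> :: real and t :: "nat \<Rightarrow> real" +
  fixes T C1 C2 C3 :: real and f u u1 u2 u3 :: "real \<Rightarrow> 'd \<Rightarrow> real" and u0 :: "'d \<Rightarrow> real"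
    and U :: "nat \<Rightarrow> 'd \<Rightarrow> real" and n :: nat
  assumes T: "0 < T" and C: "0 \<le> C1" "0 \<le> C2" "0 \<le> C3"
    and u0: "H01 \<Omega> u0"
    and reg: "\<And>s. s \<in> {0<..T} \<Longrightarrow> H01 \<Omega> (u s)" "\<And>s. s \<in> {0<..T} \<Longrightarrow> H01 \<Omega> (u1 s)"
      "\<And>s. s \<in> {0<..T} \<Longrightarrow> H01 \<Omega> (u2 s)" "\<And>s. s \<in> {0<..T} \<Longrightarrow> H01 \<Omega> (u3 s)"
    and der: "H1_deriv_on \<Omega> T u u1" "H1_deriv_on \<Omega> T u1 u2" "H1_deriv_on \<Omega> T u2 u3"
    and bounds: "\<And>s. s \<in> {0<..T} \<Longrightarrow> H1norm \<Omega> (u1 s) \<le> C1 * (1 + s powr (\<alpha> - 1))"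
      "\<And>s. s \<in> {0<..T} \<Longrightarrow> H1norm \<Omega> (u2 s) \<le> C2 * (1 + s powr (\<alpha> - 2))"
      "\<And>s. s \<in> {0<..T} \<Longrightarrow> H1norm \<Omega> (u3 s) \<le> C3 * (1 + s powr (\<alpha> - 3))"
    and pde: "\<And>s v. s \<in> {0<..T} \<Longrightarrow> H01 \<Omega> v \<Longrightarrow>
        (1 / Gamma (1 - \<alpha>)) * (LBINT r=0..s. (s - r) powr (- \<alpha>) * L2inner \<Omega> (u1 r) v)
          + dform \<Omega> (u s) v = L2inner \<Omega> (f s) v"
    and init: "((\<lambda>s. L2norm \<Omega> (\<lambda>x. u s x - u0 x)) \<longlongrightarrow> 0) (at_right 0)"
    and U0: "U 0 = u0"
    and UH: "\<And>k. 1 \<le> k \<Longrightarrow> k \<le> n \<Longrightarrow> H01 \<Omega> (U k)"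
    and scheme: "\<And>k v. 1 \<le> k \<Longrightarrow> k \<le> n \<Longrightarrow> H01 \<Omega> v \<Longrightarrow>
        L2inner \<Omega> (Lstar \<alpha> t U k) v + (1 - \<alpha> / 2) * dform \<Omega> (U k) v
          + (\<alpha> / 2) * dform \<Omega> (U (k - 1)) v = L2inner \<Omega> (f (tstar \<alpha> t k)) v"
    and tn: "t n \<le> T"
begin

lemma regH1: "s \<in> {0<..T} \<Longrightarrow> H1 \<Omega> (u s)" "s \<in> {0<..T} \<Longrightarrow> H1 \<Omega> (u1 s)"
  "s \<in> {0<..T} \<Longrightarrow> H1 \<Omega> (u2 s)" "s \<in> {0<..T} \<Longrightarrow> H1 \<Omega> (u3 s)"
  using reg H01_H1 by blast+

lemma at_right_in: "\<forall>\<^sub>F s in at_right 0. s \<in> {0<..<T}"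
  using T eventually_at_right_real[of 0 T] by simp

text \<open>Nothing is known about the value of \<open>u\<close> at 0 itself, only its limit; the
  scalar function is therefore given the value of \<open>u0\<close> there.\<close>

lemma functional_scalar:
  fixes \<Lambda> :: "('d \<Rightarrow> real) \<Rightarrow> real"
  assumes lin: "\<And>a b v w. H1 \<Omega> v \<Longrightarrow> H1 \<Omega> w \<Longrightarrow> \<Lambda> (\<lambda>x. a * v x + b * w x) = a * \<Lambda> v + b * \<Lambda> w"
    and bd: "\<And>w. H1 \<Omega> w \<Longrightarrow> \<bar>\<Lambda> w\<bar> \<le> H1norm \<Omega> w * c" and c: "0 \<le> c"
    and lim: "((\<lambda>s. \<Lambda> (u s)) \<longlongrightarrow> \<Lambda> u0) (at_right 0)"
  shows "l21_scalar \<alpha> t (\<lambda>s. \<Lambda> (if s = 0 then u0 else u s)) (\<lambda>s. \<Lambda> (u1 s)) (\<lambda>s. \<Lambda> (u2 s)) (\<lambda>s. \<Lambda> (u3 s)) T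
    (C1 * c) (C2 * c) (C3 * c)"
proof unfold_locales
  show "0 < T" "0 \<le> C1 * c" "0 \<le> C2 * c" "0 \<le> C3 * c" using T C c by auto
  have "((\<lambda>s. \<Lambda> (if s = 0 then u0 else u s)) \<longlongrightarrow> \<Lambda> u0) (at_right 0)"
    by (rule Lim_transform_eventually[OF lim]) (auto simp: eventually_at_filter)
  then show "((\<lambda>s. \<Lambda> (if s = 0 then u0 else u s)) \<longlongrightarrow> \<Lambda> (if 0 = (0::real) then u0 else u 0)) (at_right 0)" by simp
  fix s :: real assume "0 < s" "s \<le> T"
  then have s: "s \<in> {0<..T}" by simp
  have "((\<lambda>s. \<Lambda> (u s)) has_real_derivative \<Lambda> (u1 s)) (at s within {0<..T})"
    by (intro functional_deriv[OF lin bd _ _ der(1) s] regH1)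
  then show "((\<lambda>s. \<Lambda> (if s = 0 then u0 else u s)) has_real_derivative \<Lambda> (u1 s)) (at s within {0<..T})"
    unfolding has_field_derivative_def by (rule has_derivative_transform[OF s, rotated]) auto
  show "((\<lambda>s. \<Lambda> (u1 s)) has_real_derivative \<Lambda> (u2 s)) (at s within {0<..T})"
    by (intro functional_deriv[OF lin bd _ _ der(2) s] regH1)
  show "((\<lambda>s. \<Lambda> (u2 s)) has_real_derivative \<Lambda> (u3 s)) (at s within {0<..T})"
    by (intro functional_deriv[OF lin bd _ _ der(3) s] regH1)
  have le: "\<bar>\<Lambda> w\<bar> \<le> K * c * X" if "H1 \<Omega> w" "H1norm \<Omega> w \<le> K * X" for w K X
  proof -
    have "H1norm \<Omega> w * c \<le> (K * X) * c" using that c by (intro mult_right_mono)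
    then show ?thesis using bd[OF that(1)] by (simp add: mult_ac)
  qed
  show "\<bar>\<Lambda> (u1 s)\<bar> \<le> C1 * c * (1 + s powr (\<alpha> - 1))" by (intro le regH1 bounds s)
  show "\<bar>\<Lambda> (u2 s)\<bar> \<le> C2 * c * (1 + s powr (\<alpha> - 2))" by (intro le regH1 bounds s)
  show "\<bar>\<Lambda> (u3 s)\<bar> \<le> C3 * c * (1 + s powr (\<alpha> - 3))" by (intro le regH1 bounds s)
qed

lemma L2_functional_scalar:
  assumes v: "L2 \<Omega> v"
  shows "l21_scalar \<alpha> t (\<lambda>s. L2inner \<Omega> (if s = 0 then u0 else u s) v) (\<lambda>s. L2inner \<Omega> (u1 s) v)
    (\<lambda>s. L2inner \<Omega> (u2 s) v) (\<lambda>s. L2inner \<Omega> (u3 s) v) T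
    (C1 * L2norm \<Omega> v) (C2 * L2norm \<Omega> v) (C3 * L2norm \<Omega> v)"
proof (rule functional_scalar[where \<Lambda>="\<lambda>w. L2inner \<Omega> w v"])
  show "L2inner \<Omega> (\<lambda>x. a * p x + b * w x) v = a * L2inner \<Omega> p v + b * L2inner \<Omega> w v"
    if "H1 \<Omega> p" "H1 \<Omega> w" for a b p w by (intro L2inner_lin H1_L2 that v)
  show "\<bar>L2inner \<Omega> w v\<bar> \<le> H1norm \<Omega> w * L2norm \<Omega> v" if "H1 \<Omega> w" for w
    using L2inner_CS[OF H1_L2[OF that] v] mult_right_mono[OF L2norm_le_H1norm[of w] L2norm_nonneg[of v]] by linarith
  show "0 \<le> L2norm \<Omega> v" by (rule L2norm_nonneg)
  have u0L: "L2 \<Omega> u0" using u0 H01_H1 H1_L2 by blast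
  have "((\<lambda>s. L2norm \<Omega> (\<lambda>x. u s x - u0 x) * L2norm \<Omega> v) \<longlongrightarrow> 0 * L2norm \<Omega> v) (at_right 0)"
    by (intro tendsto_intros init)
  then have lim: "((\<lambda>s. L2norm \<Omega> (\<lambda>x. u s x - u0 x) * L2norm \<Omega> v) \<longlongrightarrow> 0) (at_right 0)" by simp
  have "((\<lambda>s. L2inner \<Omega> (u s) v - L2inner \<Omega> u0 v) \<longlongrightarrow> 0) (at_right 0)"
  proof (rule Lim_null_comparison[OF _ lim])
    show "\<forall>\<^sub>F s in at_right 0. norm (L2inner \<Omega> (u s) v - L2inner \<Omega> u0 v) \<le> L2norm \<Omega> (\<lambda>x. u s x - u0 x) * L2norm \<Omega> v"
      using at_right_in
    proof eventually_elim
      case (elim s)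
      then have "L2 \<Omega> (u s)" using regH1(1)[of s] H1_L2 by simp
      then show ?case using L2inner_diff[OF _ u0L v, of "u s"] L2inner_CS[OF L2_diff[OF _ u0L] v, of "u s"] by simp
    qed
  qed
  then show "((\<lambda>s. L2inner \<Omega> (u s) v) \<longlongrightarrow> L2inner \<Omega> u0 v) (at_right 0)" by (subst (asm) LIM_zero_iff)
qed

lemma dform_bound_H1: "H1 \<Omega> z \<Longrightarrow> H1 \<Omega> v \<Longrightarrow> \<bar>dform \<Omega> z v\<bar> \<le> H1norm \<Omega> z * sqrt (dform \<Omega> v v)"
  using dform_CS[of z v] mult_right_mono[OF gradnorm_le_H1norm[of z] real_sqrt_ge_zero[OF dform_self_nonneg[of v]]] by linarith

text \<open>The integrability of the derivative bound at the origin keeps the gradients bounded there.\<close>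

lemma gradient_bounded:
  assumes s: "0 < s" "s < T"
  shows "sqrt (dform \<Omega> (u s) (u s)) \<le> C1 * N T + sqrt (dform \<Omega> (u T) (u T))"
proof -
  let ?v = "\<lambda>x. u s x - u T x"
  let ?g = "sqrt (dform \<Omega> ?v ?v)"
  have sT: "s \<in> {0<..T}" "T \<in> {0<..T}" using s by auto
  note us = regH1(1)[OF sT(1)] and uT = regH1(1)[OF sT(2)]
  have v: "H1 \<Omega> ?v" by (intro H1_diff us uT)
  have dd: "((\<lambda>r. dform \<Omega> (u r) ?v) has_real_derivative dform \<Omega> (u1 r) ?v) (at r within {0<..T})" if "r \<in> {0<..T}" for r
    by (rule functional_deriv[where \<Lambda>="\<lambda>w. dform \<Omega> w ?v", OF _ dform_bound_H1[OF _ v] _ _ der(1) that])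
      (auto intro!: dform_lin v regH1)
  \<comment> \<open>The derivative of F is nonnegative by the bound on \<open>u1\<close>. Since the
    pairing is with the difference \<open>?v\<close> itself, comparing F at s and T gives g^2 \<le>
    C1 N T g.\<close>
  define F where "F r = C1 * ?g * N r - (- 1) * dform \<Omega> (u r) ?v" for r
  obtain z where z: "s < z" "z < T" "F T - F s = (T - s) * (C1 * ?g * (1 + z powr (\<alpha> - 1)) - (- 1) * dform \<Omega> (u1 z) ?v)"
  proof (rule mvt_open[OF s(2), of F "\<lambda>z. C1 * ?g * (1 + z powr (\<alpha> - 1)) - (- 1) * dform \<Omega> (u1 z) ?v"])
    have "continuous_on {0<..T} (\<lambda>r. dform \<Omega> (u r) ?v)" by (rule DERIV_continuous_on[OF dd])
    then have "continuous_on {s..T} (\<lambda>r. dform \<Omega> (u r) ?v)" by (rule continuous_on_subset) (use s in auto)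
    then show "continuous_on {s..T} F"
      unfolding F_def N_def using s \<alpha> by (intro continuous_intros) auto
    fix x assume x: "s < x" "x < T"
    have "at x within {0<..T} = at x" using x s by (intro at_within_interior interiorI[of "{0<..<T}"]) auto
    then have d: "((\<lambda>r. dform \<Omega> (u r) ?v) has_real_derivative dform \<Omega> (u1 x) ?v) (at x)" using dd[of x] x s by simp
    have "(N has_real_derivative (1 + x powr (\<alpha> - 1))) (at x)"
      unfolding N_def[abs_def] using x s \<alpha> by (auto intro!: derivative_eq_intros)
    then show "(F has_real_derivative (C1 * ?g * (1 + x powr (\<alpha> - 1)) - (- 1) * dform \<Omega> (u1 x) ?v)) (at x)"
      unfolding F_def[abs_def] by (intro DERIV_diff DERIV_cmult d)
  qed
  have "\<bar>dform \<Omega> (u1 z) ?v\<bar> \<le> C1 * ?g * (1 + z powr (\<alpha> - 1))"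
  proof -
    have zT: "z \<in> {0<..T}" using z s by simp
    have "H1norm \<Omega> (u1 z) * ?g \<le> (C1 * (1 + z powr (\<alpha> - 1))) * ?g"
      using bounds(1)[OF zT] dform_self_nonneg[of ?v] by (intro mult_right_mono) auto
    then show ?thesis using dform_bound_H1[OF regH1(2)[OF zT] v] by (simp add: mult_ac)
  qed
  then have "0 \<le> (T - s) * (C1 * ?g * (1 + z powr (\<alpha> - 1)) - (- 1) * dform \<Omega> (u1 z) ?v)" using s by simp
  then have 1: "dform \<Omega> (u s) ?v - dform \<Omega> (u T) ?v \<le> C1 * ?g * N T - C1 * ?g * N s"
    unfolding z(3)[symmetric] F_def by linarith
  have 2: "0 \<le> C1 * ?g * N s"
    using C(1) N_nonneg[OF less_imp_le[OF s(1)]] dform_self_nonneg[of ?v] by (intro mult_nonneg_nonneg) auto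
  have "?g * ?g = dform \<Omega> ?v ?v" using dform_self_nonneg[of ?v] by simp
  also have "\<dots> = dform \<Omega> (u s) ?v - dform \<Omega> (u T) ?v"
    using dform_lin[OF us uT v, of 1 "-1"] by simp
  also have "\<dots> \<le> C1 * ?g * N T" using 1 2 by linarith
  finally have gg: "?g * ?g \<le> C1 * N T * ?g" by (simp only: mult_ac)
  have g: "?g \<le> C1 * N T"
    by (rule le_of_square_le[OF gg]) (use dform_self_nonneg[of ?v] C(1) N_nonneg[of T] T in simp_all)
  let ?a = "sqrt (dform \<Omega> (u s) (u s))" and ?b = "sqrt (dform \<Omega> (u T) (u T))"
  have "dform \<Omega> (u s) (u s) = dform \<Omega> (u s) ?v + dform \<Omega> (u s) (u T)"
    using dform_lin[OF us uT us, of 1 "-1"] dform_commute[of "u s" ?v] dform_commute[of "u s" "u T"] by simp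
  also have "\<dots> \<le> ?a * ?g + ?a * ?b" using dform_CS[OF us v] dform_CS[OF us uT] by linarith
  finally have "?a * ?a \<le> (?g + ?b) * ?a" using dform_self_nonneg[of "u s"] by (simp add: algebra_simps)
  then have "?a \<le> ?g + ?b"
    by (rule le_of_square_le) (use dform_self_nonneg[of "u s"] dform_self_nonneg[of "u T"] dform_self_nonneg[of ?v] in simp_all)
  then show ?thesis using g by linarith
qed

text \<open>The initial value is attained in L2 only, so continuity of the Dirichlet pairing at 0
  comes from weak convergence under bounded gradients, against \<open>v\<close> with zero boundary
  values.\<close>

lemma dform_functional_scalar:
  assumes v: "H01 \<Omega> v"
  shows "l21_scalar \<alpha> t (\<lambda>s. dform \<Omega> (if s = 0 then u0 else u s) v) (\<lambda>s. dform \<Omega> (u1 s) v)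
    (\<lambda>s. dform \<Omega> (u2 s) v) (\<lambda>s. dform \<Omega> (u3 s) v) T
    (C1 * sqrt (dform \<Omega> v v)) (C2 * sqrt (dform \<Omega> v v)) (C3 * sqrt (dform \<Omega> v v))"
proof (rule functional_scalar[where \<Lambda>="\<lambda>w. dform \<Omega> w v"])
  have vH: "H1 \<Omega> v" using v by (rule H01_H1)
  show "dform \<Omega> (\<lambda>x. a * p x + b * w x) v = a * dform \<Omega> p v + b * dform \<Omega> w v"
    if "H1 \<Omega> p" "H1 \<Omega> w" for a b p w by (intro dform_lin that vH)
  show "\<bar>dform \<Omega> w v\<bar> \<le> H1norm \<Omega> w * sqrt (dform \<Omega> v v)" if "H1 \<Omega> w" for w
    by (intro dform_bound_H1 that vH)
  show "0 \<le> sqrt (dform \<Omega> v v)" by (simp add: dform_self_nonneg)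
  show "((\<lambda>s. dform \<Omega> (u s) v) \<longlongrightarrow> dform \<Omega> u0 v) (at_right 0)"
  proof (rule H1_bounded_L2_limit_weak[OF _ H01_H1[OF u0] init v])
    show "\<forall>\<^sub>F s in at_right 0. H1 \<Omega> (u s) \<and> sqrt (dform \<Omega> (u s) (u s)) \<le> C1 * N T + sqrt (dform \<Omega> (u T) (u T))"
      using at_right_in by eventually_elim (use regH1(1) gradient_bounded in auto)
  qed
qed

end

text \<open>Gamma is logarithmically convex and equals 1 at both 1 and 2, hence is at most 1 in
  between; the functional equation transports this to 1 - a.\<close>

lemma Gamma_le_inverse:
  fixes a :: real
  assumes "0 < a" "a < 1"
  shows "Gamma (1 - a) \<le> 1 / (1 - a)"
proof -
  have "(ln \<circ> Gamma) ((1 - (1 - a)) *\<^sub>R 1 + (1 - a) *\<^sub>R (2::real)) \<le> (1 - (1 - a)) * (ln \<circ> Gamma) 1 + (1 - a) * (ln \<circ> Gamma) (2::real)"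
    using assms by (intro convex_onD[OF log_convex_Gamma_real]) auto
  moreover have "Gamma (2::real) = 1" using Gamma_fact[of 1, where 'a=real] by simp
  moreover have "(1 - (1 - a)) *\<^sub>R 1 + (1 - a) *\<^sub>R (2::real) = 2 - a" by simp
  ultimately have "ln (Gamma (2 - a)) \<le> 0" by simp
  then have "Gamma (2 - a) \<le> 1" using assms Gamma_real_pos[of "2 - a"] by (simp add: ln_le_zero_iff)
  moreover have "Gamma (2 - a) = (1 - a) * Gamma (1 - a)"
  proof -
    have "1 - a \<notin> \<int>\<^sub>\<le>\<^sub>0" using assms by (auto elim!: nonpos_Ints_cases)
    from Gamma_plus1[OF this] show ?thesis by (simp add: algebra_simps)
  qed
  ultimately show ?thesis using assms by (simp add: field_simps)
qed

lemma (in l21_mesh) Gf_scale: "Gf (c * x) (d * x) j = Gf c d j * x"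
  by (simp add: Gf_def)

lemma (in l21_mesh) Hf_scale: "Hf (c * x) (d * x) j = Hf c d j * x"
  by (simp add: Hf_def)

section \<open>Error equation, energy step and the final bound\<close>

context l21_problem
begin

abbreviation "ue \<equiv> \<lambda>s. if s = 0 then u0 else u s"

definition e :: "nat \<Rightarrow> 'd \<Rightarrow> real" where "e k = (\<lambda>x. ue (t k) x - U k x)"

abbreviation "\<Gamma>' \<equiv> Gamma (1 - \<alpha>)"

text \<open>Bounds the error of replacing the Dirichlet pairing at the collocation point by the
  weighted average at the mesh points, per unit of the gradient norm of the test function.\<close>

definition mid :: "nat \<Rightarrow> real" where
  "mid k = (if k = 1 then 2 * C1 * N (t 1) else C2 * (1 + t (k - 1) powr (\<alpha> - 2)) * (tau t k)\<^sup>2)"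

lemma Gamma_pos: "0 < \<Gamma>'" using \<alpha> by (simp add: Gamma_real_pos)

lemma tkT: "k \<le> n \<Longrightarrow> t k \<le> T" using t_le[of k n] tn by simp

lemma ue_H01: "k \<le> n \<Longrightarrow> H01 \<Omega> (ue (t k))"
  using u0 reg(1)[of "t k"] tkT[of k] t_nonneg[of k] by auto

lemma U_H01: "k \<le> n \<Longrightarrow> H01 \<Omega> (U k)"
  using UH[of k] U0 u0 by (cases "k = 0") auto

lemma e_H01: "k \<le> n \<Longrightarrow> H01 \<Omega> (e k)"
  unfolding e_def by (intro H01_diff ue_H01 U_H01)

lemma e_L2: "k \<le> n \<Longrightarrow> L2 \<Omega> (e k)"
  using e_H01 H01_H1 H1_L2 by blast

lemma e_0: "e 0 = (\<lambda>x. 0)"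
  by (simp add: e_def U0 t0)

text \<open>The equation at the collocation point and the scheme are tested with the same v,
  multiplied by \<Gamma>(1 - \<alpha>) and subtracted, so the source term drops out. What remains is
  the truncation error, the averaging error of the Dirichlet form, and the dissipation of the
  error.\<close>

lemma error_equation:
  assumes k: "1 \<le> k" "k \<le> n" and v: "H01 \<Omega> v"
  shows "(\<Sum>j=1..k. wt k j * L2inner \<Omega> (\<lambda>x. e j x - e (j - 1) x) v) =
    ((\<Sum>j=1..k. wt k j * (L2inner \<Omega> (ue (t j)) v - L2inner \<Omega> (ue (t (j - 1))) v))
       - (LBINT r=0..tstar \<alpha> t k. (tstar \<alpha> t k - r) powr (- \<alpha>) * L2inner \<Omega> (u1 r) v))
    + \<Gamma>' * ((\<sigma> * dform \<Omega> (ue (t k)) v + (1 - \<sigma>) * dform \<Omega> (ue (t (k - 1))) v - dform \<Omega> (ue (tstar \<alpha> t k)) v)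
       - (\<sigma> * dform \<Omega> (e k) v + (1 - \<sigma>) * dform \<Omega> (e (k - 1)) v))"
proof -
  have vH: "H1 \<Omega> v" and vL: "L2 \<Omega> v" using v H01_H1 H1_L2 by blast+
  have UL: "L2 \<Omega> (U j)" and uL: "L2 \<Omega> (ue (t j))" if "j \<le> n" for j
    using that U_H01 ue_H01 H01_H1 H1_L2 by blast+
  have ts: "tstar \<alpha> t k \<in> {0<..T}" using tstar_pos[of k] tstar_bounds[of k] tkT[of k] k by auto
  have "L2inner \<Omega> (Lstar \<alpha> t U k) v = (1 / \<Gamma>') * (\<Sum>j=1..k. wt k j * (L2inner \<Omega> (U j) v - L2inner \<Omega> (U (j - 1)) v))"
  proof -
    have "Lstar \<alpha> t U k = (\<lambda>x. \<Sum>j=1..k. (1 / \<Gamma>' * wt k j) * (U j x - U (j - 1) x))"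
      using Lstar_eq[OF k(1), of U] by (auto simp: fun_eq_iff sum_distrib_left mult.assoc)
    moreover have "L2 \<Omega> (\<lambda>x. U j x - U (j - 1) x)" if "j \<in> {1..k}" for j
      using that k by (intro L2_diff UL) auto
    ultimately have "L2inner \<Omega> (Lstar \<alpha> t U k) v = (\<Sum>j=1..k. (1 / \<Gamma>' * wt k j) * L2inner \<Omega> (\<lambda>x. U j x - U (j - 1) x) v)"
      using L2inner_sum[of k "\<lambda>j x. U j x - U (j - 1) x" v "\<lambda>j. 1 / \<Gamma>' * wt k j", OF _ vL] by simp
    also have "\<dots> = (\<Sum>j=1..k. (1 / \<Gamma>' * wt k j) * (L2inner \<Omega> (U j) v - L2inner \<Omega> (U (j - 1)) v))"
      using k by (intro sum.cong refl arg_cong2[where f="(*)"] L2inner_diff UL vL) auto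
    finally show ?thesis by (simp add: sum_distrib_left mult.assoc)
  qed
  note LU = this
  have SU: "(\<Sum>j=1..k. wt k j * (L2inner \<Omega> (U j) v - L2inner \<Omega> (U (j - 1)) v)) =
      \<Gamma>' * (L2inner \<Omega> (f (tstar \<alpha> t k)) v - (\<sigma> * dform \<Omega> (U k) v + (1 - \<sigma>) * dform \<Omega> (U (k - 1)) v))"
  proof -
    define Y where "Y = (\<Sum>j=1..k. wt k j * (L2inner \<Omega> (U j) v - L2inner \<Omega> (U (j - 1)) v))"
    have "Y = \<Gamma>' * L2inner \<Omega> (Lstar \<alpha> t U k) v" unfolding LU Y_def[symmetric] using Gamma_pos by simp
    also have "L2inner \<Omega> (Lstar \<alpha> t U k) v =
        L2inner \<Omega> (f (tstar \<alpha> t k)) v - (\<sigma> * dform \<Omega> (U k) v + (1 - \<sigma>) * dform \<Omega> (U (k - 1)) v)"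
      using scheme[OF k v] by (simp add: \<sigma>_def)
    finally show ?thesis unfolding Y_def .
  qed
  have "(1 / \<Gamma>') * (LBINT r=0..tstar \<alpha> t k. (tstar \<alpha> t k - r) powr (- \<alpha>) * L2inner \<Omega> (u1 r) v) =
      L2inner \<Omega> (f (tstar \<alpha> t k)) v - dform \<Omega> (ue (tstar \<alpha> t k)) v"
    using pde[OF ts v] ts by simp
  then have SC: "(LBINT r=0..tstar \<alpha> t k. (tstar \<alpha> t k - r) powr (- \<alpha>) * L2inner \<Omega> (u1 r) v) =
      \<Gamma>' * (L2inner \<Omega> (f (tstar \<alpha> t k)) v - dform \<Omega> (ue (tstar \<alpha> t k)) v)"
    using Gamma_pos by (simp add: field_simps)
  have "L2inner \<Omega> (\<lambda>x. e j x - e (j - 1) x) v =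
      (L2inner \<Omega> (ue (t j)) v - L2inner \<Omega> (ue (t (j - 1))) v) - (L2inner \<Omega> (U j) v - L2inner \<Omega> (U (j - 1)) v)"
    if "j \<in> {1..k}" for j
  proof -
    have j: "j \<le> n" "j - 1 \<le> n" using that k by auto
    have "L2inner \<Omega> (e i) v = L2inner \<Omega> (ue (t i)) v - L2inner \<Omega> (U i) v" if "i \<le> n" for i
      unfolding e_def by (intro L2inner_diff uL UL that vL)
    note a = this[OF j(1)] this[OF j(2)]
    show ?thesis unfolding L2inner_diff[OF e_L2[OF j(1)] e_L2[OF j(2)] vL] a by linarith
  qed
  then have "(\<Sum>j=1..k. wt k j * L2inner \<Omega> (\<lambda>x. e j x - e (j - 1) x) v) =
      (\<Sum>j=1..k. wt k j * (L2inner \<Omega> (ue (t j)) v - L2inner \<Omega> (ue (t (j - 1))) v) -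
        wt k j * (L2inner \<Omega> (U j) v - L2inner \<Omega> (U (j - 1)) v))"
    by (intro sum.cong refl) (simp add: right_diff_distrib)
  also have "\<dots> = (\<Sum>j=1..k. wt k j * (L2inner \<Omega> (ue (t j)) v - L2inner \<Omega> (ue (t (j - 1))) v)) -
      \<Gamma>' * (L2inner \<Omega> (f (tstar \<alpha> t k)) v - (\<sigma> * dform \<Omega> (U k) v + (1 - \<sigma>) * dform \<Omega> (U (k - 1)) v))"
    unfolding sum_subtractf SU ..
  finally have eq: "(\<Sum>j=1..k. wt k j * L2inner \<Omega> (\<lambda>x. e j x - e (j - 1) x) v) = \<dots>" .
  have de: "dform \<Omega> (e i) v = dform \<Omega> (ue (t i)) v - dform \<Omega> (U i) v" if "i \<le> n" for i
    unfolding e_def using dform_lin[OF H01_H1[OF ue_H01[OF that]] H01_H1[OF U_H01[OF that]] vH, of 1 "-1"] by simp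
  have kn: "k \<le> n" "k - 1 \<le> n" using k by auto
  have alg: "A - g * (F - (s * a' + (1 - s) * b')) =
      (A - g * (F - d)) + g * ((s * a + (1 - s) * b - d) - (s * (a - a') + (1 - s) * (b - b')))"
    for A F a b a' b' d g s :: real
    by (simp add: algebra_simps)
  show ?thesis
    unfolding eq SC de[OF kn(1)] de[OF kn(2)] by (rule alg)
qed

text \<open>Testing with v = \<sigma> e k + (1 - \<sigma>) e (k - 1) turns the dissipation into -
  \<Gamma>(1 - \<alpha>) g^2 with g the gradient norm of v. It absorbs the averaging error, because
  mid g - g^2 \<le> mid^2 / 4.\<close>

lemma energy_step:
  assumes k: "1 \<le> k" "k \<le> n" and E: "\<And>j. j \<le> n \<Longrightarrow> L2norm \<Omega> (e j) \<le> E"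
  shows "(\<Sum>j=1..k. wt k j * (L2inner \<Omega> (e j) (e j) - L2inner \<Omega> (e (j - 1)) (e (j - 1)))) \<le>
    2 * E * ((\<Sum>j=1..k-1. (10 * Gf C1 C3 j) * (wt k (j + 1) - wt k j)) + Hf C1 C3 k * wt k k) + \<Gamma>' * (mid k)\<^sup>2 / 2"
proof -
  define v where "v = (\<lambda>x. \<sigma> * e k x + (1 - \<sigma>) * e (k - 1) x)"
  have kn: "k \<le> n" "k - 1 \<le> n" using k by auto
  have v: "H01 \<Omega> v" unfolding v_def by (intro H01_lin e_H01 kn)
  have vH: "H1 \<Omega> v" and vL: "L2 \<Omega> v" using v H01_H1 H1_L2 by blast+
  define g where "g = sqrt (dform \<Omega> v v)"
  have g2: "g\<^sup>2 = dform \<Omega> v v" by (simp add: g_def dform_self_nonneg)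
  interpret sL: l21_scalar \<alpha> t "\<lambda>s. L2inner \<Omega> (ue s) v" "\<lambda>s. L2inner \<Omega> (u1 s) v"
    "\<lambda>s. L2inner \<Omega> (u2 s) v" "\<lambda>s. L2inner \<Omega> (u3 s) v" T "C1 * L2norm \<Omega> v" "C2 * L2norm \<Omega> v" "C3 * L2norm \<Omega> v"
    by (rule L2_functional_scalar[OF vL])
  interpret sD: l21_scalar \<alpha> t "\<lambda>s. dform \<Omega> (ue s) v" "\<lambda>s. dform \<Omega> (u1 s) v"
    "\<lambda>s. dform \<Omega> (u2 s) v" "\<lambda>s. dform \<Omega> (u3 s) v" T "C1 * g" "C2 * g" "C3 * g"
    unfolding g_def by (rule dform_functional_scalar[OF v])
  define X where "X = (\<Sum>j=1..k-1. (10 * Gf C1 C3 j) * (wt k (j + 1) - wt k j)) + Hf C1 C3 k * wt k k"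
  have TL: "\<bar>(\<Sum>j=1..k. wt k j * (L2inner \<Omega> (ue (t j)) v - L2inner \<Omega> (ue (t (j - 1))) v))
       - (LBINT r=0..tstar \<alpha> t k. (tstar \<alpha> t k - r) powr (- \<alpha>) * L2inner \<Omega> (u1 r) v)\<bar> \<le> X * L2norm \<Omega> v"
  proof -
    have "(\<Sum>j=1..k-1. 10 * (Gf C1 C3 j * L2norm \<Omega> v) * (wt k (j + 1) - wt k j)) + Hf C1 C3 k * L2norm \<Omega> v * wt k k = X * L2norm \<Omega> v"
      unfolding X_def distrib_right sum_distrib_right by (simp add: mult_ac)
    then show ?thesis using sL.truncation_error[OF k(1) tkT[OF k(2)]] unfolding Gf_scale Hf_scale by simp
  qed
  have TD: "\<bar>\<sigma> * dform \<Omega> (ue (t k)) v + (1 - \<sigma>) * dform \<Omega> (ue (t (k - 1))) v - dform \<Omega> (ue (tstar \<alpha> t k)) v\<bar> \<le> mid k * g"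
  proof (cases "k = 1")
    case True
    have z: "t (1 - 1) = 0" by (simp add: t0)
    have "t 1 \<le> T" using tkT[OF k(2)] True by simp
    from sD.midpoint_error_first[OF this] show ?thesis unfolding True z by (simp only: mid_def simp_thms if_True mult_ac)
  next
    case False
    then have "2 \<le> k" using k by simp
    from sD.midpoint_error[OF this tkT[OF k(2)]] show ?thesis using False by (simp add: mid_def mult_ac)
  qed
  have vE: "L2norm \<Omega> v \<le> E"
    unfolding v_def using \<sigma> by (intro L2norm_convex e_L2 kn E) auto
  have X0: "0 \<le> X" 
  proof -
    have "0 \<le> Gf C1 C3 j" if "1 \<le> j" for j
      using C N_nonneg[OF t_nonneg] tau_pos[of j] tau_pos[of "j + 1"] that by (simp add: Gf_def rho_def)
    moreover have "0 \<le> Hf C1 C3 k"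
      using C N_nonneg[OF t_nonneg] tau_pos[of k] k by (simp add: Hf_def)
    moreover have "0 \<le> wt k k" using P_le_wt[OF k(1)] P_nonneg[of k] by linarith
    moreover have "0 \<le> wt k (j + 1) - wt k j" if "1 \<le> j" "j < k" for j using wt_mono[OF that] by simp
    ultimately show ?thesis unfolding X_def by (intro add_nonneg_nonneg sum_nonneg mult_nonneg_nonneg) auto
  qed
  have dv: "\<sigma> * dform \<Omega> (e k) v + (1 - \<sigma>) * dform \<Omega> (e (k - 1)) v = g\<^sup>2"
    unfolding g2 using dform_lin[OF H01_H1[OF e_H01[OF kn(1)]] H01_H1[OF e_H01[OF kn(2)]] vH, of \<sigma> "1 - \<sigma>"]
    by (simp add: v_def)
  have sq: "mid k * g - g\<^sup>2 \<le> (mid k)\<^sup>2 / 4"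
    using zero_le_power2[of "g - mid k / 2"] by (simp add: power2_eq_square algebra_simps)
  have "(\<Sum>j=1..k. wt k j * L2inner \<Omega> (\<lambda>x. e j x - e (j - 1) x) v) \<le> X * L2norm \<Omega> v + \<Gamma>' * (mid k * g - g\<^sup>2)"
    unfolding error_equation[OF k v] dv using TL TD Gamma_pos
    by (intro add_mono mult_left_mono) auto
  also have "\<dots> \<le> X * E + \<Gamma>' * ((mid k)\<^sup>2 / 4)"
    using vE X0 sq Gamma_pos by (intro add_mono mult_left_mono) auto
  finally have "2 * (\<Sum>j=1..k. wt k j * L2inner \<Omega> (\<lambda>x. e j x - e (j - 1) x) v) \<le> 2 * E * X + \<Gamma>' * (mid k)\<^sup>2 / 2"
    by (simp add: algebra_simps)
  moreover have "(\<Sum>j=1..k. wt k j * (L2inner \<Omega> (e j) (e j) - L2inner \<Omega> (e (j - 1)) (e (j - 1)))) \<le>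
      2 * (\<Sum>j=1..k. wt k j * L2inner \<Omega> (\<lambda>x. e j x - e (j - 1) x) v)"
    unfolding v_def
    by (rule energy_inequality[OF k(1)])
      (use wt_first_pos[OF k(1)] wt_mono wt_penultimate \<sigma> e_L2 k in auto)
  ultimately show ?thesis unfolding X_def by linarith
qed

theorem error_bound:
  shows "maxk {1..n} (\<lambda>k. L2norm \<Omega> (\<lambda>x. u (t k) x - U k x)) \<le>
      1000 * (C1 + C2 + C3) * (t 2 powr \<alpha> / \<alpha> + t 2
        + (1 / (1 - \<alpha>)) * maxk {2..n} (\<lambda>k. (1 + rho t (k + 1)) * (1 + t (k - 1) powr (\<alpha> - 3))
              * tstar \<alpha> t (k - 1) powr \<alpha> * tau t k ^ 3 * tau t (k - 1) powr (- \<alpha>))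
        + (tau t 1 powr \<alpha> / \<alpha> + tau t 1) * tau t 1 powr (\<alpha> / 2)
        + sqrt (Gamma (1 - \<alpha>)) * maxk {2..n} (\<lambda>k. tstar \<alpha> t k powr (\<alpha> / 2)
              * (1 + t (k - 1) powr (\<alpha> - 2)) * tau t k ^ 2))"
proof -
  let ?e = "\<lambda>k. L2norm \<Omega> (\<lambda>x. u (t k) x - U k x)"
  let ?g3 = "\<lambda>k. (1 + rho t (k + 1)) * (1 + t (k - 1) powr (\<alpha> - 3))
              * tstar \<alpha> t (k - 1) powr \<alpha> * tau t k ^ 3 * tau t (k - 1) powr (- \<alpha>)"
  let ?g2 = "\<lambda>k. tstar \<alpha> t k powr (\<alpha> / 2) * (1 + t (k - 1) powr (\<alpha> - 2)) * tau t k ^ 2"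
  define E where "E = maxk {1..n} ?e"
  define m3 where "m3 = (1 / (1 - \<alpha>)) * maxk {2..n} ?g3"
  define m2 where "m2 = sqrt \<Gamma>' * maxk {2..n} ?g2"
  define m1 where "m1 = N (t 1) * tau t 1 powr (\<alpha> / 2)"
  \<comment> \<open>45 = 10 * 4 + 5 combines the first-interval constants of \<open>Gf\<close> and
    \<open>Hf\<close>; 385 = 11 * 35 combines the interpolation and local errors with the constant
    of \<open>wt_ratio\<close>.\<close>
  define S where "S = 45 * C1 * N (t 2) + 385 * C3 * m3"
  define q where "q = 2 * C1 * m1 + C2 * m2"
  have pos: "0 \<le> E" "0 \<le> m3" "0 \<le> m2" "0 \<le> m1" "0 \<le> N (t 2)"
    using maxk_nonneg[of "{1..n}" ?e] maxk_nonneg[of "{2..n}" ?g3] maxk_nonneg[of "{2..n}" ?g2] \<alpha> Gamma_pos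
      N_nonneg[OF t_nonneg]
    by (auto simp: E_def m3_def m2_def m1_def)
  have e_eq: "L2norm \<Omega> (e k) = ?e k" if "1 \<le> k" for k
    using t_less[of 0 k] that t0 by (simp add: e_def)
  have eE: "L2norm \<Omega> (e j) \<le> E" if "j \<le> n" for j
  proof (cases "j = 0")
    case True
    then show ?thesis using pos by (simp add: e_0 L2norm_eq L2inner_eq)
  next
    case False
    then show ?thesis using that maxk_ge[of "{1..n}" j ?e] e_eq[of j] by (simp add: E_def)
  qed
  have S: "wt k k * (10 * Gf C1 C3 k + Hf C1 C3 k) \<le> S * wt k 1" if k: "1 \<le> k" "k \<le> n" for k
  proof (cases "k = 1")
    case True
    have "5 * C1 * N (t 1) \<le> 5 * C1 * N (t 2)"
      using C t_nonneg[of 1] t_le[of 1 2] by (intro mult_left_mono N_mono) auto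
    moreover have "0 \<le> 385 * C3 * m3" using C pos by simp
    ultimately have "10 * Gf C1 C3 1 + Hf C1 C3 1 \<le> S" by (simp add: Gf_def Hf_def S_def)
    then show ?thesis using True wt_first_pos[of 1] by (simp add: mult.commute)
  next
    case False
    then have k2: "2 \<le> k" using k by simp
    let ?A = "C3 * (1 + t (k - 1) powr (\<alpha> - 3)) * tau t k ^ 3"
    let ?R = "35 / (1 - \<alpha>) * (tstar \<alpha> t (k - 1) powr \<alpha> * tau t (k - 1) powr (- \<alpha>))"
    have tp: "0 < tau t k" "0 < tau t (k + 1)" using tau_pos k by auto
    have A: "0 \<le> ?A" using C tp by simp
    have r: "0 \<le> rho t (k + 1)" using tp by (simp add: rho_def)
    have "10 * Gf C1 C3 k + Hf C1 C3 k = ?A * (10 * (1 + rho t (k + 1)) + 1)"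
      using False by (simp add: Gf_def Hf_def algebra_simps)
    also have "\<dots> \<le> ?A * (11 * (1 + rho t (k + 1)))" using A r by (intro mult_left_mono) auto
    finally have 1: "10 * Gf C1 C3 k + Hf C1 C3 k \<le> ?A * (11 * (1 + rho t (k + 1)))" .
    have wk: "0 \<le> wt k k" using P_le_wt[OF k(1)] P_nonneg[of k] by linarith
    have "wt k k * (10 * Gf C1 C3 k + Hf C1 C3 k) \<le> wt k k * (?A * (11 * (1 + rho t (k + 1))))"
      using 1 wk by (intro mult_left_mono)
    also have "\<dots> \<le> (?R * wt k 1) * (?A * (11 * (1 + rho t (k + 1))))"
      using wt_ratio[OF k2] A r by (intro mult_right_mono) auto
    also have "\<dots> = 385 * C3 * ((1 / (1 - \<alpha>)) * ?g3 k) * wt k 1"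
    proof -
      have "(35 / x * (a * b) * X) * (y * p * z * (11 * r)) = 385 * y * ((1 / x) * (r * p * a * z * b)) * X"
        for x a b X y p z r :: real by (simp add: divide_inverse mult_ac)
      then show ?thesis .
    qed
    also have "\<dots> \<le> 385 * C3 * m3 * wt k 1"
      unfolding m3_def using maxk_ge[of "{2..n}" k ?g3] k k2 \<alpha> C wt_first_pos[OF k(1)]
      by (intro mult_right_mono mult_left_mono) auto
    also have "\<dots> \<le> S * wt k 1"
      using C pos wt_first_pos[OF k(1)] by (intro mult_right_mono) (auto simp: S_def)
    finally show ?thesis .
  qed
  have q0: "0 \<le> q" and S0: "0 \<le> S" using C pos by (auto simp: q_def S_def)
  \<comment> \<open>Z is an upper bound for the square root of \<Gamma>(1 - \<alpha>) / (2 wt k 1),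
    so that only the first power of \<open>mid k\<close> has to be compared with q.\<close>
  have mid_sq: "\<Gamma>' * (mid k)\<^sup>2 / 2 / wt k 1 \<le> q\<^sup>2"
    if "1 \<le> k" "\<Gamma>' \<le> 2 * wt k 1 * Z\<^sup>2" "0 \<le> mid k * Z" "mid k * Z \<le> q" for k Z
  proof -
    have "\<Gamma>' * (mid k)\<^sup>2 \<le> 2 * wt k 1 * Z\<^sup>2 * (mid k)\<^sup>2" using that by (intro mult_right_mono) auto
    then have "\<Gamma>' * (mid k)\<^sup>2 / 2 / wt k 1 \<le> (mid k * Z)\<^sup>2"
      using wt_first_pos[OF that(1)] by (simp add: field_simps power_mult_distrib)
    also have "\<dots> \<le> q\<^sup>2" using that by (intro power_mono)
    finally show ?thesis .
  qed
  have Q: "\<Gamma>' * (mid k)\<^sup>2 / 2 / wt k 1 \<le> q\<^sup>2" if k: "1 \<le> k" "k \<le> n" for k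
  proof (cases "k = 1")
    case True
    have tp: "0 < tau t 1" using tau_pos by simp
    \<comment> \<open>In the first step the weight itself contains 1 / (1 - \<alpha>), which
      swallows the Gamma factor; hence no square root of Gamma in the corresponding term of the
      estimate.\<close>
    have "\<Gamma>' \<le> 1 / (1 - \<alpha>)" using Gamma_le_inverse[OF \<alpha>] .
    also have "\<dots> \<le> 2 * \<sigma> powr (1 - \<alpha>) / (1 - \<alpha>)" using \<sigma>_powr(2) \<alpha> by (intro divide_right_mono) auto
    also have "\<dots> = 2 * wt 1 1 * (tau t 1 powr (\<alpha> / 2))\<^sup>2"
    proof -
      have "tau t 1 powr (- \<alpha>) * (tau t 1 powr (\<alpha> / 2))\<^sup>2 = 1"
        using tp by (simp add: power2_eq_square flip: powr_add)
      then show ?thesis unfolding wt_11 by (simp add: mult.assoc)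
    qed
    finally have "\<Gamma>' \<le> 2 * wt 1 1 * (tau t 1 powr (\<alpha> / 2))\<^sup>2" .
    moreover have "mid 1 * tau t 1 powr (\<alpha> / 2) = 2 * C1 * m1" by (simp add: mid_def m1_def)
    ultimately show ?thesis using mid_sq[of 1 "tau t 1 powr (\<alpha> / 2)"] C pos True by (simp add: q_def)
  next
    case False
    then have k2: "2 \<le> k" using k by simp
    let ?c = "tstar \<alpha> t k"
    \<comment> \<open>For later steps the first weight is only known to be at least the kernel at 0,
      so the Gamma factor and the power of \<open>tstar\<close> stay in the bound.\<close>
    let ?Z = "sqrt \<Gamma>' * ?c powr (\<alpha> / 2)"
    have c: "0 < ?c" using tstar_pos[OF k(1)] .
    have Z2: "?Z\<^sup>2 = \<Gamma>' * ?c powr \<alpha>"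
    proof -
      have "(?c powr (\<alpha> / 2))\<^sup>2 = ?c powr \<alpha>" by (simp add: power2_eq_square flip: powr_add)
      then show ?thesis using Gamma_pos by (simp add: power_mult_distrib)
    qed
    have "?c powr (- \<alpha>) \<le> wt k 1" using wt_first_ge[OF k(1)] by (simp add: w_def)
    then have "?c powr (- \<alpha>) * ?c powr \<alpha> \<le> wt k 1 * ?c powr \<alpha>" by (intro mult_right_mono) auto
    then have "1 \<le> wt k 1 * ?c powr \<alpha>" using c by (simp add: powr_minus)
    then have "\<Gamma>' * 1 \<le> \<Gamma>' * (2 * (wt k 1 * ?c powr \<alpha>))" using Gamma_pos by (intro mult_left_mono) auto
    then have 1: "\<Gamma>' \<le> 2 * wt k 1 * ?Z\<^sup>2" unfolding Z2 by (simp add: mult_ac)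
    have m: "mid k * ?Z = C2 * (sqrt \<Gamma>' * ?g2 k)" using False by (simp add: mid_def mult_ac)
    have "mid k * ?Z \<le> C2 * m2"
      unfolding m m2_def using maxk_ge[of "{2..n}" k ?g2] k k2 C Gamma_pos by (intro mult_left_mono) auto
    also have "\<dots> \<le> q" using C pos by (simp add: q_def)
    finally have 2: "mid k * ?Z \<le> q" .
    have "0 \<le> mid k * ?Z" unfolding m using C Gamma_pos by simp
    from mid_sq[OF k(1) 1 this 2] show ?thesis .
  qed
  have y: "L2inner \<Omega> (e k) (e k) \<le> 2 * E * S + q\<^sup>2" if k: "1 \<le> k" "k \<le> n" for k
  proof -
    have "L2inner \<Omega> (e k) (e k) \<le> 2 * E * S + q\<^sup>2 - 2 * E * (10 * Gf C1 C3 k)"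
    \<comment> \<open>The averaging error is divided by the first weight because the stability lemma
      measures this part of the right-hand side in units of \<open>A k 1\<close>.\<close>
    proof (rule discrete_stability[where A=wt and y="\<lambda>k. L2inner \<Omega> (e k) (e k)" and n=n
          and H="Hf C1 C3" and G="\<lambda>k. 10 * Gf C1 C3 k" and q="\<lambda>k. \<Gamma>' * (mid k)\<^sup>2 / 2 / wt k 1"])
      show "L2inner \<Omega> (e 0) (e 0) = 0" by (simp add: e_0 L2inner_eq)
      fix k assume k: "1 \<le> k" "k \<le> n"
      show "0 < wt k 1" by (rule wt_first_pos[OF k(1)])
      then have "\<Gamma>' * (mid k)\<^sup>2 / 2 / wt k 1 * wt k 1 = \<Gamma>' * (mid k)\<^sup>2 / 2" by simp
      then show "(\<Sum>j=1..k. wt k j * (L2inner \<Omega> (e j) (e j) - L2inner \<Omega> (e (j - 1)) (e (j - 1)))) \<le>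
        2 * E * ((\<Sum>j=1..k-1. 10 * Gf C1 C3 j * (wt k (j + 1) - wt k j)) + Hf C1 C3 k * wt k k) + \<Gamma>' * (mid k)\<^sup>2 / 2 / wt k 1 * wt k 1"
        using energy_step[OF k eE] by simp
    qed (use wt_mono pos S Q k in auto)
    moreover have "0 \<le> Gf C1 C3 k"
      using C N_nonneg[OF t_nonneg] tau_pos[of k] tau_pos[of "k + 1"] k by (simp add: Gf_def rho_def)
    then have "0 \<le> 2 * E * (10 * Gf C1 C3 k)" using pos by simp
    ultimately show ?thesis by linarith
  qed
  have "E\<^sup>2 \<le> 2 * E * S + q\<^sup>2"
  proof (rule maxk_cases[of "{1..n}" ?e])
    assume "maxk {1..n} ?e = 0"
    then show ?thesis by (simp add: E_def)
  next
    fix k assume k: "k \<in> {1..n}" "maxk {1..n} ?e = ?e k"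
    then have "E = L2norm \<Omega> (e k)" using e_eq[of k] by (simp add: E_def)
    then have "E\<^sup>2 = L2inner \<Omega> (e k) (e k)" by (simp add: L2norm_sq)
    then show ?thesis using y[of k] k by simp
  qed simp
  from le_of_quadratic_bound[OF this q0 S0] have "E \<le> 2 * S + q" .
  also have "\<dots> \<le> 1000 * (C1 + C2 + C3) * (N (t 2) + m3 + m1 + m2)"
  \<comment> \<open>The coefficients that occur are 90, 770, 2 and 1, all below the round constant
    1000.\<close>
  proof -
    define D where "D = C1 + C2 + C3"
    have D: "C1 \<le> D" "C2 \<le> D" "C3 \<le> D" using C by (auto simp: D_def)
    have "C1 * N (t 2) \<le> D * N (t 2)" "C3 * m3 \<le> D * m3" "C1 * m1 \<le> D * m1" "C2 * m2 \<le> D * m2"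
      using D pos by (auto intro!: mult_right_mono)
    moreover have "0 \<le> D * N (t 2)" "0 \<le> D * m3" "0 \<le> D * m1" "0 \<le> D * m2" using D C pos by auto
    moreover have "1000 * D * (N (t 2) + m3 + m1 + m2) = 1000 * (D * N (t 2)) + 1000 * (D * m3) + 1000 * (D * m1) + 1000 * (D * m2)"
      by (simp add: algebra_simps)
    moreover have "2 * S + q = 90 * (C1 * N (t 2)) + 770 * (C3 * m3) + 2 * (C1 * m1) + C2 * m2"
      by (simp add: S_def q_def)
    ultimately show ?thesis unfolding D_def[symmetric] by linarith
  qed
  finally show ?thesis
    using t0 by (simp add: E_def m3_def m2_def m1_def N_def tau_def add_ac)
qed

end

theorem theorem3:
  fixes \<Omega> :: "'d::euclidean_space set" and C1 C2 C3 :: real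
  assumes "bounded \<Omega>" and "lipschitz_domain \<Omega>"
  shows "\<exists>C. \<forall>(\<alpha>::real) (T::real) (f :: real \<Rightarrow> 'd \<Rightarrow> real) (u0 :: 'd \<Rightarrow> real)
      (u :: real \<Rightarrow> 'd \<Rightarrow> real) (u1 :: real \<Rightarrow> 'd \<Rightarrow> real) (u2 :: real \<Rightarrow> 'd \<Rightarrow> real)
      (u3 :: real \<Rightarrow> 'd \<Rightarrow> real) (t :: nat \<Rightarrow> real) (U :: nat \<Rightarrow> 'd \<Rightarrow> real) (n::nat).
    0 < \<alpha> \<and> \<alpha> < 1 \<and> 0 < T \<and>
    \<comment> \<open>data\<close>
    H01 \<Omega> u0 \<and> (\<forall>s\<in>{0<..T}. L2 \<Omega> (f s)) \<and>
    \<comment> \<open>regularity: u \<in> C^3((0,T], H_0^1) with derivative bounds\<close>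
    (\<forall>s\<in>{0<..T}. H01 \<Omega> (u s) \<and> H01 \<Omega> (u1 s) \<and> H01 \<Omega> (u2 s) \<and> H01 \<Omega> (u3 s)) \<and>
    H1_deriv_on \<Omega> T u u1 \<and> H1_deriv_on \<Omega> T u1 u2 \<and> H1_deriv_on \<Omega> T u2 u3 \<and>
    H1_cont_on \<Omega> T u3 \<and>
    (\<forall>s\<in>{0<..T}. H1norm \<Omega> (u1 s) \<le> C1 * (1 + s powr (\<alpha> - 1)) \<and>
                  H1norm \<Omega> (u2 s) \<le> C2 * (1 + s powr (\<alpha> - 2)) \<and>
                  H1norm \<Omega> (u3 s) \<le> C3 * (1 + s powr (\<alpha> - 3))) \<and>
    \<comment> \<open>u solves the subdiffusion problem (weak form, Caputo derivative)\<close>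
    (\<forall>s\<in>{0<..T}. \<forall>v. H01 \<Omega> v \<longrightarrow>
        (1 / Gamma (1 - \<alpha>)) * (LBINT r=0..s. (s - r) powr (- \<alpha>) * L2inner \<Omega> (u1 r) v)
          + dform \<Omega> (u s) v = L2inner \<Omega> (f s) v) \<and>
    ((\<lambda>s. L2norm \<Omega> (\<lambda>x. u s x - u0 x)) \<longlongrightarrow> 0) (at_right 0) \<and>
    \<comment> \<open>time mesh\<close>
    t 0 = 0 \<and> strict_mono t \<and> (\<forall>k\<ge>2. rho t k \<ge> eta) \<and>
    \<comment> \<open>the L2-1_sigma scheme\<close>
    U 0 = u0 \<and>
    (\<forall>k\<in>{1..n}. H01 \<Omega> (U k) \<and> (\<forall>v. H01 \<Omega> v \<longrightarrow>
        L2inner \<Omega> (Lstar \<alpha> t U k) v + (1 - \<alpha> / 2) * dform \<Omega> (U k) v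
          + (\<alpha> / 2) * dform \<Omega> (U (k - 1)) v = L2inner \<Omega> (f (tstar \<alpha> t k)) v)) \<and>
    t n \<le> T
    \<longrightarrow>
    maxk {1..n} (\<lambda>k. L2norm \<Omega> (\<lambda>x. u (t k) x - U k x)) \<le>
      C * (t 2 powr \<alpha> / \<alpha> + t 2
        + (1 / (1 - \<alpha>)) * maxk {2..n} (\<lambda>k. (1 + rho t (k + 1)) * (1 + t (k - 1) powr (\<alpha> - 3))
              * tstar \<alpha> t (k - 1) powr \<alpha> * tau t k ^ 3 * tau t (k - 1) powr (- \<alpha>))
        + (tau t 1 powr \<alpha> / \<alpha> + tau t 1) * tau t 1 powr (\<alpha> / 2)
        + sqrt (Gamma (1 - \<alpha>)) * maxk {2..n} (\<lambda>k. tstar \<alpha> t k powr (\<alpha> / 2)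
              * (1 + t (k - 1) powr (\<alpha> - 2)) * tau t k ^ 2))"
proof (intro exI[of _ "1000 * (\<bar>C1\<bar> + \<bar>C2\<bar> + \<bar>C3\<bar>)"] allI impI, elim conjE)
  fix \<alpha> T :: real and f u u1 u2 u3 :: "real \<Rightarrow> 'd \<Rightarrow> real" and u0 :: "'d \<Rightarrow> real"
    and t :: "nat \<Rightarrow> real" and U :: "nat \<Rightarrow> 'd \<Rightarrow> real" and n :: nat
  assume \<alpha>: "0 < \<alpha>" "\<alpha> < 1" and T: "0 < T" and u0: "H01 \<Omega> u0"
    and reg: "\<forall>s\<in>{0<..T}. H01 \<Omega> (u s) \<and> H01 \<Omega> (u1 s) \<and> H01 \<Omega> (u2 s) \<and> H01 \<Omega> (u3 s)"
    and der: "H1_deriv_on \<Omega> T u u1" "H1_deriv_on \<Omega> T u1 u2" "H1_deriv_on \<Omega> T u2 u3"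
    and bounds: "\<forall>s\<in>{0<..T}. H1norm \<Omega> (u1 s) \<le> C1 * (1 + s powr (\<alpha> - 1)) \<and>
                  H1norm \<Omega> (u2 s) \<le> C2 * (1 + s powr (\<alpha> - 2)) \<and>
                  H1norm \<Omega> (u3 s) \<le> C3 * (1 + s powr (\<alpha> - 3))"
    and pde: "\<forall>s\<in>{0<..T}. \<forall>v. H01 \<Omega> v \<longrightarrow>
        (1 / Gamma (1 - \<alpha>)) * (LBINT r=0..s. (s - r) powr (- \<alpha>) * L2inner \<Omega> (u1 r) v)
          + dform \<Omega> (u s) v = L2inner \<Omega> (f s) v"
    and init: "((\<lambda>s. L2norm \<Omega> (\<lambda>x. u s x - u0 x)) \<longlongrightarrow> 0) (at_right 0)"
    and mesh: "t 0 = 0" "strict_mono t" "\<forall>k\<ge>2. rho t k \<ge> eta"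
    and U0: "U 0 = u0"
    and scheme: "\<forall>k\<in>{1..n}. H01 \<Omega> (U k) \<and> (\<forall>v. H01 \<Omega> v \<longrightarrow>
        L2inner \<Omega> (Lstar \<alpha> t U k) v + (1 - \<alpha> / 2) * dform \<Omega> (U k) v
          + (\<alpha> / 2) * dform \<Omega> (U (k - 1)) v = L2inner \<Omega> (f (tstar \<alpha> t k)) v)"
    and tn: "t n \<le> T"
  \<comment> \<open>The given constants may have any sign, while the locale asks for nonnegative
    ones; their absolute values weaken the bounds and fix C independently of \<alpha>, T, the mesh
    and the data.\<close>
  have up: "c * x \<le> \<bar>c\<bar> * x" if "0 \<le> x" for c x :: real using that by (intro mult_right_mono) auto
  have upt: "y \<le> \<bar>c\<bar> * (1 + s powr b)" if "y \<le> c * (1 + s powr b)" for y c s b :: real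
    using that up[of "1 + s powr b" c] by (smt (verit) powr_ge_zero)
  interpret l21_problem \<Omega> \<alpha> t T "\<bar>C1\<bar>" "\<bar>C2\<bar>" "\<bar>C3\<bar>" f u u1 u2 u3 u0 U n
  proof (intro l21_problem.intro l21_problem_axioms.intro bounded_open.intro l21_mesh.intro)
    show "bounded \<Omega>" "open \<Omega>" using assms by (auto simp: lipschitz_domain_def)
    show "H1norm \<Omega> (u1 s) \<le> \<bar>C1\<bar> * (1 + s powr (\<alpha> - 1))" "H1norm \<Omega> (u2 s) \<le> \<bar>C2\<bar> * (1 + s powr (\<alpha> - 2))"
      "H1norm \<Omega> (u3 s) \<le> \<bar>C3\<bar> * (1 + s powr (\<alpha> - 3))" if "s \<in> {0<..T}" for s
      using bounds that by (intro upt; blast)+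
    show "(1 / Gamma (1 - \<alpha>)) * (LBINT r=0..s. (s - r) powr (- \<alpha>) * L2inner \<Omega> (u1 r) v)
          + dform \<Omega> (u s) v = L2inner \<Omega> (f s) v" if "s \<in> {0<..T}" "H01 \<Omega> v" for s v
      using pde that by blast
    show "L2inner \<Omega> (Lstar \<alpha> t U k) v + (1 - \<alpha> / 2) * dform \<Omega> (U k) v
          + (\<alpha> / 2) * dform \<Omega> (U (k - 1)) v = L2inner \<Omega> (f (tstar \<alpha> t k)) v"
      if "1 \<le> k" "k \<le> n" "H01 \<Omega> v" for k v
      using scheme that by (metis atLeastAtMost_iff)
    show "H01 \<Omega> (U k)" if "1 \<le> k" "k \<le> n" for k using scheme that by simp
    show "eta \<le> rho t k" if "2 \<le> k" for k using mesh(3) that by blast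
    show "H01 \<Omega> (u s)" "H01 \<Omega> (u1 s)" "H01 \<Omega> (u2 s)" "H01 \<Omega> (u3 s)" if "s \<in> {0<..T}" for s
      using reg that by blast+
  qed (rule \<alpha> T u0 der init mesh(1,2) U0 tn abs_ge_zero)+
  show "maxk {1..n} (\<lambda>k. L2norm \<Omega> (\<lambda>x. u (t k) x - U k x)) \<le>
      1000 * (\<bar>C1\<bar> + \<bar>C2\<bar> + \<bar>C3\<bar>) * (t 2 powr \<alpha> / \<alpha> + t 2
        + (1 / (1 - \<alpha>)) * maxk {2..n} (\<lambda>k. (1 + rho t (k + 1)) * (1 + t (k - 1) powr (\<alpha> - 3))
              * tstar \<alpha> t (k - 1) powr \<alpha> * tau t k ^ 3 * tau t (k - 1) powr (- \<alpha>))
        + (tau t 1 powr \<alpha> / \<alpha> + tau t 1) * tau t 1 powr (\<alpha> / 2)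
        + sqrt (Gamma (1 - \<alpha>)) * maxk {2..n} (\<lambda>k. tstar \<alpha> t k powr (\<alpha> / 2)
              * (1 + t (k - 1) powr (\<alpha> - 2)) * tau t k ^ 2))"
    by (rule error_bound)
qed

end
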